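(* Let $c>0$ and let $m\colon\mathbb{R}\to\mathbb{R}$ satisfy $m(\xi)\neq c$ for all $\xi\in\mathbb{R}$. Assume that $H_c=\mathscr{F}^{-1}\left(\frac{m}{c-m}\right)\in L^1(\mathbb{R})$ is non-negative, symmetric and monotonically decreasing on $(0,\infty)$. Let $G\colon\mathbb{R}\to\mathbb{R}$ be bounded on compact sets and such that, for some $r>1$, $|G(s)|\lesssim|s|^r$ for all sufficiently small $s$. Let $u$ be a bounded continuous function on $\mathbb{R}$ with $\lim_{|x|\to\infty}u(x)=0$ that is a solution to $$u\left(c-\frac{G(u)}{u}\right)=H_c*G(u),$$ and assume that $G$ is non-negative, increasing, and satisfies $|G(x)-G(y)|\le\tilde c|x-y|$ for all $x,y$ in the range of $u$, for some $0<\tilde c<c$ (non-negativity and monotonicity of $G$ being also required only on the range of $u$). Then $u$ is symmetric about some point $\lambda_0\in\mathbb{R}$ and has exactly one crest, located at $\lambda_0$.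
   Context: The inverse Fourier transform is normalized by $\mathscr{F}^{-1}(\varphi)(x)=\frac{1}{\sqrt{2\pi}}\int_{\mathbb{R}}\varphi(\xi)\mathrm{e}^{ix\xi}\,\mathrm{d}\xi$ (in the sense of tempered distributions where necessary), and $(f*g)(x)=\int_{\mathbb{R}}f(x-y)g(y)\,\mathrm{d}y$. The expression $u\left(c-\frac{G(u)}{u}\right)$ means $cu-G(u)$. Symmetric for $H_c$ means even; $u$ symmetric about $\lambda_0$ means $u(x)=u(2\lambda_0-x)$ for all $x$. A crest of $u$ is a local maximum of the profile $u$. $A\lesssim B$ means $A\le CB$ for some constant $C>0$.
   Formalization: The solution u is assumed not identically zero (for u = 0 every point is a local maximum, so "exactly one crest" fails), and "G increasing" is read as strictly increasing on the range of u (for merely non-decreasing G, two far-apart bumps can solve the equation). *)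

theory Defs
  imports "HOL-Analysis.Analysis"
begin

section \<open>Schwartz functions and tempered distributions on the real line\<close>

definition nth_deriv :: "nat \<Rightarrow> (real \<Rightarrow> complex) \<Rightarrow> real \<Rightarrow> complex" where
  "nth_deriv k \<psi> = ((\<lambda>g x. vector_derivative g (at x)) ^^ k) \<psi>"

definition schwartz_space :: "(real \<Rightarrow> complex) set" where
  "schwartz_space = {\<psi>.
     (\<forall>k x. nth_deriv k \<psi> differentiable (at x)) \<and>
     (\<forall>j k. bounded (range (\<lambda>x. x ^ j *\<^sub>R nth_deriv k \<psi> x)))}"

definition schwartz_seminorm :: "nat \<Rightarrow> nat \<Rightarrow> (real \<Rightarrow> complex) \<Rightarrow> real" where
  "schwartz_seminorm j k \<psi> = (SUP x. norm (x ^ j *\<^sub>R nth_deriv k \<psi> x))"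

text \<open>Linear functionals on the Schwartz space that are continuous, i.e. bounded by finitely many
  of the seminorms. Values outside \<^const>\<open>schwartz_space\<close> are irrelevant.\<close>

definition tempered_distribution :: "((real \<Rightarrow> complex) \<Rightarrow> complex) \<Rightarrow> bool" where
  "tempered_distribution T \<longleftrightarrow>
     (\<forall>\<phi>\<in>schwartz_space. \<forall>\<psi>\<in>schwartz_space. T (\<lambda>x. \<phi> x + \<psi> x) = T \<phi> + T \<psi>) \<and>
     (\<forall>a. \<forall>\<psi>\<in>schwartz_space. T (\<lambda>x. a * \<psi> x) = a * T \<psi>) \<and>
     (\<exists>N C. \<forall>\<psi>\<in>schwartz_space.
        norm (T \<psi>) \<le> C * (\<Sum>j\<le>N. \<Sum>k\<le>N. schwartz_seminorm j k \<psi>))"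

definition distribution_of :: "(real \<Rightarrow> complex) \<Rightarrow> (real \<Rightarrow> complex) \<Rightarrow> complex" where
  "distribution_of f \<psi> = (LINT x|lebesgue. f x * \<psi> x)"

definition tempered_function :: "(real \<Rightarrow> complex) \<Rightarrow> bool" where
  "tempered_function f \<longleftrightarrow>
     (\<forall>\<psi>\<in>schwartz_space. integrable lebesgue (\<lambda>x. f x * \<psi> x)) \<and>
     tempered_distribution (distribution_of f)"

section \<open>The inverse Fourier transform\<close>

definition inv_fourier :: "(real \<Rightarrow> complex) \<Rightarrow> real \<Rightarrow> complex" where
  "inv_fourier \<phi> x =
     of_real (1 / sqrt (2 * pi)) * (LINT \<xi>|lebesgue. \<phi> \<xi> * exp (\<i> * of_real (x * \<xi>)))"

definition inv_fourier_distribution ::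
    "((real \<Rightarrow> complex) \<Rightarrow> complex) \<Rightarrow> (real \<Rightarrow> complex) \<Rightarrow> complex" where
  "inv_fourier_distribution T \<psi> = T (inv_fourier \<psi>)"

text \<open>\<open>has_inv_fourier \<phi> f\<close>: the inverse Fourier transform of \<open>\<phi>\<close>, taken in the sense of tempered
  distributions, is (given by) the function \<open>f\<close>, which is thereby determined up to a null set.\<close>

definition has_inv_fourier :: "(real \<Rightarrow> complex) \<Rightarrow> (real \<Rightarrow> complex) \<Rightarrow> bool" where
  "has_inv_fourier \<phi> f \<longleftrightarrow> tempered_function \<phi> \<and> tempered_function f \<and>
     (\<forall>\<psi>\<in>schwartz_space.
        inv_fourier_distribution (distribution_of \<phi>) \<psi> = distribution_of f \<psi>)"

section \<open>Convolution and crests\<close>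

definition convolution :: "(real \<Rightarrow> real) \<Rightarrow> (real \<Rightarrow> real) \<Rightarrow> real \<Rightarrow> real" where
  "convolution f g x = (LINT y|lebesgue. f (x - y) * g y)"

text \<open>Local maxima are not required to be strict.\<close>

definition crest :: "(real \<Rightarrow> real) \<Rightarrow> real \<Rightarrow> bool" where
  "crest u x \<longleftrightarrow> (\<forall>\<^sub>F y in nhds x. u y \<le> u x)"

end

theory Submission
  imports Defs
begin

text \<open>Put \<open>v = G \<circ> u\<close>. The equation says that \<open>H * v = c u - v\<close>, which is a strictly increasing function
  of the value of \<open>v\<close>; in particular \<open>v\<close> is Lipschitz and integrable. Symmetry is obtained by moving planes.
  Since nothing is known about the decay of \<open>H\<close>, the difficulty is to find a plane to start from.

  Take \<open>0\<close> as origin. For small \<open>t\<close> the component \<open>(-a, b)\<close> of \<open>{v > t}\<close> around the origin leans to the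
  right if \<open>a < b\<close>. Split \<open>v = f + g\<close>, where \<open>f\<close> collects the layers leaning to the right together
  with the part of \<open>v\<close> on the positive axis that lies outside these components, and \<open>g\<close> is the rest.
  Shift \<open>f\<close> to the left by \<open>h\<close>. As \<open>H * v\<close> is a function of \<open>v\<close>, the interaction \<open>\<integral> f (H * g)\<close> changes
  by \<open>o(h)\<close> only. On the other hand every piece of \<open>f\<close> moves towards larger values of \<open>H * g\<close>. So all
  first order contributions vanish: \<open>H * g\<close> agrees at the two ends of almost every layer leaning to the
  right and is constant where \<open>v\<close> exceeds its running minimum. A reflection argument turns this into the
  statement that all sufficiently low layers lean to the same side.

  For every origin \<open>K\<close>, planes can therefore be moved in from the right or from the left. A plane coming
  from the right stops at a point of symmetry, or else at a point \<open>l\<close> below which the layers lean to the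
  left; planes from the left then reach \<open>l\<close> as well, and \<open>v\<close> is symmetric about \<open>l\<close>.\<close>

text \<open>The interaction changes by \<open>o(h)\<close> for three separate reasons. A layer feels
  equal values of \<open>H * v\<close> at its two ends, since \<open>v\<close> takes the same value
  there. The part of \<open>f\<close> outside the layers moves in a potential that is a function of
  \<open>v\<close>, so its contribution is a total difference of an antiderivative, up to an error
  of lower order. The force of \<open>f\<close> on itself vanishes to first order because
  \<open>H\<close> is even. As \<open>H\<close> is only weakly decreasing and may be constant on
  long stretches, an equality such as \<open>(H * g)(l - B) = (H * g)(l + B)\<close> carries
  information only where the reflected kernel difference is positive. A point \<open>R\<close> in
  the support of \<open>- dH\<close> supplies such places, namely
  \<open>|Y - B| < R < Y + B\<close>. This length sets the scale of all reflection arguments: the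
  layers considered reach beyond \<open>- R\<close> and \<open>R\<close>, equalities spread in steps
  shorter than \<open>R\<close>, and what remains to be excluded is a stretch of length
  \<open>R\<close> on which \<open>v\<close> is constant. \<open>H\<close> may also be unbounded
  near the origin; the mass of short intervals around the origin serves as its modulus of continuity
  in \<open>L1\<close>.\<close>

section \<open>Translations, reflections and null sets for Lebesgue measure on the line\<close>

lemma integral_lborel_shift:
  fixes f :: "real \<Rightarrow> real"
  shows "(\<integral>x. f (x + a) \<partial>lborel) = (\<integral>x. f x \<partial>lborel)"
  using lborel_integral_real_affine[of 1 f a] by (simp add: add.commute)

lemma integrable_lborel_shift:
  fixes f :: "real \<Rightarrow> real"
  assumes "integrable lborel f"
  shows "integrable lborel (\<lambda>x. f (x + a))"
  using lborel_integrable_real_affine[OF assms, of 1 a] by (simp add: add.commute)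

lemma integral_lborel_reflect:
  fixes f :: "real \<Rightarrow> real"
  shows "(\<integral>x. f (a - x) \<partial>lborel) = (\<integral>x. f x \<partial>lborel)"
  using lborel_integral_real_affine[of "-1" f a] by simp

lemma integrable_lborel_reflect:
  fixes f :: "real \<Rightarrow> real"
  assumes "integrable lborel f"
  shows "integrable lborel (\<lambda>x. f (a - x))"
  using lborel_integrable_real_affine[OF assms, of "-1" a] by simp

lemma AE_lborel_affine:
  fixes P :: "real \<Rightarrow> bool"
  assumes "AE x in lborel. P x" and c: "c \<noteq> 0"
  shows "AE x in lborel. P (a + c * x)"
proof -
  have "AE x in density (distr lborel borel (\<lambda>x. a + c * x)) (\<lambda>_. ennreal \<bar>c\<bar>). P x"
    using assms(1) by (subst (asm) lborel_real_affine[OF c, of a])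
  then have "AE x in distr lborel borel (\<lambda>x. a + c * x). P x"
    by (subst (asm) AE_density) (use c in auto)
  then show ?thesis
    by (rule AE_distrD[rotated]) simp
qed

lemma AE_lborel_neq: "AE x in lborel. x \<noteq> (a::real)"
  by (rule AE_lborel_singleton)

lemma AE_zero_open:
  fixes F :: "real \<Rightarrow> real"
  assumes "AE x in lborel. F x = 0" and "a < b"
  obtains x where "a < x" "x < b" "F x = 0"
proof -
  have "\<exists>x. a < x \<and> x < b \<and> F x = 0"
  proof (rule ccontr)
    assume *: "\<not> ?thesis"
    have "AE x in lborel. x \<notin> {a<..<b}"
      using assms(1) by eventually_elim (use * in auto)
    then have "{a<..<b} \<in> null_sets lborel"
      by (subst AE_iff_null_sets) auto
    then show False using \<open>a < b\<close> by (simp add: null_sets_def)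
  qed
  then show ?thesis using that by blast
qed

lemma
  fixes f :: "real \<Rightarrow> real"
  assumes "\<And>x y. \<bar>f x - f y\<bar> \<le> C * \<bar>x - y\<bar>"
  shows lipschitz_continuous_on: "continuous_on A f"
    and lipschitz_borel: "f \<in> borel_measurable borel"
proof -
  have "0 \<le> C" using assms[of 0 1] by simp
  then have "C-lipschitz_on B f" for B
    by (intro lipschitz_onI) (use assms in \<open>auto simp: dist_real_def\<close>)
  then have c: "continuous_on B f" for B by (rule lipschitz_on_continuous_on)
  show "continuous_on A f" by (rule c)
  show "f \<in> borel_measurable borel" by (rule borel_measurable_continuous_onI[OF c])
qed

section \<open>Convolution with an even nonnegative kernel that decreases away from the
  origin\<close>

locale kernel =
  fixes H :: "real \<Rightarrow> real"
  assumes H_borel [measurable]: "H \<in> borel_measurable borel"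
    and H_int: "integrable lborel H"
    and H_nn: "\<And>x. 0 \<le> H x"
    and H_even: "\<And>x. H (- x) = H x"
    and H_anti: "\<And>x y. 0 < x \<Longrightarrow> x \<le> y \<Longrightarrow> H y \<le> H x"
begin

lemma H_abs: "H \<bar>x\<bar> = H x"
  by (cases "0 \<le> x") (auto simp: H_even)

text \<open>Monotonicity on the open half-line leaves \<open>H 0\<close> arbitrary, so the point
  closer to the origin must differ from it. This is the source of later exclusions such as
  \<open>Y \<noteq> B\<close>.\<close>

lemma H_le: "x \<noteq> 0 \<Longrightarrow> \<bar>x\<bar> \<le> \<bar>y\<bar> \<Longrightarrow> H y \<le> H x"
  using H_anti[of "\<bar>x\<bar>" "\<bar>y\<bar>"] by (simp add: H_abs)

definition mass :: real where "mass = (\<integral>x. H x \<partial>lborel)"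

lemma mass_nn: "0 \<le> mass"
  unfolding mass_def by (intro Bochner_Integration.integral_nonneg H_nn)

definition conv :: "(real \<Rightarrow> real) \<Rightarrow> real \<Rightarrow> real" where
  "conv w x = (\<integral>y. H (x - y) * w y \<partial>lborel)"

lemma conv_integrable:
  assumes [measurable]: "w \<in> borel_measurable borel" and M: "\<And>y. \<bar>w y\<bar> \<le> M"
  shows "integrable lborel (\<lambda>y. H (x - y) * w y)"
proof (rule Bochner_Integration.integrable_bound)
  show "integrable lborel (\<lambda>y. H (x - y) * M)"
    by (intro integrable_mult_left integrable_lborel_reflect H_int)
  show "AE y in lborel. norm (H (x - y) * w y) \<le> norm (H (x - y) * M)"
    using M H_nn by (intro AE_I2) (simp add: abs_mult mult_left_mono order_trans[OF M abs_ge_self])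
qed measurable

lemma conv_alt: "conv w x = (\<integral>y. H y * w (x - y) \<partial>lborel)"
  unfolding conv_def
  using integral_lborel_reflect[of "\<lambda>y. H (x - y) * w y" x] by simp

lemma conv_nonneg: "(\<And>y. 0 \<le> w y) \<Longrightarrow> 0 \<le> conv w x"
  unfolding conv_def by (intro Bochner_Integration.integral_nonneg mult_nonneg_nonneg H_nn)

lemma conv_add:
  assumes "w \<in> borel_measurable borel" "\<And>y. \<bar>w y\<bar> \<le> M"
    and "w' \<in> borel_measurable borel" "\<And>y. \<bar>w' y\<bar> \<le> M'"
  shows "conv (\<lambda>y. w y + w' y) x = conv w x + conv w' x"
  unfolding conv_def distrib_left
  by (intro Bochner_Integration.integral_add conv_integrable[OF assms(1,2)] conv_integrable[OF assms(3,4)])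

lemma conv_diff:
  assumes "w \<in> borel_measurable borel" "\<And>y. \<bar>w y\<bar> \<le> M"
    and "w' \<in> borel_measurable borel" "\<And>y. \<bar>w' y\<bar> \<le> M'"
  shows "conv (\<lambda>y. w y - w' y) x = conv w x - conv w' x"
  unfolding conv_def right_diff_distrib
  by (intro Bochner_Integration.integral_diff conv_integrable[OF assms(1,2)] conv_integrable[OF assms(3,4)])

lemma conv_cmult: "conv (\<lambda>y. a * w y) x = a * conv w x"
  unfolding conv_def by (simp add: mult.left_commute)

lemma conv_mono:
  assumes "w \<in> borel_measurable borel" "\<And>y. \<bar>w y\<bar> \<le> M"
    and "w' \<in> borel_measurable borel" "\<And>y. \<bar>w' y\<bar> \<le> M'" and "\<And>y. w y \<le> w' y"
  shows "conv w x \<le> conv w' x"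
  unfolding conv_def
  by (intro integral_mono conv_integrable[OF assms(1,2)] conv_integrable[OF assms(3,4)]
      mult_left_mono assms H_nn)

lemma conv_const: "conv (\<lambda>y. a) x = a * mass"
  unfolding conv_alt mass_def by simp

lemma conv_le:
  assumes "w \<in> borel_measurable borel" "\<And>y. \<bar>w y\<bar> \<le> M" "\<And>y. w y \<le> a"
  shows "conv w x \<le> a * mass"
  using conv_mono[of w M "\<lambda>_. a" "\<bar>a\<bar>"] assms by (simp add: conv_const)

lemma conv_abs_le:
  assumes "w \<in> borel_measurable borel" "\<And>y. \<bar>w y\<bar> \<le> M"
  shows "\<bar>conv w x\<bar> \<le> M * mass"
proof -
  have "conv (\<lambda>y. - w y) x = - conv w x"
    using conv_cmult[of "-1" w x] by simp
  moreover have "conv (\<lambda>y. - w y) x \<le> M * mass"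
    using assms abs_le_D2[OF assms(2)] by (intro conv_le[of _ M]) auto
  moreover have "conv w x \<le> M * mass"
    using assms abs_le_D1[OF assms(2)] by (intro conv_le[of _ M]) auto
  ultimately show ?thesis by linarith
qed

lemma conv_shift: "conv (\<lambda>y. w (y + a)) x = conv w (x + a)"
  unfolding conv_alt by (simp add: algebra_simps)

lemma conv_uminus: "conv (\<lambda>y. w (- y)) x = conv w (- x)"
  unfolding conv_alt
  using integral_lborel_reflect[of "\<lambda>y. H y * w (- x - y)" 0] by (simp add: H_even)

lemma conv_lipschitz:
  assumes "w \<in> borel_measurable borel" "\<And>y. \<bar>w y\<bar> \<le> M"
    and L: "\<And>x y. \<bar>w x - w y\<bar> \<le> L * \<bar>x - y\<bar>"
  shows "\<bar>conv w x - conv w y\<bar> \<le> L * mass * \<bar>x - y\<bar>"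
proof -
  have m: "(\<lambda>z. w (z + (y - x))) \<in> borel_measurable borel" using assms(1) by measurable
  have "conv w x - conv w y = conv (\<lambda>z. w z - w (z + (y - x))) x"
    by (subst conv_diff[OF assms(1,2) m assms(2)]) (simp add: conv_shift)
  also have "\<bar>\<dots>\<bar> \<le> (L * \<bar>x - y\<bar>) * mass"
  proof (rule conv_abs_le)
    show "\<bar>w z - w (z + (y - x))\<bar> \<le> L * \<bar>x - y\<bar>" for z using L[of z "z + (y - x)"] by simp
  qed (use assms(1) m in measurable)
  finally show ?thesis by (simp add: mult_ac)
qed

text \<open>Both factors of the integrand are odd in \<open>Y\<close>, so it is nonnegative on the whole line as soon
  as it is for positive \<open>Y\<close>; this avoids integrals over half-lines.\<close>

lemma conv_reflection:
  assumes [measurable]: "w \<in> borel_measurable borel" and M: "\<And>y. \<bar>w y\<bar> \<le> M"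
  shows "2 * (conv w (l - B) - conv w (l + B)) =
      (\<integral>Y. (H (Y - B) - H (Y + B)) * (w (l - Y) - w (l + Y)) \<partial>lborel)"
    and "integrable lborel (\<lambda>Y. (H (Y - B) - H (Y + B)) * (w (l - Y) - w (l + Y)))"
proof -
  have H': "H (- c - Y) = H (c + Y)" for c Y
    using H_even[of "c + Y"] by simp
  have i1: "integrable lborel (\<lambda>Y. H (c + Y) * w (l + Y))" for c
    using integrable_lborel_shift[OF conv_integrable[OF assms, of "l - c"], of l] H'
    by (simp add: algebra_simps)
  have e1: "(\<integral>Y. H (c + Y) * w (l + Y) \<partial>lborel) = conv w (l - c)" for c
    unfolding conv_def
    using integral_lborel_shift[of "\<lambda>y. H (l - c - y) * w y" l] H'
    by (simp add: algebra_simps)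
  have i2: "integrable lborel (\<lambda>Y. H (Y - c) * w (l - Y))" for c
    using integrable_lborel_reflect[OF i1[of c], of 0] H'[of "- c"]
    by (simp add: algebra_simps)
  have e2: "(\<integral>Y. H (Y - c) * w (l - Y) \<partial>lborel) = conv w (l - c)" for c
    using integral_lborel_reflect[of "\<lambda>Y. H (c + Y) * w (l + Y)" 0] e1[of c] H'[of "- c"]
    by (simp add: algebra_simps)
  have eq: "(H (Y - B) - H (Y + B)) * (w (l - Y) - w (l + Y)) =
      H (Y - B) * w (l - Y) - H (-B + Y) * w (l + Y) - H (Y - (-B)) * w (l - Y) + H (B + Y) * w (l + Y)" for Y
    by (simp add: algebra_simps)
  show "integrable lborel (\<lambda>Y. (H (Y - B) - H (Y + B)) * (w (l - Y) - w (l + Y)))"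
    unfolding eq by (intro Bochner_Integration.integrable_add Bochner_Integration.integrable_diff i1 i2)
  note i = i2[of B] i1[of "- B"] i2[of "- B"] i1[of B]
  show "2 * (conv w (l - B) - conv w (l + B)) =
      (\<integral>Y. (H (Y - B) - H (Y + B)) * (w (l - Y) - w (l + Y)) \<partial>lborel)"
    unfolding eq
      Bochner_Integration.integral_add[OF Bochner_Integration.integrable_diff[OF
          Bochner_Integration.integrable_diff[OF i(1,2)] i(3)] i(4)]
      Bochner_Integration.integral_diff[OF Bochner_Integration.integrable_diff[OF i(1,2)] i(3)]
      Bochner_Integration.integral_diff[OF i(1,2)]
    using e1[of B] e1[of "- B"] e2[of B] e2[of "- B"] by simp
qed

lemma H_diff_nonneg:
  assumes "0 < B" "0 < Y" "Y \<noteq> B"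
  shows "H (Y + B) \<le> H (Y - B)"
  by (rule H_le) (use assms in auto)

lemma AE_reflection_nonneg:
  assumes "0 < B" and "\<And>Y. 0 < Y \<Longrightarrow> w (l + Y) \<le> w (l - Y)"
  shows "AE Y in lborel. 0 \<le> (H (Y - B) - H (Y + B)) * (w (l - Y) - w (l + Y))"
proof -
  have *: "0 \<le> (H (Y - B) - H (Y + B)) * (w (l - Y) - w (l + Y))" if "Y \<noteq> B" "Y \<noteq> - B" for Y
  proof -
    consider "0 < Y" | "Y = 0" | "Y < 0" by linarith
    then show ?thesis
    proof cases
      case 1
      then show ?thesis using H_diff_nonneg[OF assms(1) 1 that(1)] assms(2)[OF 1] by simp
    next
      case 3
      have "- Y + B = - (Y - B)" "- Y - B = - (Y + B)" by simp_all
      then have "H (- Y + B) = H (Y - B)" "H (- Y - B) = H (Y + B)"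
        by (simp_all only: H_even)
      then show ?thesis
        using H_diff_nonneg[OF assms(1), of "- Y"] assms(2)[of "- Y"] 3 that
        by (intro mult_nonpos_nonpos) auto
    qed simp
  qed
  show ?thesis
    using AE_lborel_neq[of B] AE_lborel_neq[of "- B"] by eventually_elim (rule *)
qed

lemma conv_reflection_le:
  assumes "w \<in> borel_measurable borel" "\<And>y. \<bar>w y\<bar> \<le> M"
    and "0 \<le> B" and "\<And>Y. 0 < Y \<Longrightarrow> w (l + Y) \<le> w (l - Y)"
  shows "conv w (l + B) \<le> conv w (l - B)"
proof (cases "B = 0")
  case False
  then have "0 \<le> 2 * (conv w (l - B) - conv w (l + B))"
    unfolding conv_reflection(1)[OF assms(1,2)]
    using assms by (intro integral_nonneg_AE AE_reflection_nonneg) auto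
  then show ?thesis by simp
qed simp

lemma conv_reflection_eq_AE:
  assumes "w \<in> borel_measurable borel" "\<And>y. \<bar>w y\<bar> \<le> M"
    and "0 < B" and "\<And>Y. 0 < Y \<Longrightarrow> w (l + Y) \<le> w (l - Y)"
    and "conv w (l - B) = conv w (l + B)"
  shows "AE Y in lborel. (H (Y - B) - H (Y + B)) * (w (l - Y) - w (l + Y)) = 0"
  using conv_reflection(1)[OF assms(1,2), of l B] assms(5)
    integral_nonneg_eq_0_iff_AE[OF conv_reflection(2)[OF assms(1,2), of B l] AE_reflection_nonneg[OF assms(3,4)]]
  by simp

text \<open>\<open>jump R\<close> says that \<open>R\<close> lies in the support of the measure \<open>- dH\<close> on the positive axis.\<close>

definition jump :: "real \<Rightarrow> bool" where
  "jump R \<longleftrightarrow> 0 < R \<and> (\<forall>x y. 0 < x \<longrightarrow> x < R \<longrightarrow> R < y \<longrightarrow> H y < H x)"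

lemma jumpD: "jump R \<Longrightarrow> x \<noteq> 0 \<Longrightarrow> \<bar>x\<bar> < R \<Longrightarrow> R < \<bar>y\<bar> \<Longrightarrow> H y < H x"
  unfolding jump_def by (metis H_abs zero_less_abs_iff)

text \<open>The rigid case of the comparison: \<open>R\<close> separates
  \<open>\<bar>Y - B\<bar>\<close> from \<open>Y + B\<close>, so the kernel difference is positive
  near \<open>Y\<close>. There the reflected difference of \<open>w\<close> vanishes almost
  everywhere, and by continuity it does so at \<open>Y\<close>.\<close>

lemma conv_reflection_eq:
  assumes "continuous_on UNIV w" and M: "\<And>y. \<bar>w y\<bar> \<le> M"
    and "0 < B" and ord: "\<And>Y. 0 < Y \<Longrightarrow> w (l + Y) \<le> w (l - Y)"
    and "conv w (l - B) = conv w (l + B)"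
    and R: "jump R" and Y: "0 < Y" "\<bar>Y - B\<bar> < R" "R < Y + B"
  shows "w (l + Y) = w (l - Y)"
proof (rule ccontr)
  assume ne: "w (l + Y) \<noteq> w (l - Y)"
  have m: "w \<in> borel_measurable borel"
    using assms(1) by (rule borel_measurable_continuous_onI)
  have ae: "AE Y in lborel. (H (Y - B) - H (Y + B)) * (w (l - Y) - w (l + Y)) = 0"
    by (rule conv_reflection_eq_AE[OF m M assms(3,4,5)]) auto
  have "continuous_on UNIV (\<lambda>Y. w (l - Y) - w (l + Y))"
    by (intro continuous_intros continuous_on_compose2[OF assms(1)]) auto
  then have c: "((\<lambda>Y. w (l - Y) - w (l + Y)) \<longlongrightarrow> w (l - Y) - w (l + Y)) (at Y)"
    by (simp add: continuous_on_def)
  have "\<forall>\<^sub>F Z in at Y. 0 < w (l - Z) - w (l + Z)"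
    by (rule order_tendstoD(1)[OF c]) (use ord[OF Y(1)] ne in simp)
  moreover have "\<forall>\<^sub>F Z in at Y. \<bar>Z - B\<bar> < R"
    by (rule order_tendstoD(2)[OF _ Y(2)]) (intro tendsto_intros)
  moreover have "\<forall>\<^sub>F Z in at Y. R < Z + B"
    by (rule order_tendstoD(1)[OF _ Y(3)]) (intro tendsto_intros)
  ultimately have "\<forall>\<^sub>F Z in at Y. 0 < w (l - Z) - w (l + Z) \<and> \<bar>Z - B\<bar> < R \<and> R < Z + B"
    by eventually_elim auto
  then obtain d where d: "d > 0" "\<And>Z. Z \<noteq> Y \<Longrightarrow> dist Z Y < d \<Longrightarrow>
      0 < w (l - Z) - w (l + Z) \<and> \<bar>Z - B\<bar> < R \<and> R < Z + B"
    unfolding eventually_at by auto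
  \<comment> \<open>The interval has to avoid \<open>B\<close>, because \<open>Z = B\<close> would
    evaluate \<open>H\<close> at the origin.\<close>
  obtain a b where ab: "Y < a" "a < b" "b < Y + d" "B \<notin> {a<..<b}"
  proof (cases "B \<le> Y \<or> Y + d \<le> B")
    case True then show ?thesis using that[of "Y + d/3" "Y + d/2"] d(1) by (auto simp: field_simps)
  next
    case False then show ?thesis using that[of "(Y + B)/2" B] by auto
  qed
  obtain Z where Z: "a < Z" "Z < b" "(H (Z - B) - H (Z + B)) * (w (l - Z) - w (l + Z)) = 0"
    using AE_zero_open[OF ae ab(2)] by blast
  have "0 < w (l - Z) - w (l + Z)" "\<bar>Z - B\<bar> < R" "R < Z + B" "Z \<noteq> B"
    using d(2)[of Z] Z ab by (auto simp: dist_real_def)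
  then show False
    using Z(3) jumpD[OF R, of "Z - B" "Z + B"] by auto
qed

end

section \<open>Symmetry of the interaction and the mass of the kernel near the origin\<close>

lemma integrable_indicator_interval [simp]:
  "integrable lborel (indicat_real {a<..<b::real})"
  by (rule integrable_real_indicator) (cases "a \<le> b"; auto)+

context kernel
begin

lemma
  assumes p: "integrable lborel p" and [measurable]: "p \<in> borel_measurable borel"
    and [measurable]: "q \<in> borel_measurable borel" and M: "\<And>y. \<bar>q y\<bar> \<le> M"
  shows conv_symmetric: "(\<integral>x. p x * conv q x \<partial>lborel) = (\<integral>x. q x * conv p x \<partial>lborel)"
    and integrable_mult_conv: "integrable lborel (\<lambda>x. q x * conv p x)"
proof -
  define F where "F = (\<lambda>x y. p x * (H (x - y) * q y))"
  have [measurable]: "case_prod F \<in> borel_measurable (lborel \<Otimes>\<^sub>M lborel)"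
    unfolding F_def by measurable
  have M0: "0 \<le> M" using M[of 0] by linarith
  have ab: "\<bar>F x y\<bar> \<le> \<bar>p x\<bar> * M * H (x - y)" for x y
    using mult_mono[of "\<bar>q y\<bar>" M "\<bar>p x\<bar> * H (x - y)" "\<bar>p x\<bar> * H (x - y)"] M M0 H_nn[of "x - y"]
    by (simp add: F_def abs_mult mult_ac)
  have i1: "integrable lborel (\<lambda>y. \<bar>p x\<bar> * M * H (x - y))" for x
    by (intro integrable_mult_right integrable_lborel_reflect H_int)
  have i2: "integrable lborel (F x)" for x
    by (rule Bochner_Integration.integrable_bound[OF i1]) (use ab M0 H_nn in \<open>auto simp: F_def\<close>)
  have b2: "(\<integral>y. \<bar>F x y\<bar> \<partial>lborel) \<le> \<bar>p x\<bar> * M * mass" for x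
  proof -
    have "(\<integral>y. \<bar>F x y\<bar> \<partial>lborel) \<le> (\<integral>y. \<bar>p x\<bar> * M * H (x - y) \<partial>lborel)"
      by (intro integral_mono i1 integrable_abs i2 ab)
    also have "\<dots> = \<bar>p x\<bar> * M * mass"
      using integral_lborel_reflect[of H x] by (simp add: mass_def)
    finally show ?thesis .
  qed
  have "integrable (lborel \<Otimes>\<^sub>M lborel) (case_prod F)"
  proof (rule lborel_pair.Fubini_integrable)
    have "integrable lborel (\<lambda>x. \<bar>p x\<bar> * M * mass)"
      using p by (intro integrable_mult_left integrable_abs)
    then show "integrable lborel (\<lambda>x. \<integral>y. norm (case_prod F (x, y)) \<partial>lborel)"
      by (rule Bochner_Integration.integrable_bound)
        (use b2 M0 mass_nn in \<open>auto simp: Bochner_Integration.integral_nonneg\<close>)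
  qed (use i2 in auto)
  note F = this
  have s: "(\<integral>x. F x y \<partial>lborel) = q y * conv p y" for y
  proof -
    have "F x y = q y * (H (y - x) * p x)" for x
      using H_even[of "x - y"] by (simp add: F_def)
    then show ?thesis unfolding conv_def by simp
  qed
  have t: "(\<integral>y. F x y \<partial>lborel) = p x * conv q x" for x
    unfolding F_def conv_def by simp
  show "integrable lborel (\<lambda>x. q x * conv p x)"
    using lborel_pair.integrable_snd[OF F] by (simp add: s)
  show "(\<integral>x. p x * conv q x \<partial>lborel) = (\<integral>x. q x * conv p x \<partial>lborel)"
    using lborel_pair.Fubini_integral[OF F] by (simp add: s t)
qed

lemma
  assumes p: "integrable lborel p" and "p \<in> borel_measurable borel"
  shows integral_conv: "(\<integral>x. conv p x \<partial>lborel) = mass * (\<integral>x. p x \<partial>lborel)"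
    and integrable_conv: "integrable lborel (conv p)"
proof -
  have c: "conv (\<lambda>_. 1) x = mass" for x using conv_const[of 1] by simp
  show "(\<integral>x. conv p x \<partial>lborel) = mass * (\<integral>x. p x \<partial>lborel)"
    using conv_symmetric[OF assms, of "\<lambda>_. 1" 1] by (simp add: c mult.commute)
  show "integrable lborel (conv p)"
    using integrable_mult_conv[OF assms, of "\<lambda>_. 1" 1] by simp
qed

text \<open>Plays the role of a modulus: it tends to 0 with \<open>d\<close>, dominates the mass of
  every interval of length \<open>d\<close>, and controls translations of \<open>H\<close> in
  \<open>L1\<close>.\<close>

definition core :: "real \<Rightarrow> real" where
  "core d = (\<integral>z. indicator {-d<..<d} z * H z \<partial>lborel)"

lemma ind_int: "A \<in> sets borel \<Longrightarrow> integrable lborel (\<lambda>z. indicator A z * H (c + z))"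
  using integrable_mult_indicator[of A lborel "\<lambda>z. H (c + z)"]
    integrable_lborel_shift[OF H_int, of c] by (simp add: add.commute)

lemma ind_int0: "A \<in> sets borel \<Longrightarrow> integrable lborel (\<lambda>z. indicator A z * H z)"
  using ind_int[of A 0] by simp

lemma core_nn: "0 \<le> core d"
  unfolding core_def by (intro Bochner_Integration.integral_nonneg mult_nonneg_nonneg H_nn) auto

lemma core_mono: "d \<le> e \<Longrightarrow> core d \<le> core e"
  unfolding core_def by (intro integral_mono ind_int0) (auto simp: indicator_def H_nn)

lemma core_small:
  assumes "0 < e"
  obtains d where "0 < d" "core d < e"
proof -
  have "(\<lambda>n. core (1 / real (Suc n))) \<longlonglongrightarrow> (\<integral>z. 0 \<partial>(lborel :: real measure))"
    unfolding core_def
  proof (rule integral_dominated_convergence[OF _ _ H_int])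
    show "AE z in lborel. (\<lambda>n. indicator {- (1 / real (Suc n))<..<1 / real (Suc n)} z * H z) \<longlonglongrightarrow> 0"
      using AE_lborel_neq[of 0]
    proof eventually_elim
      case (elim z)
      have "\<forall>\<^sub>F n in sequentially. 1 / real (Suc n) < \<bar>z\<bar>"
        using LIMSEQ_inverse_real_of_nat elim
        by (intro order_tendstoD) (auto simp: inverse_eq_divide)
      then have "\<forall>\<^sub>F n in sequentially. indicator {- (1 / real (Suc n))<..<1 / real (Suc n)} z * H z = 0"
        by eventually_elim (auto simp: indicator_def)
      then show ?case by (rule tendsto_eventually)
    qed
  qed (auto simp: indicator_def H_nn)
  then have "\<forall>\<^sub>F n in sequentially. core (1 / real (Suc n)) < e"
    using assms by (intro order_tendstoD(2)) auto
  then obtain n where "core (1 / real (Suc n)) < e" by (auto simp: eventually_sequentially)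
  then show ?thesis using that[of "1 / real (Suc n)"] by simp
qed

text \<open>An interval on one side of the origin gains mass when it is slid until it touches the
  origin; one that contains the origin lies in \<open>{-d<..<d}\<close> already.\<close>

lemma core_interval:
  assumes "0 \<le> d"
  shows "(\<integral>z. indicator {a<..<a + d} z * H z \<partial>lborel) \<le> core d"
proof -
  consider "0 \<le> a" | "a + d \<le> 0" | "a < 0" "0 < a + d" by linarith
  then show ?thesis
  proof cases
    case 1
    have "(\<integral>z. indicator {a<..<a + d} z * H z \<partial>lborel)
        \<le> (\<integral>z. indicator {a<..<a + d} z * H (- a + z) \<partial>lborel)"
      by (intro integral_mono ind_int0 ind_int)
        (use 1 in \<open>auto simp: indicator_def intro!: H_anti\<close>)
    also have "\<dots> = (\<integral>z. indicator {0<..<d} z * H z \<partial>lborel)"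
      using integral_lborel_shift[of "\<lambda>z. indicator {a<..<a + d} z * H (- a + z)" a]
      by (simp add: indicator_def)
    also have "\<dots> \<le> core d"
      unfolding core_def by (intro integral_mono ind_int0) (use assms in \<open>auto simp: indicator_def H_nn\<close>)
    finally show ?thesis .
  next
    case 2
    have "(\<integral>z. indicator {a<..<a + d} z * H z \<partial>lborel)
        \<le> (\<integral>z. indicator {a<..<a + d} z * H (- (a + d) + z) \<partial>lborel)"
      by (intro integral_mono ind_int0 ind_int)
        (use 2 in \<open>auto simp: indicator_def intro!: H_le\<close>)
    also have "\<dots> = (\<integral>z. indicator {-d<..<0} z * H z \<partial>lborel)"
    proof -
      have "indicator {a<..<a + d} (z + (a + d)) = (indicator {-d<..<0} z :: real)" for z
        by (auto simp: indicator_def)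
      then show ?thesis
        using integral_lborel_shift[of "\<lambda>z. indicator {a<..<a + d} z * H (- (a + d) + z)" "a + d"]
        by (simp add: add.commute)
    qed
    also have "\<dots> \<le> core d"
      unfolding core_def by (intro integral_mono ind_int0) (use assms in \<open>auto simp: indicator_def H_nn\<close>)
    finally show ?thesis .
  next
    case 3
    then show ?thesis
      unfolding core_def by (intro integral_mono ind_int0) (auto simp: indicator_def H_nn)
  qed
qed

text \<open>The sign of \<open>H (z + h) - H z\<close> changes at the midpoint
  \<open>- h / 2\<close>. On each side of it the integral telescopes, and only the mass between
  \<open>- h / 2\<close> and \<open>h / 2\<close> survives, once from each side.\<close>

lemma shift_L1:
  assumes h: "0 < h"
  shows "integrable lborel (\<lambda>z. \<bar>H (z + h) - H z\<bar>)"
    and "(\<integral>z. \<bar>H (z + h) - H z\<bar> \<partial>lborel) \<le> 2 * core h"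
proof -
  let ?a = "\<lambda>z. indicator {- h / 2<..} z :: real" and ?b = "\<lambda>z. indicator {..- h / 2} z :: real"
  have i: "integrable lborel (\<lambda>z. indicator A z * H (z + h))"
          "integrable lborel (\<lambda>z. indicator A z * H z)" if "A \<in> sets borel" for A
    using ind_int[OF that, of h] ind_int0[OF that] by (simp_all add: add.commute)
  show "integrable lborel (\<lambda>z. \<bar>H (z + h) - H z\<bar>)"
    by (intro integrable_abs Bochner_Integration.integrable_diff integrable_lborel_shift H_int)
  have "(\<integral>z. \<bar>H (z + h) - H z\<bar> \<partial>lborel) =
      (\<integral>z. ?a z * H z - ?a z * H (z + h) + (?b z * H (z + h) - ?b z * H z) \<partial>lborel)"
  proof (rule integral_cong_AE)
    show "AE z in lborel. \<bar>H (z + h) - H z\<bar> = ?a z * H z - ?a z * H (z + h) + (?b z * H (z + h) - ?b z * H z)"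
      using AE_lborel_neq[of 0] AE_lborel_neq[of "- h"]
    proof eventually_elim
      case (elim z)
      show ?case
      proof (cases "- h / 2 < z")
        case True
        then have "\<bar>z\<bar> \<le> \<bar>z + h\<bar>" using h by linarith
        then show ?thesis using H_le[OF elim(1), of "z + h"] True by (simp add: indicator_def)
      next
        case False
        then have "\<bar>z + h\<bar> \<le> \<bar>z\<bar>" using h by linarith
        then show ?thesis using H_le[of "z + h" z] elim False by (simp add: indicator_def)
      qed
    qed
  qed measurable
  also have "\<dots> = (\<integral>z. ?a z * H z \<partial>lborel) - (\<integral>z. ?a z * H (z + h) \<partial>lborel)
      + ((\<integral>z. ?b z * H (z + h) \<partial>lborel) - (\<integral>z. ?b z * H z \<partial>lborel))"
    by (simp add: i)
  also have "(\<integral>z. ?a z * H (z + h) \<partial>lborel) = (\<integral>z. indicator {h / 2<..} z * H z \<partial>lborel)"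
  proof -
    have "indicator {h / 2<..} (z + h) = ?a z" for z
      by (auto simp: indicator_def field_simps)
    then show ?thesis
      using integral_lborel_shift[of "\<lambda>z. indicator {h / 2<..} z * H z" h] by simp
  qed
  also have "(\<integral>z. ?b z * H (z + h) \<partial>lborel) = (\<integral>z. indicator {..h / 2} z * H z \<partial>lborel)"
  proof -
    have "indicator {..h / 2} (z + h) = ?b z" for z
      by (auto simp: indicator_def field_simps)
    then show ?thesis
      using integral_lborel_shift[of "\<lambda>z. indicator {..h / 2} z * H z" h] by simp
  qed
  also have "(\<integral>z. ?a z * H z \<partial>lborel) - (\<integral>z. indicator {h / 2<..} z * H z \<partial>lborel)
      + ((\<integral>z. indicator {..h / 2} z * H z \<partial>lborel) - (\<integral>z. ?b z * H z \<partial>lborel))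
      = (\<integral>z. ?a z * H z - indicator {h / 2<..} z * H z
          + (indicator {..h / 2} z * H z - ?b z * H z) \<partial>lborel)"
    by (simp add: i)
  also have "\<dots> \<le> (\<integral>z. 2 * (indicator {-h<..<h} z * H z) \<partial>lborel)"
    by (intro integral_mono Bochner_Integration.integrable_add Bochner_Integration.integrable_diff
        integrable_mult_right i) (use h in \<open>auto simp: indicator_def H_nn\<close>)
  also have "\<dots> = 2 * core h" by (simp add: core_def)
  finally show "(\<integral>z. \<bar>H (z + h) - H z\<bar> \<partial>lborel) \<le> 2 * core h" .
qed

lemma core_le_bounded:
  assumes "\<And>x. H x \<le> N" "0 < d"
  shows "core d \<le> 2 * N * d"
proof -
  have N: "0 \<le> N" using H_nn[of 0] assms(1)[of 0] by linarith
  have "core d \<le> (\<integral>z. indicator {-d<..<d} z * N \<partial>lborel)"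
    unfolding core_def
  proof (rule integral_mono)
    show "integrable lborel (\<lambda>z. indicator {-d<..<d} z * N)"
      by (intro integrable_mult_left) simp
  qed (use assms N in \<open>auto intro!: ind_int0 mult_left_mono\<close>)
  also have "\<dots> = 2 * N * d" using assms(2) by simp
  finally show ?thesis .
qed

lemma kernel_min:
  assumes "0 \<le> N"
  shows "kernel (\<lambda>x. min (H x) N)"
proof
  show "integrable lborel (\<lambda>x. min (H x) N)"
    by (rule Bochner_Integration.integrable_bound[OF H_int]) (use assms H_nn in auto)
  show "min (H y) N \<le> min (H x) N" if "0 < x" "x \<le> y" for x y
    using H_anti[OF that] by auto
qed (use assms H_nn H_even in auto)

lemma truncation_small:
  assumes "0 < e"
  obtains N where "0 \<le> N" "(\<integral>x. H x - min (H x) N \<partial>lborel) < e"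
proof -
  have "(\<lambda>n. \<integral>x. H x - min (H x) (real n) \<partial>lborel) \<longlonglongrightarrow> (\<integral>z. 0 \<partial>(lborel :: real measure))"
  proof (rule integral_dominated_convergence[OF _ _ H_int])
    have "(\<lambda>n. H x - min (H x) (real n)) \<longlonglongrightarrow> 0" for x
    proof (rule tendsto_eventually)
      have "\<forall>\<^sub>F n in sequentially. H x \<le> real n"
        using filterlim_real_sequentially by (simp add: filterlim_at_top)
      then show "\<forall>\<^sub>F n in sequentially. H x - min (H x) (real n) = 0"
        by eventually_elim auto
    qed
    then show "AE x in lborel. (\<lambda>n. H x - min (H x) (real n)) \<longlonglongrightarrow> 0" by simp
    show "AE x in lborel. norm (H x - min (H x) (real n)) \<le> H x" for n
      by (rule AE_I2) (use H_nn in \<open>auto simp: min_def\<close>)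
  qed measurable
  then have "\<forall>\<^sub>F n in sequentially. (\<integral>x. H x - min (H x) (real n) \<partial>lborel) < e"
    using assms by (intro order_tendstoD(2)) auto
  then obtain n where "(\<integral>x. H x - min (H x) (real n) \<partial>lborel) < e"
    by (auto simp: eventually_sequentially)
  then show ?thesis using that[of "real n"] by simp
qed

text \<open>Integrability bounds the set where \<open>H\<close> is at least \<open>H z\<close>,
  since \<open>x * H z \<le> mass\<close> for each of its positive points \<open>x\<close>. At the
  supremum of this set \<open>H\<close> passes to values below \<open>H z\<close>.\<close>

lemma jump_exists:
  assumes z: "0 < z" "0 < H z"
  obtains R where "jump R"
proof -
  define S where "S = {x. 0 < x \<and> H z \<le> H x}"
  have zS: "z \<in> S" using z by (simp add: S_def)
  have bd: "x \<le> mass / H z" if "x \<in> S" for x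
  proof -
    have "x * H z = (\<integral>y. indicator {0<..<x} y * H z \<partial>lborel)"
      using that by (simp add: S_def)
    also have "\<dots> \<le> (\<integral>y. H y \<partial>lborel)"
    proof (rule integral_mono)
      show "indicator {0<..<x} y * H z \<le> H y" for y
        using that H_anti[of y x] by (auto simp: S_def indicator_def H_nn intro: order_trans)
    qed (use H_int in auto)
    finally show ?thesis using z by (simp add: mass_def field_simps)
  qed
  then have bdd: "bdd_above S" by (auto simp: bdd_above_def)
  have "jump (Sup S)"
    unfolding jump_def
  proof (intro conjI allI impI)
    show "0 < Sup S" using cSup_upper[OF zS bdd] z(1) by linarith
    fix x y :: real assume x: "0 < x" "x < Sup S" "Sup S < y"
    then obtain s where s: "s \<in> S" "x < s" using less_cSup_iff[of S x] bdd zS by auto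
    have "y \<notin> S" using cSup_upper[of y S] bdd x by auto
    then have "H y < H z" using x by (auto simp: S_def)
    also have "\<dots> \<le> H s" using s by (simp add: S_def)
    also have "\<dots> \<le> H x" using H_anti[OF x(1)] s by simp
    finally show "H y < H x" .
  qed
  then show ?thesis by (rule that)
qed

text \<open>The shifted integrals cancel except on two intervals of length \<open>h\<close>, around
  \<open>R - e\<close> and around \<open>R + e\<close>. As \<open>h < e\<close>, the first lies to
  the left of \<open>R - e / 2\<close> and the second to the right of \<open>R + e / 2\<close>. The
  gain is thus linear in \<open>h\<close> even if \<open>H\<close> has no derivative at
  \<open>R\<close>.\<close>

lemma jump_gain:
  assumes R: "jump R" and e: "0 < e" "2 * e < R"
  obtains q where "0 < q" and "\<And>h. 0 < h \<Longrightarrow> h < e \<Longrightarrow>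
      q * h \<le> (\<integral>Y. indicator {R - e<..<R + e} Y * (H (Y - h / 2) - H (Y + h / 2)) \<partial>lborel)"
proof (rule that)
  let ?q = "H (R - e / 2) - H (R + e / 2)"
  show "0 < ?q" using jumpD[OF R, of "R - e / 2" "R + e / 2"] e by simp
  fix h assume h: "0 < h" "h < e"
  have i: "integrable lborel (\<lambda>z. indicator A z * H (z + c))"
          "integrable lborel (\<lambda>z. indicator A z * H z)"
          "integrable lborel (\<lambda>z. indicator A z * H (z - c))" if "A \<in> sets borel" for A c
    using ind_int[OF that, of c] ind_int[OF that, of "-c"] ind_int0[OF that] by (simp_all add: add.commute)
  have "(\<integral>Y. indicator {R - e<..<R + e} Y * (H (Y - h / 2) - H (Y + h / 2)) \<partial>lborel)
     = (\<integral>Y. indicator {R - e<..<R + e} Y * H (Y - h / 2) \<partial>lborel)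
       - (\<integral>Y. indicator {R - e<..<R + e} Y * H (Y + h / 2) \<partial>lborel)"
    by (simp add: right_diff_distrib i)
  also have "(\<integral>Y. indicator {R - e<..<R + e} Y * H (Y - h / 2) \<partial>lborel)
      = (\<integral>Y. indicator {R - e - h/2<..<R + e - h/2} Y * H Y \<partial>lborel)"
  proof -
    have "indicator {R - e<..<R + e} (z + h/2) = (indicator {R - e - h/2<..<R + e - h/2} z :: real)" for z
      by (auto simp: indicator_def)
    then show ?thesis
      using integral_lborel_shift[of "\<lambda>Y. indicator {R - e<..<R + e} Y * H (Y - h / 2)" "h/2"] by simp
  qed
  also have "(\<integral>Y. indicator {R - e<..<R + e} Y * H (Y + h / 2) \<partial>lborel)
      = (\<integral>Y. indicator {R - e + h/2<..<R + e + h/2} Y * H Y \<partial>lborel)"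
  proof -
    have "indicator {R - e<..<R + e} (z + - h/2) = (indicator {R - e + h/2<..<R + e + h/2} z :: real)" for z
      by (auto simp: indicator_def)
    then show ?thesis
      using integral_lborel_shift[of "\<lambda>Y. indicator {R - e<..<R + e} Y * H (Y + h / 2)" "- h/2"] by simp
  qed
  also have "(\<integral>Y. indicator {R - e - h/2<..<R + e - h/2} Y * H Y \<partial>lborel)
      - (\<integral>Y. indicator {R - e + h/2<..<R + e + h/2} Y * H Y \<partial>lborel)
      = (\<integral>Y. indicator {R - e - h/2<..<R + e - h/2} Y * H Y
          - indicator {R - e + h/2<..<R + e + h/2} Y * H Y \<partial>lborel)"
    by (simp add: i)
  also have "\<dots> \<ge> (\<integral>Y. indicator {R - e - h/2<..<R - e + h/2} Y * H (R - e / 2)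
      - indicator {R + e - h/2<..<R + e + h/2} Y * H (R + e / 2) \<partial>lborel)"
  proof (rule integral_mono_AE)
    have 1: "H (R - e / 2) \<le> H Y" if "R - e - h/2 < Y" "Y < R - e + h/2" for Y
      by (rule H_anti) (use that e h in auto)
    have 2: "H Y \<le> H (R + e / 2)" if "R + e - h/2 < Y" "Y < R + e + h/2" for Y
      by (rule H_anti) (use that e h R in \<open>auto simp: jump_def\<close>)
    show "AE Y in lborel. indicator {R - e - h/2<..<R - e + h/2} Y * H (R - e / 2)
        - indicator {R + e - h/2<..<R + e + h/2} Y * H (R + e / 2)
        \<le> indicator {R - e - h/2<..<R + e - h/2} Y * H Y
          - indicator {R - e + h/2<..<R + e + h/2} Y * H Y"
      using AE_lborel_neq[of "R - e + h/2"] AE_lborel_neq[of "R + e - h/2"]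
    proof eventually_elim
      case (elim Y)
      define p1 p2 p3 p4 where p: "p1 = R - e - h/2" "p2 = R - e + h/2" "p3 = R + e - h/2" "p4 = R + e + h/2"
      have o: "p1 < p2" "p2 < p3" "p3 < p4" using e h by (auto simp: p)
      note eqs = p(1)[symmetric] p(2)[symmetric] p(3)[symmetric] p(4)[symmetric]
      consider "Y \<le> p1" | "p1 < Y" "Y < p2" | "p2 < Y" "Y < p3" | "p3 < Y" "Y < p4" | "p4 \<le> Y"
        using elim unfolding p by linarith
      then show ?case
        unfolding eqs using 1[of Y] 2[of Y] o by cases (auto simp: eqs indicator_def)
    qed
  qed (auto intro!: i Bochner_Integration.integrable_diff)
  also have "(\<integral>Y. indicator {R - e - h/2<..<R - e + h/2} Y * H (R - e / 2)
      - indicator {R + e - h/2<..<R + e + h/2} Y * H (R + e / 2) \<partial>lborel) = ?q * h"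
    using h by (subst Bochner_Integration.integral_diff) (auto simp: algebra_simps)
  finally show "?q * h \<le> (\<integral>Y. indicator {R - e<..<R + e} Y * (H (Y - h / 2) - H (Y + h / 2)) \<partial>lborel)"
    by simp
qed

end

section \<open>Lipschitz continuity and integrability from the equation\<close>

lemma integrable_compact_support:
  fixes f :: "real \<Rightarrow> real"
  assumes "continuous_on UNIV f" and "\<And>x. N \<le> \<bar>x\<bar> \<Longrightarrow> f x = 0"
  shows "integrable lborel f"
proof -
  have "integrable lborel (\<lambda>x. indicator {-N..N} x *\<^sub>R f x)"
    using borel_integrable_compact[of "{-N..N}" f] continuous_on_subset[OF assms(1)] by simp
  moreover have "(\<lambda>x. indicator {-N..N} x *\<^sub>R f x) = f"
  proof
    show "indicator {-N..N} x *\<^sub>R f x = f x" for x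
      using assms(2)[of x] by (cases "N \<le> \<bar>x\<bar>") (auto simp: indicator_def)
  qed
  ultimately show ?thesis by simp
qed

context kernel
begin

text \<open>The singular part of the kernel has small mass and is absorbed by \<open>\<kappa>\<close>;
  the bounded part has bounded variation and smooths.\<close>

lemma lipschitz_of_equation:
  assumes [measurable]: "v \<in> borel_measurable borel" and M: "\<And>y. \<bar>v y\<bar> \<le> M"
    and kap: "0 < \<kappa>"
    and mono: "\<And>x y. v x \<le> v y \<Longrightarrow> \<kappa> * (v y - v x) \<le> conv v y - conv v x"
  obtains L where "0 \<le> L" "\<And>x y. \<bar>v x - v y\<bar> \<le> L * \<bar>x - y\<bar>"
proof -
  obtain N where N: "0 \<le> N" "(\<integral>x. H x - min (H x) N \<partial>lborel) < \<kappa> / 2"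
    using truncation_small[of "\<kappa> / 2"] kap by auto
  define K where "K = (\<lambda>x. min (H x) N)"
  interpret K: kernel K unfolding K_def by (rule kernel_min[OF N(1)])
  have M0: "0 \<le> M" using M[of 0] by linarith
  \<comment> \<open>The supremum \<open>D\<close> of the increments of \<open>v\<close> over
    distance \<open>h\<close> will satisfy \<open>D \<le> 4 * M * N * h / \<kappa> + D / 2\<close>.
    It is finite, so the last term can be absorbed, which doubles the constant.\<close>
  define L where "L = 8 * M * N / \<kappa>"
  have step: "\<bar>v (x + h) - v x\<bar> \<le> L * h" if h: "0 < h" for x h
  proof -
    define w where "w = (\<lambda>y. v (y + h) - v y)"
    have [measurable]: "w \<in> borel_measurable borel" unfolding w_def by measurable
    have wM: "\<bar>w y\<bar> \<le> 2 * M" for y using M[of y] M[of "y + h"] by (simp add: w_def)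
    define D where "D = (SUP y. \<bar>w y\<bar>)"
    have D: "\<bar>w y\<bar> \<le> D" for y
      unfolding D_def by (rule cSUP_upper) (auto intro!: bdd_aboveI2 wM)
    have K1: "\<bar>K.conv w x\<bar> \<le> 4 * M * N * h" for x
    proof -
      have i: "integrable lborel (\<lambda>z. \<bar>K (z + h) - K z\<bar>)" by (rule K.shift_L1(1)[OF h])
      have "K.conv w x = K.conv v (x + h) - K.conv v x"
        unfolding w_def using M by (subst K.conv_diff[of _ M _ M]) (auto simp: K.conv_shift)
      also have "\<dots> = (\<integral>y. (K (x - y + h) - K (x - y)) * v y \<partial>lborel)"
      proof -
        have e: "x + h - y = x - y + h" for y by simp
        show ?thesis
          unfolding K.conv_def left_diff_distrib e
          by (rule Bochner_Integration.integral_diff[symmetric])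
            (use K.conv_integrable[of v M "x + h"] K.conv_integrable[of v M x] M in \<open>simp_all add: e\<close>)
      qed
      also have "\<bar>\<dots>\<bar> \<le> (\<integral>y. \<bar>(K (x - y + h) - K (x - y)) * v y\<bar> \<partial>lborel)"
        by (rule integral_abs_bound)
      also have "\<dots> \<le> (\<integral>y. \<bar>K (x - y + h) - K (x - y)\<bar> * M \<partial>lborel)"
      proof (rule integral_mono')
        show "integrable lborel (\<lambda>y. \<bar>K (x - y + h) - K (x - y)\<bar> * M)"
          using integrable_lborel_reflect[OF i, of x] by (intro integrable_mult_left)
      qed (auto simp: abs_mult M M0 intro!: mult_left_mono)
      also have "\<dots> = (\<integral>z. \<bar>K (z + h) - K z\<bar> \<partial>lborel) * M"
        using integral_lborel_reflect[of "\<lambda>z. \<bar>K (z + h) - K z\<bar>" x] by simp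
      also have "\<dots> \<le> (2 * (2 * N * h)) * M"
      proof (rule mult_right_mono[OF _ M0])
        have "K.core h \<le> 2 * N * h" by (rule K.core_le_bounded) (use h in \<open>auto simp: K_def\<close>)
        then show "(\<integral>z. \<bar>K (z + h) - K z\<bar> \<partial>lborel) \<le> 2 * (2 * N * h)"
          using K.shift_L1(2)[OF h] by linarith
      qed
      finally show ?thesis by (simp add: mult_ac)
    qed
    have K2: "\<bar>conv w x - K.conv w x\<bar> \<le> D * (\<kappa> / 2)" for x
    proof -
      have D0: "0 \<le> D" using D[of 0] by linarith
      have i: "integrable lborel (\<lambda>z. H z - K z)"
        by (intro Bochner_Integration.integrable_diff H_int K.H_int)
      have "conv w x - K.conv w x = (\<integral>y. (H (x - y) - K (x - y)) * w y \<partial>lborel)"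
        unfolding conv_def K.conv_def left_diff_distrib
        by (rule Bochner_Integration.integral_diff[symmetric])
          (use conv_integrable[of w "2 * M" x] K.conv_integrable[of w "2 * M" x] wM in simp_all)
      also have "\<bar>\<dots>\<bar> \<le> (\<integral>y. \<bar>(H (x - y) - K (x - y)) * w y\<bar> \<partial>lborel)"
        by (rule integral_abs_bound)
      also have "\<dots> \<le> (\<integral>y. (H (x - y) - K (x - y)) * D \<partial>lborel)"
      proof (rule integral_mono')
        show "integrable lborel (\<lambda>y. (H (x - y) - K (x - y)) * D)"
          using integrable_lborel_reflect[OF i, of x] by (intro integrable_mult_left)
      qed (auto simp: abs_mult D D0 K_def intro!: mult_mono)
      also have "\<dots> = (\<integral>z. H z - K z \<partial>lborel) * D"
        using integral_lborel_reflect[of "\<lambda>z. H z - K z" x] by simp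
      also have "\<dots> \<le> (\<kappa> / 2) * D"
        using N(2) D0 by (intro mult_right_mono) (auto simp: K_def)
      finally show ?thesis by (simp add: mult_ac)
    qed
    have "\<bar>w y\<bar> \<le> 4 * M * N * h / \<kappa> + D / 2" for y
    proof -
      have "\<kappa> * \<bar>w y\<bar> \<le> \<bar>conv v (y + h) - conv v y\<bar>"
        using mono[of y "y + h"] mono[of "y + h" y] kap
        by (cases "v y \<le> v (y + h)") (auto simp: w_def abs_if algebra_simps)
      also have "conv v (y + h) - conv v y = conv w y"
        unfolding w_def using M by (subst conv_diff[of _ M _ M]) (auto simp: conv_shift)
      also have "\<bar>\<dots>\<bar> \<le> 4 * M * N * h + D * (\<kappa> / 2)"
        using K1[of y] K2[of y] by linarith
      finally show ?thesis using kap by (simp add: field_simps)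
    qed
    then have "D \<le> 4 * M * N * h / \<kappa> + D / 2"
      unfolding D_def by (intro cSUP_least) auto
    then have "D \<le> L * h" by (simp add: L_def)
    then show ?thesis using D[of x] by (simp add: w_def)
  qed
  have "\<bar>v x - v y\<bar> \<le> L * \<bar>x - y\<bar>" for x y
  proof -
    consider "x < y" | "x = y" | "y < x" by linarith
    then show ?thesis
      by cases (use step[of "y - x" x] step[of "x - y" y] in \<open>simp_all add: abs_minus_commute\<close>)
  qed
  moreover have "0 \<le> L" using M0 N kap by (simp add: L_def)
  ultimately show ?thesis using that by blast
qed

text \<open>The truncations \<open>(u - s)\<^sup>+\<close> are compactly supported, hence integrable for free, and the
  equation bounds their integrals uniformly in \<open>s\<close>.\<close>

lemma integrable_of_equation:
  assumes u: "continuous_on UNIV u" "(u \<longlongrightarrow> 0) at_infinity" "\<And>x. 0 \<le> u x"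
    and v: "continuous_on UNIV v" "\<And>x. 0 \<le> v x" "\<And>x. v x \<le> M"
    and c: "0 < c" and eq: "\<And>x. c * u x = v x + conv v x"
    and small: "\<And>e. 0 < e \<Longrightarrow> \<exists>N. \<forall>x. N \<le> \<bar>x\<bar> \<longrightarrow> v x \<le> e * u x"
  shows "integrable lborel v"
proof -
  have [measurable]: "u \<in> borel_measurable borel" "v \<in> borel_measurable borel"
    using u(1) v(1) by (auto intro: borel_measurable_continuous_onI)
  \<comment> \<open>The part \<open>e * u\<close> of \<open>v\<close> enters the equation through
    \<open>v + conv v\<close>, with total weight \<open>e * (1 + mass)\<close>; this choice makes it
    half of \<open>c\<close>.\<close>
  define e where "e = c / (2 * (1 + mass))"
  have e: "0 < e" "e * (1 + mass) = c / 2" using c mass_nn by (auto simp: e_def field_simps)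
  obtain N where N: "\<And>x. N \<le> \<bar>x\<bar> \<Longrightarrow> v x \<le> e * u x" using small[OF e(1)] by blast
  have vM: "\<bar>v x\<bar> \<le> M" for x using v(2,3)[of x] by simp
  have uM: "u x \<le> M * (1 + mass) / c" for x
  proof -
    have "conv v x \<le> M * mass" using vM v(3) by (intro conv_le) auto
    then have "c * u x \<le> M * (1 + mass)" using eq[of x] v(3)[of x] by (simp add: algebra_simps)
    then show ?thesis using c by (simp add: field_simps)
  qed
  define U where "U = M * (1 + mass) / c"
  \<comment> \<open>The excess of \<open>v\<close> over \<open>e * u\<close> vanishes outside a
    compact set, by the choice of \<open>N\<close>.\<close>
  define k where "k = (\<lambda>x. max 0 (v x - e * u x))"
  define E where "E = (\<lambda>s x. max 0 (u x - s))"
  have [measurable]: "k \<in> borel_measurable borel" "E s \<in> borel_measurable borel" for s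
    unfolding k_def E_def by measurable
  have kM: "\<bar>k x\<bar> \<le> M" for x
  proof -
    have "0 \<le> e * u x" using e(1) u(3)[of x] by simp
    then show ?thesis using v(2,3)[of x] unfolding k_def by linarith
  qed
  have EM: "\<bar>E s x\<bar> \<le> U" if "0 < s" for s x
    using uM[of x] u(3)[of x] that by (auto simp: E_def U_def max_def)
  have ik: "integrable lborel k"
    unfolding k_def using N
    by (intro integrable_compact_support[of _ N] continuous_intros u v) (auto simp: max_def intro: antisym)
  have iE: "integrable lborel (E s)" if s: "0 < s" for s
  proof -
    have "\<forall>\<^sub>F x in at_infinity. u x < s" using u(2) s by (rule order_tendstoD)
    then obtain B where "\<And>x. B \<le> \<bar>x\<bar> \<Longrightarrow> u x < s" by (auto simp: eventually_at_infinity)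
    then show ?thesis
      unfolding E_def
      by (intro integrable_compact_support[of _ B] continuous_intros u) (force simp: max_def)
  qed
  define C where "C = (\<integral>x. k x + conv k x \<partial>lborel)"
  \<comment> \<open>Lowering the truncation from \<open>s\<close> to \<open>s / 2\<close> pays for
    the constant: replacing \<open>u\<close> by \<open>E s + s\<close> costs
    \<open>e * s * (1 + mass) = c * (s / 2)\<close>.\<close>
  have pw: "c * E (s / 2) x \<le> k x + conv k x + (e * E s x + e * conv (E s) x)" if s: "0 < s" for s x
  proof (cases "u x \<le> s / 2")
    case True
    have "0 \<le> k x" "0 \<le> conv k x" "0 \<le> e * E s x" "0 \<le> e * conv (E s) x"
      using e(1) by (auto intro!: mult_nonneg_nonneg conv_nonneg simp: k_def E_def)
    moreover have "E (s / 2) x = 0" using True by (simp add: E_def)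
    ultimately show ?thesis by simp
  next
    case False
    have "conv v x \<le> conv (\<lambda>y. k y + (e * E s y + e * s)) x"
    proof (rule conv_mono)
      show "v y \<le> k y + (e * E s y + e * s)" for y
      proof -
        have "e * u y \<le> e * (E s y + s)" using e(1) by (intro mult_left_mono) (auto simp: E_def)
        then show ?thesis by (simp add: k_def algebra_simps)
      qed
      show "\<bar>k y + (e * E s y + e * s)\<bar> \<le> M + (e * U + e * s)" for y
      proof -
        have "0 \<le> k y" "0 \<le> e * E s y" "0 \<le> e * s"
          using e(1) s by (auto intro!: mult_nonneg_nonneg simp: k_def E_def)
        moreover have "e * E s y \<le> e * U"
          using e(1) EM[OF s, of y] by (intro mult_left_mono) auto
        ultimately show ?thesis using kM[of y] by linarith
      qed
    qed (use vM in auto)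
    also have "\<dots> = conv k x + (e * conv (E s) x + e * s * mass)"
    proof -
      have eE: "\<bar>e * E s y\<bar> \<le> e * U" for y
        using e(1) EM[OF s, of y] by (simp add: abs_mult)
      have "conv (\<lambda>y. e * E s y + e * s) x = e * conv (E s) x + e * s * mass"
        by (subst conv_add[of _ "e * U" _ "\<bar>e * s\<bar>"]) (simp_all add: eE conv_cmult conv_const)
      moreover have "\<bar>e * E s y + e * s\<bar> \<le> e * U + \<bar>e * s\<bar>" for y
        using eE[of y] by linarith
      ultimately show ?thesis
        by (subst conv_add[of _ M _ "e * U + \<bar>e * s\<bar>"]) (simp_all add: kM)
    qed
    finally have "c * u x \<le> v x + conv k x + (e * conv (E s) x + e * s * mass)"
      using eq[of x] by simp
    moreover have "v x \<le> k x + e * E s x + e * s"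
    proof -
      have "e * u x \<le> e * (E s x + s)" using e(1) by (intro mult_left_mono) (auto simp: E_def)
      then show ?thesis by (simp add: k_def algebra_simps)
    qed
    moreover have "e * s + e * s * mass = c * (s / 2)"
      using arg_cong[OF e(2), of "\<lambda>t. t * s"] by (simp add: algebra_simps)
    moreover have "c * E (s / 2) x = c * u x - c * (s / 2)"
      using False by (simp add: E_def right_diff_distrib max_def)
    ultimately show ?thesis by linarith
  qed
  have bnd: "(\<integral>x. E (s / 2) x \<partial>lborel) \<le> 2 * C / c" if s: "0 < s" for s
  proof -
    have i: "integrable lborel (conv k)" "integrable lborel (conv (E s))"
      by (intro integrable_conv ik iE s; measurable)+
    have "c * (\<integral>x. E (s / 2) x \<partial>lborel) = (\<integral>x. c * E (s / 2) x \<partial>lborel)" by simp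
    also have "\<dots> \<le> (\<integral>x. k x + conv k x + (e * E s x + e * conv (E s) x) \<partial>lborel)"
      using s by (intro integral_mono pw Bochner_Integration.integrable_add integrable_mult_right ik iE i) auto
    also have "\<dots> = C + (e * (\<integral>x. E s x \<partial>lborel) + e * (mass * (\<integral>x. E s x \<partial>lborel)))"
      using s by (simp add: C_def ik iE i integral_conv)
    also have "\<dots> = C + c / 2 * (\<integral>x. E s x \<partial>lborel)"
      unfolding e(2)[symmetric] by (simp add: algebra_simps)
    \<comment> \<open>\<open>E s \<le> E (s / 2)\<close> brings the same integral to both sides. It
      is finite, so half of it can be absorbed, and the resulting bound does not depend on
      \<open>s\<close>.\<close>
    also have "\<dots> \<le> C + c / 2 * (\<integral>x. E (s / 2) x \<partial>lborel)"
      using c s by (intro add_left_mono mult_left_mono integral_mono iE) (auto simp: E_def)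
    finally show ?thesis using c by (simp add: field_simps)
  qed
  have "(\<integral>\<^sup>+x. ennreal (u x) \<partial>lborel) = (\<integral>\<^sup>+x. liminf (\<lambda>n. ennreal (E (1 / real (Suc n) / 2) x)) \<partial>lborel)"
  proof (rule nn_integral_cong)
    fix x
    have "(\<lambda>n. max 0 (u x - 1 / real (Suc n) / 2)) \<longlonglongrightarrow> max 0 (u x - 0 / 2)"
      using LIMSEQ_inverse_real_of_nat unfolding inverse_eq_divide
      by (intro tendsto_intros) auto
    then have "(\<lambda>n. ennreal (E (1 / real (Suc n) / 2) x)) \<longlonglongrightarrow> ennreal (u x)"
      using u(3)[of x] by (intro tendsto_ennrealI) (simp add: E_def max_def)
    then show "ennreal (u x) = liminf (\<lambda>n. ennreal (E (1 / real (Suc n) / 2) x))"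
      by (simp add: lim_imp_Liminf)
  qed
  also have "\<dots> \<le> liminf (\<lambda>n. \<integral>\<^sup>+x. ennreal (E (1 / real (Suc n) / 2) x) \<partial>lborel)"
    by (rule nn_integral_liminf) measurable
  also have "\<dots> \<le> ennreal (2 * C / c)"
  proof (rule Liminf_le)
    have "(\<integral>\<^sup>+x. ennreal (E (1 / real (Suc n) / 2) x) \<partial>lborel) \<le> ennreal (2 * C / c)" for n
    proof -
      have "(\<integral>\<^sup>+x. ennreal (E (1 / real (Suc n) / 2) x) \<partial>lborel)
          = ennreal (\<integral>x. E (1 / real (Suc n) / 2) x \<partial>lborel)"
        by (intro nn_integral_eq_integral iE) (auto simp: E_def)
      then show ?thesis using bnd[of "1 / real (Suc n)"] by (simp add: ennreal_leI)
    qed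
    then show "\<forall>\<^sub>F n in sequentially.
        (\<integral>\<^sup>+x. ennreal (E (1 / real (Suc n) / 2) x) \<partial>lborel) \<le> ennreal (2 * C / c)"
      by simp
  qed simp
  finally have iu: "integrable lborel u"
    by (intro integrableI_nonneg) (use u(3) in \<open>auto simp: le_less_trans\<close>)
  show ?thesis
  proof (rule Bochner_Integration.integrable_bound)
    show "integrable lborel (\<lambda>x. c * u x)" using iu by simp
    show "AE x in lborel. norm (v x) \<le> norm (c * u x)"
      using eq v(2) conv_nonneg[of v] by (intro AE_I2) (simp add: order_trans[OF _ abs_ge_self])
  qed measurable
qed

end

section \<open>Level intervals around the origin and the splitting of a profile\<close>

text \<open>\<open>low v x\<close> is the minimum of \<open>v\<close> between \<open>0\<close> and \<open>x\<close>, so \<open>{x. t < low v x}\<close> is the component of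
  \<open>{x. t < v x}\<close> around \<open>0\<close>. At a level in \<open>right_levels v\<close> this component leans to the right; the rational
  \<open>q\<close> makes the set visibly Borel. For \<open>S = right_levels v\<close> the
  summands \<open>f\<close> and \<open>g\<close> of \<open>v\<close> are \<open>part v S\<close> and \<open>copart v S\<close>. Allowing any set \<open>S\<close> that \<open>splits v\<close> makes the situation
  symmetric under reflection, where \<open>S\<close> becomes \<open>- S\<close> and balanced levels change sides.\<close>

definition low :: "(real \<Rightarrow> real) \<Rightarrow> real \<Rightarrow> real" where
  "low v x = (INF s\<in>{0..1}. v (s * x))"

text \<open>The right end of the component; it is meaningful for \<open>0 < t < v 0\<close>. The
  left end is obtained from the reflected function.\<close>

definition reach :: "(real \<Rightarrow> real) \<Rightarrow> real \<Rightarrow> real" where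
  "reach v t = Sup {y. 0 \<le> y \<and> t < low v y}"

definition right_levels :: "(real \<Rightarrow> real) \<Rightarrow> real set" where
  "right_levels v = {t. \<exists>q\<in>\<rat>. 0 \<le> q \<and> low v (- q) \<le> t \<and> t < low v q}"

definition splits :: "(real \<Rightarrow> real) \<Rightarrow> real set \<Rightarrow> bool" where
  "splits v S \<longleftrightarrow> S \<in> sets borel \<and>
     (\<forall>t\<in>S. \<forall>y\<ge>0. t < low v (- y) \<longrightarrow> t < low v y) \<and>
     (\<forall>t. t \<notin> S \<longrightarrow> (\<forall>y\<ge>0. t < low v y \<longrightarrow> t < low v (- y)))"

text \<open>A layer-cake weight: with \<open>s = low v x\<close> it is what the layers in
  \<open>S\<close> contribute to \<open>low v x\<close>.\<close>

definition count :: "real set \<Rightarrow> real \<Rightarrow> real" where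
  "count S s = measure lborel (S \<inter> {0<..<s})"

definition part :: "(real \<Rightarrow> real) \<Rightarrow> real set \<Rightarrow> real \<Rightarrow> real" where
  "part v S x = count S (low v x) + (if 0 < x then v x - low v x else 0)"

lemma low_reflect: "low (\<lambda>x. v (- x)) x = low v (- x)"
  by (simp add: low_def)

lemma low_0 [simp]: "low v 0 = v 0"
  by (simp add: low_def)

lemma splits_reflect: "splits v S \<Longrightarrow> splits (\<lambda>x. v (- x)) (- S)"
  by (auto simp: splits_def low_reflect sets.compl_sets[of S borel, simplified] Compl_eq_Diff_UNIV)

lemma fmeasurable_levels:
  fixes a b :: real
  assumes "S \<in> sets borel"
  shows "S \<inter> {a<..<b} \<in> fmeasurable lborel"
proof -
  have "emeasure lborel (S \<inter> {a<..<b}) \<le> emeasure lborel {a<..<b}"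
    by (rule emeasure_mono) auto
  moreover have "emeasure lborel {a<..<b} < \<infinity>" by (cases "a \<le> b") auto
  ultimately show ?thesis using assms by (auto simp: fmeasurable_def)
qed

lemma count_mono: "S \<in> sets borel \<Longrightarrow> s \<le> t \<Longrightarrow> count S s \<le> count S t"
  unfolding count_def by (intro measure_mono_fmeasurable fmeasurable_levels) (auto intro: sets.Int)

lemma count_nonneg: "0 \<le> count S s"
  by (simp add: count_def)

lemma count_compl:
  assumes "S \<in> sets borel" "0 \<le> s"
  shows "count S s + count (- S) s = s"
proof -
  have "- S \<in> sets borel" using assms(1) by (rule borel_comp)
  then have "measure lborel ((S \<inter> {0<..<s}) \<union> (- S \<inter> {0<..<s}))
      = measure lborel (S \<inter> {0<..<s}) + measure lborel (- S \<inter> {0<..<s})"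
    using assms(1) by (intro measure_Un3[THEN trans] fmeasurable_levels) (auto simp: Int_commute)
  moreover have "(S \<inter> {0<..<s}) \<union> (- S \<inter> {0<..<s}) = {0<..<s}" by auto
  ultimately show ?thesis using assms(2) by (simp add: count_def)
qed

text \<open>The counts of \<open>S\<close> and of its complement are both increasing and add up to
  the identity.\<close>

lemma count_lipschitz:
  assumes "S \<in> sets borel" "0 \<le> s" "0 \<le> t"
  shows "\<bar>count S s - count S t\<bar> \<le> \<bar>s - t\<bar>"
  using count_compl[OF assms(1,2)] count_compl[OF assms(1,3)]
    count_mono[OF assms(1), of s t] count_mono[OF assms(1), of t s]
    count_mono[OF borel_comp[OF assms(1)], of s t] count_mono[OF borel_comp[OF assms(1)], of t s]
  by linarith

lemma count_strict:
  assumes "S \<in> sets borel" "0 \<le> s" and pos: "\<And>e. 0 < e \<Longrightarrow> emeasure lborel (S \<inter> {s<..<s + e}) \<noteq> 0"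
    and "s < t"
  shows "count S s < count S t"
proof -
  let ?A = "S \<inter> {0<..<s}" and ?B = "S \<inter> {s<..<t}"
  have f: "?A \<in> fmeasurable lborel" "?B \<in> fmeasurable lborel" "S \<inter> {0<..<t} \<in> fmeasurable lborel"
    by (intro fmeasurable_levels assms(1))+
  have "emeasure lborel ?B \<noteq> 0" using pos[of "t - s"] \<open>s < t\<close> by simp
  then have "measure lborel ?B > 0"
    using f(2) by (metis emeasure_eq_measure2 ennreal_0 zero_less_measure_iff)
  moreover have "measure lborel ?A + measure lborel ?B = measure lborel (?A \<union> ?B)"
  proof -
    have "?A \<inter> ?B = {}" by auto
    then show ?thesis using measure_Un3[OF f(1,2)] by simp
  qed
  moreover have "measure lborel (?A \<union> ?B) \<le> measure lborel (S \<inter> {0<..<t})"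
    using f assms by (intro measure_mono_fmeasurable) (auto intro: fmeasurableD)
  ultimately show ?thesis by (simp add: count_def)
qed

section \<open>Integrable Lipschitz profiles whose convolution increases with the level\<close>

locale profile = kernel +
  fixes v :: "real \<Rightarrow> real" and \<kappa> \<Lambda> R :: real
  assumes v_pos: "\<And>x. 0 < v x"
    and v_lim: "(v \<longlongrightarrow> 0) at_infinity"
    and v_int: "integrable lborel v"
    and v_lip: "\<And>x y. \<bar>v x - v y\<bar> \<le> \<Lambda> * \<bar>x - y\<bar>"
    and \<kappa>_pos: "0 < \<kappa>"
    and v_mono: "\<And>x y. v x \<le> v y \<Longrightarrow> \<kappa> * (v y - v x) \<le> conv v y - conv v x"
    and R: "jump R"
begin

lemma R_pos: "0 < R"
  using R by (simp add: jump_def)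

lemma \<Lambda>_nn: "0 \<le> \<Lambda>"
  using v_lip[of 0 1] by simp

lemma v_cont: "continuous_on A v"
  by (rule lipschitz_continuous_on[OF v_lip])

lemma v_borel [measurable]: "v \<in> borel_measurable borel"
  by (rule borel_measurable_continuous_onI[OF v_cont])

lemma v_bounded: obtains M where "\<And>x. v x \<le> M"
proof -
  have "\<forall>\<^sub>F x in at_infinity. v x < 1" using v_lim by (rule order_tendstoD) simp
  then obtain B where B: "\<And>x. B \<le> \<bar>x\<bar> \<Longrightarrow> v x < 1" by (auto simp: eventually_at_infinity)
  have "v x \<le> 1 + v 0 + \<Lambda> * \<bar>B\<bar>" for x
  proof (cases "B \<le> \<bar>x\<bar>")
    case True
    then show ?thesis using B[of x] v_pos[of 0] mult_nonneg_nonneg[OF \<Lambda>_nn, of "\<bar>B\<bar>"] by simp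
  next
    case False
    then have "\<Lambda> * \<bar>x\<bar> \<le> \<Lambda> * \<bar>B\<bar>" using \<Lambda>_nn by (intro mult_left_mono) auto
    then show ?thesis using v_lip[of x 0] by simp
  qed
  then show ?thesis by (rule that)
qed

definition height :: real where "height = (SUP x. v x)"

lemma v_le_height: "v x \<le> height"
proof -
  obtain M where "\<And>x. v x \<le> M" using v_bounded by blast
  then have "bdd_above (range v)" by (rule bdd_aboveI2)
  then show ?thesis unfolding height_def by (intro cSUP_upper) auto
qed

lemma v_abs_le: "\<bar>v x\<bar> \<le> height"
  using v_le_height[of x] v_pos[of x] by simp

text \<open>Interpreting the locale at the reflected profile turns every statement about the right
  into one about the left.\<close>

lemma profile_reflect: "profile H (\<lambda>x. v (- x)) \<kappa> \<Lambda> R"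
proof
  show "((\<lambda>x. v (- x)) \<longlongrightarrow> 0) at_infinity"
    using v_lim unfolding tendsto_iff eventually_at_infinity by (metis norm_minus_cancel)
  show "integrable lborel (\<lambda>x. v (- x))"
    using integrable_lborel_reflect[OF v_int, of 0] by simp
  show "\<bar>v (- x) - v (- y)\<bar> \<le> \<Lambda> * \<bar>x - y\<bar>" for x y
    using v_lip[of "- x" "- y"] by (simp add: abs_minus_commute)
  show "\<kappa> * (v (- y) - v (- x)) \<le> conv (\<lambda>x. v (- x)) y - conv (\<lambda>x. v (- x)) x"
    if "v (- x) \<le> v (- y)" for x y
    using v_mono[OF that] by (simp add: conv_uminus)
qed (use v_pos \<kappa>_pos R in auto)

text \<open>Level intervals use the origin as base point; translation moves it to an arbitrary
  \<open>K\<close>.\<close>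

lemma profile_translate: "profile H (\<lambda>x. v (x + a)) \<kappa> \<Lambda> R"
proof
  have "filterlim (\<lambda>x. x + a) at_infinity (at_infinity :: real filter)"
    by (rule tendsto_add_filterlim_at_infinity'[OF filterlim_ident tendsto_const])
  then show "((\<lambda>x. v (x + a)) \<longlongrightarrow> 0) at_infinity"
    by (rule filterlim_compose[OF v_lim])
  show "integrable lborel (\<lambda>x. v (x + a))"
    by (rule integrable_lborel_shift[OF v_int])
  show "\<bar>v (x + a) - v (y + a)\<bar> \<le> \<Lambda> * \<bar>x - y\<bar>" for x y
    using v_lip[of "x + a" "y + a"] by simp
  show "\<kappa> * (v (y + a) - v (x + a)) \<le> conv (\<lambda>x. v (x + a)) y - conv (\<lambda>x. v (x + a)) x"
    if "v (x + a) \<le> v (y + a)" for x y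
    using v_mono[OF that] by (simp add: conv_shift)
qed (use v_pos \<kappa>_pos R in auto)

lemma conv_eq: "v x = v y \<Longrightarrow> conv v x = conv v y"
  using v_mono[of x y] v_mono[of y x] by simp

lemma conv_less: "v x < v y \<Longrightarrow> conv v x < conv v y"
proof -
  assume "v x < v y"
  then have "0 < \<kappa> * (v y - v x)" using \<kappa>_pos by simp
  then show ?thesis using v_mono[of x y] \<open>v x < v y\<close> by simp
qed

lemma conv_le_iff: "conv v x \<le> conv v y \<longleftrightarrow> v x \<le> v y"
  using conv_eq[of x y] conv_less[of x y] conv_less[of y x] by (cases "v x" "v y" rule: linorder_cases) auto

subsection \<open>Running minima and level intervals\<close>

lemma low_le: "0 \<le> s \<Longrightarrow> s \<le> 1 \<Longrightarrow> low v x \<le> v (s * x)"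
  unfolding low_def using v_pos by (intro cINF_lower bdd_belowI2[where m=0]) (auto intro: less_imp_le)

lemma low_le_v: "low v x \<le> v x"
  using low_le[of 1 x] by simp

lemma low_le_0: "low v x \<le> v 0"
  using low_le[of 0 x] by simp

lemma low_attained: obtains s where "0 \<le> s" "s \<le> 1" "low v x = v (s * x)"
proof -
  have "continuous_on {0..1} (\<lambda>s. v (s * x))"
    by (intro continuous_on_compose2[OF v_cont[of UNIV]] continuous_intros) auto
  then obtain s where s: "s \<in> {0..1}" "\<And>t. t \<in> {0..1} \<Longrightarrow> v (s * x) \<le> v (t * x)"
    using continuous_attains_inf[of "{0..1::real}" "\<lambda>s. v (s * x)"] by auto
  then have "v (s * x) \<le> low v x" unfolding low_def by (intro cINF_greatest) auto
  then show ?thesis using that[of s] s(1) low_le[of s x] by auto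
qed

lemma low_pos: "0 < low v x"
  using low_attained[of x] v_pos by metis

lemma low_scale:
  assumes "0 \<le> r" "r \<le> 1" shows "low v y \<le> low v (r * y)"
proof -
  obtain s where s: "0 \<le> s" "s \<le> 1" "low v (r * y) = v (s * (r * y))" using low_attained .
  have "low v y \<le> v ((s * r) * y)" using s assms by (intro low_le) (auto intro: mult_le_one)
  then show ?thesis using s(3) by (simp add: mult.assoc)
qed

lemma low_anti: "0 \<le> x \<Longrightarrow> x \<le> y \<Longrightarrow> low v y \<le> low v x"
  using low_scale[of "x / y" y] by (cases "y = 0") (auto simp: divide_le_eq_1)

lemma low_anti_neg: "y \<le> x \<Longrightarrow> x \<le> 0 \<Longrightarrow> low v y \<le> low v x"
  using low_scale[of "x / y" y] by (cases "y = 0") (auto simp: divide_le_eq_1 zero_le_divide_iff)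

lemma low_lip_le: "low v x \<le> low v y + \<Lambda> * \<bar>x - y\<bar>"
proof -
  obtain s where s: "0 \<le> s" "s \<le> 1" "low v y = v (s * y)" using low_attained .
  have "low v x \<le> v (s * x)" using s by (intro low_le)
  also have "\<dots> \<le> v (s * y) + \<Lambda> * \<bar>s * x - s * y\<bar>" using v_lip[of "s * x" "s * y"] by linarith
  also have "\<bar>s * x - s * y\<bar> = s * \<bar>x - y\<bar>"
    using s by (simp add: right_diff_distrib[symmetric] abs_mult)
  also have "\<Lambda> * (s * \<bar>x - y\<bar>) \<le> \<Lambda> * \<bar>x - y\<bar>"
    using s \<Lambda>_nn by (intro mult_left_mono) (auto intro: mult_left_le_one_le)
  finally show ?thesis using s(3) by simp
qed

lemma low_lip: "\<bar>low v x - low v y\<bar> \<le> \<Lambda> * \<bar>x - y\<bar>"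
  using low_lip_le[of x y] low_lip_le[of y x] by (simp add: abs_minus_commute)

lemma low_cont: "continuous_on A (low v)"
  by (rule lipschitz_continuous_on[OF low_lip])

lemma low_borel [measurable]: "low v \<in> borel_measurable borel"
  by (rule borel_measurable_continuous_onI[OF low_cont])

lemma low_lim: "(low v \<longlongrightarrow> 0) at_infinity"
  by (rule tendsto_sandwich[OF _ _ tendsto_const v_lim])
    (use low_pos low_le_v in \<open>auto simp: less_imp_le\<close>)

lemma level_bdd: assumes "0 < t" obtains B where "\<And>y. t < low v y \<Longrightarrow> \<bar>y\<bar> < B"
proof -
  have "\<forall>\<^sub>F y in at_infinity. low v y < t" using low_lim assms by (rule order_tendstoD)
  then obtain B where "\<And>y. B \<le> \<bar>y\<bar> \<Longrightarrow> low v y < t" by (auto simp: eventually_at_infinity)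
  then show ?thesis using that[of B] by (meson not_le order.asym)
qed

lemma reach_iff:
  assumes t: "0 < t" and y: "0 \<le> y" "t < v 0"
  shows "t < low v y \<longleftrightarrow> y < reach v t"
proof -
  let ?S = "{y. 0 \<le> y \<and> t < low v y}"
  obtain B where B: "\<And>y. t < low v y \<Longrightarrow> \<bar>y\<bar> < B" using level_bdd[OF t] by blast
  have bdd: "bdd_above ?S" by (rule bdd_aboveI[of _ B]) (use B in force)
  have ne: "0 \<in> ?S" using y by simp
  show ?thesis
  proof
    assume *: "t < low v y"
    have "((\<lambda>z. low v z) \<longlongrightarrow> low v y) (at y)"
      using low_cont[of UNIV] by (simp add: continuous_on_def)
    then have "\<forall>\<^sub>F z in at y. t < low v z" using * by (rule order_tendstoD)
    then obtain d where d: "d > 0" "\<And>z. z \<noteq> y \<Longrightarrow> dist z y < d \<Longrightarrow> t < low v z"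
      unfolding eventually_at by auto
    have "y + d / 2 \<in> ?S" using d(2)[of "y + d / 2"] d(1) y by (simp add: dist_real_def)
    then show "y < reach v t"
      unfolding reach_def using cSup_upper[OF _ bdd] d(1) by fastforce
  next
    assume "y < reach v t"
    then obtain z where "z \<in> ?S" "y < z"
      unfolding reach_def using less_cSup_iff[OF _ bdd] ne by blast
    then show "t < low v y" using low_anti[OF y(1), of z] by auto
  qed
qed

lemma reach_pos: "0 < t \<Longrightarrow> t < v 0 \<Longrightarrow> 0 < reach v t"
  using reach_iff[of t 0] by simp

lemma low_reach:
  assumes t: "0 < t" "t < v 0" shows "low v (reach v t) = t"
proof (rule antisym)
  let ?b = "reach v t"
  have b: "0 < ?b" by (rule reach_pos[OF t])
  show "low v ?b \<le> t" using reach_iff[OF t(1) _ t(2), of ?b] b by simp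
  show "t \<le> low v ?b"
  proof (rule ccontr)
    assume "\<not> ?thesis"
    then have "low v ?b < t" by simp
    moreover have "((\<lambda>z. low v z) \<longlongrightarrow> low v ?b) (at ?b)"
      using low_cont[of UNIV] by (simp add: continuous_on_def)
    ultimately have "\<forall>\<^sub>F z in at ?b. low v z < t" by (intro order_tendstoD)
    then obtain d where d: "d > 0" "\<And>z. z \<noteq> ?b \<Longrightarrow> dist z ?b < d \<Longrightarrow> low v z < t"
      unfolding eventually_at by auto
    define z where "z = max 0 (?b - d / 2)"
    have z: "0 \<le> z" "z < ?b" "dist z ?b < d" using b d(1) by (auto simp: z_def dist_real_def max_def)
    then show False using d(2)[of z] reach_iff[OF t(1) z(1) t(2)] by auto
  qed
qed

text \<open>At every smaller nonnegative argument \<open>low v\<close> still exceeds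
  \<open>t\<close>, so the minimum in \<open>low v (reach v t) = t\<close> can only be attained at
  the end point itself.\<close>

lemma v_reach:
  assumes t: "0 < t" "t < v 0" shows "v (reach v t) = t"
proof -
  let ?b = "reach v t"
  have b: "0 < ?b" by (rule reach_pos[OF t])
  obtain s where s: "0 \<le> s" "s \<le> 1" "low v ?b = v (s * ?b)" using low_attained .
  show ?thesis
  proof (cases "s = 1")
    case True then show ?thesis using s(3) low_reach[OF t] by simp
  next
    case False
    then have "s * ?b < ?b" using s b by simp
    then have "t < low v (s * ?b)" using reach_iff[OF t(1) _ t(2), of "s * ?b"] s b by simp
    also have "\<dots> \<le> v (s * ?b)" by (rule low_le_v)
    finally show ?thesis using s(3) low_reach[OF t] by simp
  qed
qed

lemma reach_anti:
  assumes "0 < s" "s \<le> t" "t < v 0" shows "reach v t \<le> reach v s"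
proof (rule ccontr)
  assume "\<not> ?thesis"
  then have "t < low v (reach v s)"
    using reach_iff[of t "reach v s"] reach_pos[of s] assms by auto
  then show False using low_reach[of s] assms by simp
qed

lemma level_iff:
  assumes t: "0 < t" "t < v 0"
  shows "t < low v x \<longleftrightarrow> - reach (\<lambda>x. v (- x)) t < x \<and> x < reach v t"
proof -
  interpret m: profile H "\<lambda>x. v (- x)" \<kappa> \<Lambda> R by (rule profile_reflect)
  show ?thesis
  proof (cases "0 \<le> x")
    case True
    then show ?thesis using reach_iff[OF t(1) True t(2)] m.reach_pos[of t] t by auto
  next
    case False
    then show ?thesis
      using m.reach_iff[of t "- x"] reach_pos[of t] t by (auto simp: low_reflect)
  qed
qed

lemma right_levels_iff:
  "t \<in> right_levels v \<longleftrightarrow> (\<exists>y\<ge>0. low v (- y) \<le> t \<and> t < low v y)"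
proof
  assume "\<exists>y\<ge>0. low v (- y) \<le> t \<and> t < low v y"
  then obtain y where y: "0 \<le> y" "low v (- y) \<le> t" "t < low v y" by blast
  have "((\<lambda>z. low v z) \<longlongrightarrow> low v y) (at y)"
    using low_cont[of UNIV] by (simp add: continuous_on_def)
  then have "\<forall>\<^sub>F z in at y. t < low v z" using y(3) by (rule order_tendstoD)
  then obtain d where d: "d > 0" "\<And>z. z \<noteq> y \<Longrightarrow> dist z y < d \<Longrightarrow> t < low v z"
    unfolding eventually_at by auto
  obtain q where q: "q \<in> \<rat>" "y < q" "q < y + d" using Rats_dense_in_real[of y "y + d"] d(1) by auto
  have "low v (- q) \<le> low v (- y)" using q y by (intro low_anti_neg) auto
  then show "t \<in> right_levels v"
    unfolding right_levels_def using q y d(2)[of q] by (auto simp: dist_real_def intro!: bexI[of _ q])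
qed (auto simp: right_levels_def)

lemma right_levels_borel: "right_levels v \<in> sets borel"
proof -
  have "right_levels v = (\<Union>q\<in>\<rat> \<inter> {0..}. {low v (- q)..<low v q})"
    by (auto simp: right_levels_def)
  also have "\<dots> \<in> sets borel"
    by (intro sets.countable_UN'' countable_Int1 countable_rat) auto
  finally show ?thesis .
qed

lemma splits_right_levels: "splits v (right_levels v)"
  unfolding splits_def
proof (intro conjI ballI allI impI right_levels_borel)
  fix t y :: real assume t: "t \<in> right_levels v" and y: "0 \<le> y" "t < low v (- y)"
  obtain z where z: "0 \<le> z" "low v (- z) \<le> t" "t < low v z" using t right_levels_iff by blast
  have "y \<le> z" using low_anti_neg[of "- y" "- z"] y z by force
  then show "t < low v y" using low_anti[OF y(1), of z] z by simp
next
  fix t y :: real assume "t \<notin> right_levels v" "0 \<le> y" "t < low v y"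
  then show "t < low v (- y)" using right_levels_iff[of t] by force
qed

lemma right_levels_reach:
  assumes t: "0 < t" "t < v 0"
  shows "t \<in> right_levels v \<longleftrightarrow> reach (\<lambda>x. v (- x)) t < reach v t"
proof -
  interpret m: profile H "\<lambda>x. v (- x)" \<kappa> \<Lambda> R by (rule profile_reflect)
  have "(\<exists>y\<ge>0. low v (- y) \<le> t \<and> t < low v y)
      \<longleftrightarrow> (\<exists>y\<ge>0. reach (\<lambda>x. v (- x)) t \<le> y \<and> y < reach v t)"
    using reach_iff[of t] m.reach_iff[of t] t by (auto simp: low_reflect not_less[symmetric])
  also have "\<dots> \<longleftrightarrow> reach (\<lambda>x. v (- x)) t < reach v t"
    using m.reach_pos[of t] t by (auto intro: exI[of _ "reach (\<lambda>x. v (- x)) t"])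
  finally show ?thesis by (simp add: right_levels_iff)
qed

lemma splits_reach:
  assumes "splits v S" and t: "0 < t" "t < v 0" "t \<in> S"
  shows "reach (\<lambda>x. v (- x)) t \<le> reach v t"
proof (rule ccontr)
  interpret m: profile H "\<lambda>x. v (- x)" \<kappa> \<Lambda> R by (rule profile_reflect)
  assume "\<not> ?thesis"
  then have "t < low v (- reach v t)"
    using m.reach_iff[of t "reach v t"] reach_pos[of t] t by (simp add: low_reflect)
  then have "t < low v (reach v t)"
    using assms(1) t reach_pos[of t] by (auto simp: splits_def)
  then show False using low_reach[of t] t by simp
qed

subsection \<open>The two parts of a profile\<close>

lemma part_sum:
  assumes "S \<in> sets borel"
  shows "part v S x + part (\<lambda>x. v (- x)) (- S) (- x) = v x"
proof -
  have "count S (low v x) + count (- S) (low v x) = low v x"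
    by (rule count_compl[OF assms less_imp_le[OF low_pos]])
  then show ?thesis
    unfolding part_def low_reflect minus_minus
    by (cases "x = 0") (auto split: if_splits)
qed

lemma part_nonneg: "0 \<le> part v S x"
  using count_nonneg[of S "low v x"] low_le_v[of x] by (simp add: part_def)

lemma part_le:
  assumes "S \<in> sets borel" shows "part v S x \<le> v x"
proof -
  interpret m: profile H "\<lambda>x. v (- x)" \<kappa> \<Lambda> R by (rule profile_reflect)
  show ?thesis using part_sum[OF assms, of x] m.part_nonneg[of "- S" "- x"] by linarith
qed

lemma part_lip:
  assumes "S \<in> sets borel"
  shows "\<bar>part v S x - part v S y\<bar> \<le> 3 * \<Lambda> * \<bar>x - y\<bar>"
proof -
  \<comment> \<open>As \<open>v\<close> and \<open>low v\<close> agree at 0, the case distinction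
    can be moved into the argument. This leaves three terms with Lipschitz constant
    \<open>\<Lambda>\<close> each.\<close>
  have e: "part v S z = count S (low v z) + (v (max z 0) - low v (max z 0))" for z
    by (cases "0 < z") (simp_all add: part_def max_def)
  have "\<bar>max x 0 - max y 0\<bar> \<le> \<bar>x - y\<bar>" by linarith
  then have "\<Lambda> * \<bar>max x 0 - max y 0\<bar> \<le> \<Lambda> * \<bar>x - y\<bar>" by (rule mult_left_mono[OF _ \<Lambda>_nn])
  then have 1: "\<bar>v (max x 0) - v (max y 0)\<bar> \<le> \<Lambda> * \<bar>x - y\<bar>"
    and 2: "\<bar>low v (max x 0) - low v (max y 0)\<bar> \<le> \<Lambda> * \<bar>x - y\<bar>"
    using v_lip[of "max x 0" "max y 0"] low_lip[of "max x 0" "max y 0"] by (auto intro: order_trans)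
  have 3: "\<bar>count S (low v x) - count S (low v y)\<bar> \<le> \<Lambda> * \<bar>x - y\<bar>"
    by (rule order_trans[OF count_lipschitz[OF assms] low_lip]) (intro less_imp_le low_pos)+
  have "\<bar>a + b - c\<bar> \<le> 3 * p" if "\<bar>a\<bar> \<le> p" "\<bar>b\<bar> \<le> p" "\<bar>c\<bar> \<le> p" for a b c p :: real
    using that by linarith
  from this[OF 3 1 2] show ?thesis by (simp add: e algebra_simps)
qed

lemma part_cont:
  assumes "S \<in> sets borel" shows "continuous_on A (part v S)"
  by (rule lipschitz_continuous_on[OF part_lip[OF assms]])

lemma part_borel: "S \<in> sets borel \<Longrightarrow> part v S \<in> borel_measurable borel"
  by (rule borel_measurable_continuous_onI[OF part_cont])

lemma part_abs_le: "S \<in> sets borel \<Longrightarrow> \<bar>part v S x\<bar> \<le> height"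
  using part_nonneg[of S x] part_le[of S x] v_le_height[of x] by simp

lemma part_int: "S \<in> sets borel \<Longrightarrow> integrable lborel (part v S)"
  by (rule Bochner_Integration.integrable_bound[OF v_int])
    (use part_borel part_nonneg part_le v_pos in \<open>auto simp: less_imp_le\<close>)

text \<open>On the negative axis only layers count, and each layer in \<open>S\<close> that contains
  \<open>- y\<close> contains \<open>y\<close> too, hence everything in between. In this sense the
  part leans to the right; it is the form that the reflection comparison uses.\<close>

lemma part_dominated:
  assumes S: "splits v S" and z: "\<bar>z\<bar> \<le> y"
  shows "part v S (- y) \<le> part v S z"
proof -
  have b: "S \<in> sets borel" using S by (simp add: splits_def)
  have y: "0 \<le> y" using z by simp
  have "part v S (- y) = count S (low v (- y))" using y by (simp add: part_def)
  also have "\<dots> \<le> count S (low v z)"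
  proof (cases "z \<le> 0")
    case True
    then show ?thesis using z by (intro count_mono[OF b] low_anti_neg) auto
  next
    case False
    have "count S (low v (- y)) \<le> count S (low v y)"
      unfolding count_def using S y
      by (intro measure_mono_fmeasurable fmeasurable_levels b) (auto simp: splits_def)
    also have "\<dots> \<le> count S (low v z)" using False z by (intro count_mono[OF b] low_anti) auto
    finally show ?thesis .
  qed
  also have "\<dots> \<le> part v S z" using low_le_v[of z] by (simp add: part_def)
  finally show ?thesis .
qed

end

section \<open>First order effect of small translations\<close>

lemma integrable_mult_bounded:
  fixes p q :: "real \<Rightarrow> real"
  assumes "integrable lborel p" "q \<in> borel_measurable borel" "\<And>x. \<bar>q x\<bar> \<le> M"
  shows "integrable lborel (\<lambda>x. p x * q x)"
proof (rule Bochner_Integration.integrable_bound)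
  show "integrable lborel (\<lambda>x. p x * M)" using assms(1) by simp
  show "AE x in lborel. norm (p x * q x) \<le> norm (p x * M)"
    by (intro AE_I2) (simp add: abs_mult mult_left_mono order_trans[OF assms(3) abs_ge_self])
qed (use borel_measurable_integrable[OF assms(1)] assms(2) in measurable)

text \<open>The identity \<open>\<bar>a - b\<bar> = a + b - 2 * min a b\<close> reduces the claim to
  integrals of minima, which \<open>f\<close> dominates.\<close>

lemma L1_shift:
  fixes f :: "real \<Rightarrow> real"
  assumes f: "continuous_on UNIV f" "\<And>x. 0 \<le> f x" and i: "integrable lborel f"
  shows "((\<lambda>h. \<integral>x. \<bar>f x - f (x - h)\<bar> \<partial>lborel) \<longlongrightarrow> 0) (at 0)"
proof -
  have [measurable]: "f \<in> borel_measurable borel" using f(1) by (rule borel_measurable_continuous_onI)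
  have i': "integrable lborel (\<lambda>x. f (x - h))" for h
    using integrable_lborel_shift[OF i, of "- h"] by simp
  have im: "integrable lborel (\<lambda>x. min (f x) (f (x - h)))" for h
    by (rule Bochner_Integration.integrable_bound[OF i]) (use f(2) in auto)
  have "((\<lambda>h. \<integral>x. min (f x) (f (x - h)) \<partial>lborel) \<longlongrightarrow> (\<integral>x. f x \<partial>lborel)) (at 0)"
    unfolding tendsto_at_iff_sequentially
  proof (intro allI impI)
    fix X :: "nat \<Rightarrow> real" assume X: "X \<longlonglongrightarrow> 0"
    have "(\<lambda>n. \<integral>x. min (f x) (f (x - X n)) \<partial>lborel) \<longlonglongrightarrow> (\<integral>x. f x \<partial>lborel)"
    proof (rule integral_dominated_convergence[OF _ _ i])
      have "(\<lambda>n. min (f x) (f (x - X n))) \<longlonglongrightarrow> min (f x) (f (x - 0))" for x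
        by (intro tendsto_intros continuous_on_tendsto_compose[OF f(1)] X) auto
      then show "AE x in lborel. (\<lambda>n. min (f x) (f (x - X n))) \<longlonglongrightarrow> f x" by simp
    qed (use f(2) in auto)
    then show "((\<lambda>h. \<integral>x. min (f x) (f (x - h)) \<partial>lborel) \<circ> X) \<longlonglongrightarrow> (\<integral>x. f x \<partial>lborel)"
      by (simp add: o_def)
  qed
  then have "((\<lambda>h. 2 * (\<integral>x. f x \<partial>lborel) - 2 * (\<integral>x. min (f x) (f (x - h)) \<partial>lborel)) \<longlongrightarrow>
      2 * (\<integral>x. f x \<partial>lborel) - 2 * (\<integral>x. f x \<partial>lborel)) (at 0)"
    by (intro tendsto_intros)
  moreover have "(\<integral>x. \<bar>f x - f (x - h)\<bar> \<partial>lborel)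
      = 2 * (\<integral>x. f x \<partial>lborel) - 2 * (\<integral>x. min (f x) (f (x - h)) \<partial>lborel)" for h
  proof -
    have "\<bar>f x - f (x - h)\<bar> = f x + f (x - h) - 2 * min (f x) (f (x - h))" for x
      by (simp add: min_def)
    then show ?thesis
      using integral_lborel_shift[of f "- h"] by (simp add: i i' im)
  qed
  ultimately show ?thesis by simp
qed

text \<open>After a change of variables only two strips of width \<open>h\<close> remain, one at
  each end of the interval. Replacing the function by its value at the end point costs at most
  \<open>C * h\<^sup>2\<close> in each.\<close>

lemma interval_shift_estimate:
  fixes \<theta> :: "real \<Rightarrow> real"
  assumes lip: "\<And>x y. \<bar>\<theta> x - \<theta> y\<bar> \<le> C * \<bar>x - y\<bar>" and h: "0 < h" and ab: "a \<le> b"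
  shows "\<bar>(\<integral>x. indicator {a<..<b} x * (\<theta> (x - h) - \<theta> x) \<partial>lborel) - h * (\<theta> a - \<theta> b)\<bar> \<le> 2 * C * h\<^sup>2"
proof -
  have C0: "0 \<le> C" using lip[of 0 1] by simp
  have cont: "continuous_on UNIV \<theta>" by (rule lipschitz_continuous_on[OF lip])
  have i: "integrable lborel (\<lambda>x. indicator {p<..<q} x * \<theta> (x + r))" for p q r
  proof -
    have "integrable lborel (\<lambda>x. indicator {p..q} x *\<^sub>R \<theta> (x + r))"
      by (intro borel_integrable_compact continuous_on_compose2[OF cont] continuous_intros) auto
    then have "integrable lborel (\<lambda>x. indicator {p<..<q} x *\<^sub>R (indicator {p..q} x *\<^sub>R \<theta> (x + r)))"
      by (rule integrable_mult_indicator[rotated]) simp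
    moreover have "(\<lambda>x. indicator {p<..<q} x *\<^sub>R (indicator {p..q} x *\<^sub>R \<theta> (x + r)))
        = (\<lambda>x. indicator {p<..<q} x * \<theta> (x + r))"
      by (auto simp: indicator_def fun_eq_iff)
    ultimately show ?thesis by metis
  qed
  note i0 = i[of _ _ 0, simplified]
  have im: "integrable lborel (\<lambda>x. indicator {p<..<q} x * \<theta> (x - r))" for p q r
    using i[of p q "- r"] by simp
  have near: "\<bar>(\<integral>x. indicator {p - h<..<p} x * \<theta> x \<partial>lborel) - h * \<theta> p\<bar> \<le> C * h\<^sup>2" for p
  proof -
    have "(\<integral>x. indicator {p - h<..<p} x * \<theta> x \<partial>lborel) - h * \<theta> p
        = (\<integral>x. indicator {p - h<..<p} x * \<theta> x - indicator {p - h<..<p} x * \<theta> p \<partial>lborel)"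
      using h by (simp add: i0)
    also have "\<bar>\<dots>\<bar> \<le> (\<integral>x. indicator {p - h<..<p} x * (C * h) \<partial>lborel)"
    proof (rule integral_abs_bound_integral)
      show "\<bar>indicator {p - h<..<p} x * \<theta> x - indicator {p - h<..<p} x * \<theta> p\<bar>
          \<le> indicator {p - h<..<p} x * (C * h)" for x
        using lip[of x p] mult_left_mono[of "\<bar>x - p\<bar>" h C] C0 by (auto simp: indicator_def)
    qed (auto intro!: i0 Bochner_Integration.integrable_diff integrable_mult_left)
    also have "\<dots> = C * h\<^sup>2" using h by (simp add: power2_eq_square)
    finally show ?thesis .
  qed
  have "(\<integral>x. indicator {a<..<b} x * (\<theta> (x - h) - \<theta> x) \<partial>lborel)
      = (\<integral>x. indicator {a<..<b} x * \<theta> (x - h) \<partial>lborel) - (\<integral>x. indicator {a<..<b} x * \<theta> x \<partial>lborel)"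
    by (simp add: right_diff_distrib im i0)
  also have "(\<integral>x. indicator {a<..<b} x * \<theta> (x - h) \<partial>lborel)
      = (\<integral>x. indicator {a - h<..<b - h} x * \<theta> x \<partial>lborel)"
  proof -
    have "indicator {a<..<b} (x + h) = (indicator {a - h<..<b - h} x :: real)" for x
      by (auto simp: indicator_def)
    then show ?thesis
      using integral_lborel_shift[of "\<lambda>x. indicator {a<..<b} x * \<theta> (x - h)" h] by simp
  qed
  also have "(\<integral>x. indicator {a - h<..<b - h} x * \<theta> x \<partial>lborel) - (\<integral>x. indicator {a<..<b} x * \<theta> x \<partial>lborel)
      = (\<integral>x. indicator {a - h<..<b - h} x * \<theta> x - indicator {a<..<b} x * \<theta> x \<partial>lborel)"
    by (simp add: i0)
  also have "\<dots> = (\<integral>x. indicator {a - h<..<a} x * \<theta> x - indicator {b - h<..<b} x * \<theta> x \<partial>lborel)"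
  proof (rule integral_cong_AE)
    show "AE x in lborel. indicator {a - h<..<b - h} x * \<theta> x - indicator {a<..<b} x * \<theta> x
        = indicator {a - h<..<a} x * \<theta> x - indicator {b - h<..<b} x * \<theta> x"
      using AE_lborel_neq[of a] AE_lborel_neq[of "b - h"]
      by eventually_elim (use ab h in \<open>auto simp: indicator_def\<close>)
  qed (use borel_measurable_continuous_onI[OF cont] in measurable)
  also have "\<dots> = (\<integral>x. indicator {a - h<..<a} x * \<theta> x \<partial>lborel) - (\<integral>x. indicator {b - h<..<b} x * \<theta> x \<partial>lborel)"
    by (simp add: i0)
  finally show ?thesis
    using near[of a] near[of b] by (simp add: algebra_simps abs_le_iff)
qed

context profile
begin

text \<open>\<open>3 * \<Lambda>\<close> is the Lipschitz constant of the parts of \<open>v\<close>,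
  so one constant serves for the convolutions with \<open>v\<close> and with both parts.\<close>

definition lc :: real where "lc = 3 * \<Lambda> * mass"

lemma lc_nn: "0 \<le> lc"
  using \<Lambda>_nn mass_nn by (simp add: lc_def)

lemma conv_v_lip: "\<bar>conv v x - conv v y\<bar> \<le> lc * \<bar>x - y\<bar>"
proof -
  have "\<bar>conv v x - conv v y\<bar> \<le> \<Lambda> * mass * \<bar>x - y\<bar>"
    by (rule conv_lipschitz[OF v_borel v_abs_le v_lip])
  also have "\<dots> \<le> lc * \<bar>x - y\<bar>"
    using \<Lambda>_nn mass_nn by (intro mult_right_mono) (auto simp: lc_def)
  finally show ?thesis .
qed

lemma conv_part_lip:
  assumes "S \<in> sets borel"
  shows "\<bar>conv (part v S) x - conv (part v S) y\<bar> \<le> lc * \<bar>x - y\<bar>"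
  using conv_lipschitz[OF part_borel part_abs_le part_lip, OF assms assms assms] by (simp add: lc_def)

text \<open>As the interaction is symmetric and translation invariant, twice the integral equals
  that of \<open>(f x - f (x - h)) * (conv f (x - h) - conv f x)\<close> with
  \<open>f = part v S\<close>. The second factor is \<open>O(h)\<close>, and the first tends to 0 in
  \<open>L1\<close>.\<close>

lemma self_interaction:
  assumes S: "S \<in> sets borel"
  shows "((\<lambda>h. (\<integral>x. part v S x * (conv (part v S) (x - h) - conv (part v S) x) \<partial>lborel) / h) \<longlongrightarrow> 0) (at_right 0)"
proof -
  define f where "f = part v S"
  note fm [measurable] = part_borel[OF S, folded f_def]
  note fi = part_int[OF S, folded f_def] and fM = part_abs_le[OF S, folded f_def]
  have cM: "\<bar>conv f x\<bar> \<le> height * mass" for x by (rule conv_abs_le[OF fm fM])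
  have cl: "\<bar>conv f x - conv f y\<bar> \<le> lc * \<bar>x - y\<bar>" for x y
    using conv_part_lip[OF S] by (simp add: f_def)
  have [measurable]: "conv f \<in> borel_measurable borel" by (rule lipschitz_borel[OF cl])
  have i: "integrable lborel (\<lambda>x. f (x - a) * conv f (x - b))" for a b
    by (rule integrable_mult_bounded[OF _ _ cM])
      (use integrable_lborel_shift[OF fi, of "- a"] in simp_all)
  have i00: "integrable lborel (\<lambda>x. f x * conv f x)" using i[of 0 0] by simp
  have i0: "integrable lborel (\<lambda>x. f x * conv f (x - b))" for b using i[of 0 b] by simp
  have i1: "integrable lborel (\<lambda>x. f (x - a) * conv f x)" for a using i[of a 0] by simp
  have e: "(f x - f (x - h)) * (conv f (x - h) - conv f x) =
      f x * conv f (x - h) - f x * conv f x - (f (x - h) * conv f (x - h) - f (x - h) * conv f x)" for x h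
    by (simp add: algebra_simps)
  have *: "2 * (\<integral>x. f x * (conv f (x - h) - conv f x) \<partial>lborel)
      = (\<integral>x. (f x - f (x - h)) * (conv f (x - h) - conv f x) \<partial>lborel)" for h
  proof -
    have sym: "(\<integral>x. f x * conv f (x - h) \<partial>lborel) = (\<integral>x. f (x - h) * conv f x \<partial>lborel)"
      using conv_symmetric[OF fi fm, of "\<lambda>x. f (x - h)" height] fM conv_shift[of f "- h"] by simp
    have tr: "(\<integral>x. f (x - h) * conv f (x - h) \<partial>lborel) = (\<integral>x. f x * conv f x \<partial>lborel)"
      using integral_lborel_shift[of "\<lambda>x. f x * conv f x" "- h"] by simp
    have "(\<integral>x. (f x - f (x - h)) * (conv f (x - h) - conv f x) \<partial>lborel) = (\<integral>x. f x * conv f (x - h) \<partial>lborel) - (\<integral>x. f x * conv f x \<partial>lborel)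
        - ((\<integral>x. f (x - h) * conv f (x - h) \<partial>lborel) - (\<integral>x. f (x - h) * conv f x \<partial>lborel))"
      unfolding e by (simp add: i i0 i00 i1)
    also have "\<dots> = 2 * (\<integral>x. f x * (conv f (x - h) - conv f x) \<partial>lborel)"
      by (simp add: right_diff_distrib i0 i00 tr sym)
    finally show ?thesis by simp
  qed
  have bnd: "norm ((\<integral>x. f x * (conv f (x - h) - conv f x) \<partial>lborel) / h)
      \<le> lc * (\<integral>x. \<bar>f x - f (x - h)\<bar> \<partial>lborel)" if h: "0 < h" for h
  proof -
    have "\<bar>2 * (\<integral>x. f x * (conv f (x - h) - conv f x) \<partial>lborel)\<bar>
        \<le> (\<integral>x. \<bar>f x - f (x - h)\<bar> * (lc * h) \<partial>lborel)"
      unfolding *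
    proof (rule integral_abs_bound_integral)
      show "integrable lborel (\<lambda>x. (f x - f (x - h)) * (conv f (x - h) - conv f x))"
        unfolding e by (intro Bochner_Integration.integrable_diff i i0 i00 i1)
      show "integrable lborel (\<lambda>x. \<bar>f x - f (x - h)\<bar> * (lc * h))"
        using integrable_lborel_shift[OF fi, of "- h"] fi by simp
      show "\<bar>(f x - f (x - h)) * (conv f (x - h) - conv f x)\<bar> \<le> \<bar>f x - f (x - h)\<bar> * (lc * h)" for x
        using cl[of "x - h" x] h by (simp add: abs_mult mult_left_mono)
    qed
    also have "\<dots> = h * (lc * (\<integral>x. \<bar>f x - f (x - h)\<bar> \<partial>lborel))" by simp
    finally have "\<bar>2 * (\<integral>x. f x * (conv f (x - h) - conv f x) \<partial>lborel)\<bar> / h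
        \<le> lc * (\<integral>x. \<bar>f x - f (x - h)\<bar> \<partial>lborel)"
      using h by (simp add: divide_le_eq mult.commute)
    then show ?thesis using h by (simp add: abs_mult field_simps)
  qed
  have "((\<lambda>h. \<integral>x. \<bar>f x - f (x - h)\<bar> \<partial>lborel) \<longlongrightarrow> 0) (at 0)"
    unfolding f_def by (rule L1_shift) (use part_cont[OF S] part_nonneg part_int[OF S] in auto)
  then have "((\<lambda>h. \<integral>x. \<bar>f x - f (x - h)\<bar> \<partial>lborel) \<longlongrightarrow> 0) (at_right 0)"
    by (simp add: filterlim_at_split)
  then have lim: "((\<lambda>h. lc * (\<integral>x. \<bar>f x - f (x - h)\<bar> \<partial>lborel)) \<longlongrightarrow> 0) (at_right 0)"
    by (rule tendsto_mult_right_zero)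
  show ?thesis
    unfolding f_def[symmetric]
  proof (rule Lim_null_comparison[OF _ lim])
    show "\<forall>\<^sub>F h in at_right 0. norm ((\<integral>x. f x * (conv f (x - h) - conv f x) \<partial>lborel) / h)
        \<le> lc * (\<integral>x. \<bar>f x - f (x - h)\<bar> \<partial>lborel)"
      using eventually_at_right_less[of 0] by eventually_elim (rule bnd)
  qed
qed

subsection \<open>Levels around the origin\<close>

definition left_end :: "real \<Rightarrow> real" where
  "left_end t = - reach (\<lambda>x. v (- x)) t"

lemma left_end_neg: "0 < t \<Longrightarrow> t < v 0 \<Longrightarrow> left_end t < 0"
proof -
  interpret m: profile H "\<lambda>x. v (- x)" \<kappa> \<Lambda> R by (rule profile_reflect)
  show "0 < t \<Longrightarrow> t < v 0 \<Longrightarrow> left_end t < 0" using m.reach_pos[of t] by (simp add: left_end_def)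
qed

lemma v_left_end: "0 < t \<Longrightarrow> t < v 0 \<Longrightarrow> v (left_end t) = t"
proof -
  interpret m: profile H "\<lambda>x. v (- x)" \<kappa> \<Lambda> R by (rule profile_reflect)
  show "0 < t \<Longrightarrow> t < v 0 \<Longrightarrow> v (left_end t) = t" using m.v_reach[of t] by (simp add: left_end_def)
qed

lemma reach_measurable: "(\<lambda>t. if 0 < t \<and> t < v 0 then reach v t else 0) \<in> borel_measurable borel"
proof (rule borel_measurableI_greater)
  fix y :: real
  have "{t. y < (if 0 < t \<and> t < v 0 then reach v t else 0)}
      = (if y < 0 then UNIV else {0<..<v 0} \<inter> {..<low v y})"
    using reach_iff[of _ y] reach_pos by (auto split: if_splits) (metis dual_order.strict_trans)+
  then show "{t \<in> space borel. y < (if 0 < t \<and> t < v 0 then reach v t else 0)} \<in> sets borel"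
    by simp
qed

lemma left_end_measurable: "(\<lambda>t. if 0 < t \<and> t < v 0 then left_end t else 0) \<in> borel_measurable borel"
proof -
  interpret m: profile H "\<lambda>x. v (- x)" \<kappa> \<Lambda> R by (rule profile_reflect)
  have "(\<lambda>t. if 0 < t \<and> t < v 0 then left_end t else 0)
      = (\<lambda>t. - (if 0 < t \<and> t < v (- 0) then reach (\<lambda>x. v (- x)) t else 0))"
    by (auto simp: left_end_def)
  then show ?thesis using m.reach_measurable by simp
qed

text \<open>Layer cake: \<open>count S (low v x)\<close> is the integral over the levels in
  \<open>S\<close> of the indicators of the intervals from \<open>left_end t\<close> to
  \<open>reach v t\<close>. Fubini reduces the claim to one interval for each level, and
  \<open>v 0\<close> is the length of the range of levels.\<close>

lemma chain_estimate:
  assumes S [measurable]: "S \<in> sets borel"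
    and lip: "\<And>x y. \<bar>\<theta> x - \<theta> y\<bar> \<le> C * \<bar>x - y\<bar>" and bnd: "\<And>x. \<bar>\<theta> x\<bar> \<le> M" and h: "0 < h"
  defines "\<Delta> \<equiv> \<lambda>t. if t \<in> S \<and> 0 < t \<and> t < v 0 then \<theta> (left_end t) - \<theta> (reach v t) else 0"
  shows "integrable lborel \<Delta>"
    and "\<bar>(\<integral>x. count S (low v x) * (\<theta> (x - h) - \<theta> x) \<partial>lborel) - h * (\<integral>t. \<Delta> t \<partial>lborel)\<bar> \<le> v 0 * (2 * C * h\<^sup>2)"
proof -
  have C0: "0 \<le> C" using lip[of 0 1] by simp
  have [measurable]: "\<theta> \<in> borel_measurable borel" by (rule lipschitz_borel[OF lip])
  have M0: "0 \<le> M" using bnd[of 0] by linarith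
  have "\<Delta> = (\<lambda>t. if t \<in> S \<and> 0 < t \<and> t < v 0 then
      \<theta> (if 0 < t \<and> t < v 0 then left_end t else 0) - \<theta> (if 0 < t \<and> t < v 0 then reach v t else 0) else 0)"
    by (auto simp: \<Delta>_def)
  then have [measurable]: "\<Delta> \<in> borel_measurable borel"
    using measurable_compose[OF left_end_measurable, of \<theta>] measurable_compose[OF reach_measurable, of \<theta>]
    by simp
  show i\<Delta>: "integrable lborel \<Delta>"
  proof (rule Bochner_Integration.integrable_bound)
    show "integrable lborel (\<lambda>t. indicator {0<..<v 0} t * (2 * M))"
      by (intro integrable_mult_left) simp
    have "\<bar>\<theta> a - \<theta> b\<bar> \<le> 2 * M" for a b using bnd[of a] bnd[of b] by linarith
    then show "AE t in lborel. norm (\<Delta> t) \<le> norm (indicator {0<..<v 0} t * (2 * M))"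
      using M0 by (intro AE_I2) (auto simp: \<Delta>_def indicator_def)
  qed measurable
  define D where "D = (\<lambda>x. \<theta> (x - h) - \<theta> x)"
  have [measurable]: "D \<in> borel_measurable borel" unfolding D_def by measurable
  have DM: "\<bar>D x\<bar> \<le> 2 * M" for x using bnd[of "x - h"] bnd[of x] by (simp add: D_def)
  define F where "F = (\<lambda>x t. if t \<in> S \<and> 0 < t \<and> t < low v x then D x else 0)"
  have Fx: "F x = (\<lambda>t. indicator (S \<inter> {0<..<low v x}) t * D x)" for x
    by (auto simp: F_def indicator_def)
  have fm: "S \<inter> {0<..<low v x} \<in> fmeasurable lborel" for x by (rule fmeasurable_levels[OF S])
  have ind: "integrable lborel (indicat_real (S \<inter> {0<..<low v x}))" for x
    using fm[of x] by (intro integrable_real_indicator) (auto simp: fmeasurable_def)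
  have [measurable]: "case_prod F \<in> borel_measurable (lborel \<Otimes>\<^sub>M lborel)"
    unfolding F_def by measurable
  have Ft: "(\<integral>t. F x t \<partial>lborel) = count S (low v x) * D x" for x
    by (simp add: Fx count_def)
  have "integrable (lborel \<Otimes>\<^sub>M lborel) (case_prod F)"
  proof (rule lborel_pair.Fubini_integrable)
    show "integrable lborel (\<lambda>x. \<integral>t. norm (case_prod F (x, t)) \<partial>lborel)"
    proof (rule Bochner_Integration.integrable_bound)
      show "integrable lborel (\<lambda>x. v x * (2 * M))" using v_int by simp
      have "(\<integral>t. \<bar>F x t\<bar> \<partial>lborel) \<le> v x * (2 * M)" for x
      proof -
        have "(\<integral>t. \<bar>F x t\<bar> \<partial>lborel) = count S (low v x) * \<bar>D x\<bar>"
          by (simp add: Fx abs_mult count_def)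
        also have "\<dots> \<le> v x * (2 * M)"
        proof (rule mult_mono)
          show "count S (low v x) \<le> v x"
            using count_compl[OF S, of "low v x"] count_nonneg[of "- S" "low v x"] low_pos[of x] low_le_v[of x]
            by simp
        qed (use DM v_pos count_nonneg in \<open>auto simp: less_imp_le\<close>)
        finally show ?thesis .
      qed
      then show "AE x in lborel. norm (\<integral>t. norm (case_prod F (x, t)) \<partial>lborel) \<le> norm (v x * (2 * M))"
        using v_pos M0 by (intro AE_I2) (simp add: Bochner_Integration.integral_nonneg less_imp_le)
    qed measurable
    show "AE x in lborel. integrable lborel (\<lambda>t. case_prod F (x, t))"
      using ind by (intro AE_I2) (auto simp: Fx)
  qed measurable
  note F = this
  define I where "I = (\<lambda>t. \<integral>x. F x t \<partial>lborel)"
  have iI: "integrable lborel I" unfolding I_def by (rule lborel_pair.integrable_snd[OF F])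
  have "(\<integral>x. count S (low v x) * D x \<partial>lborel) = (\<integral>t. I t \<partial>lborel)"
    using lborel_pair.Fubini_integral[OF F] by (simp add: Ft I_def)
  then have "(\<integral>x. count S (low v x) * D x \<partial>lborel) - h * (\<integral>t. \<Delta> t \<partial>lborel)
      = (\<integral>t. I t - h * \<Delta> t \<partial>lborel)"
    by (simp add: iI i\<Delta>)
  also have "\<bar>\<dots>\<bar> \<le> (\<integral>t. indicator {0<..<v 0} t * (2 * C * h\<^sup>2) \<partial>lborel)"
  proof (rule integral_abs_bound_integral)
    show "\<bar>I t - h * \<Delta> t\<bar> \<le> indicator {0<..<v 0} t * (2 * C * h\<^sup>2)" for t
    proof (cases "t \<in> S \<and> 0 < t \<and> t < v 0")
      case True
      have "F x t = indicator {left_end t<..<reach v t} x * D x" for x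
        using level_iff[of t x] True by (auto simp: F_def indicator_def left_end_def)
      then show ?thesis
        using interval_shift_estimate[of \<theta> C h "left_end t" "reach v t"] lip h True
          left_end_neg[of t] reach_pos[of t]
        by (simp add: I_def \<Delta>_def D_def)
    next
      case False
      then have "F x t = 0" for x using low_le_0[of x] by (auto simp: F_def)
      then show ?thesis using False C0 by (auto simp: I_def \<Delta>_def)
    qed
  qed (auto intro!: iI i\<Delta> Bochner_Integration.integrable_diff integrable_mult_left)
  also have "\<dots> = v 0 * (2 * C * h\<^sup>2)" using v_pos[of 0] by simp
  finally show "\<bar>(\<integral>x. count S (low v x) * (\<theta> (x - h) - \<theta> x) \<partial>lborel) - h * (\<integral>t. \<Delta> t \<partial>lborel)\<bar>
      \<le> v 0 * (2 * C * h\<^sup>2)" by (simp add: D_def)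
qed

end

definition copart :: "(real \<Rightarrow> real) \<Rightarrow> real set \<Rightarrow> real \<Rightarrow> real" where
  "copart v S x = part (\<lambda>x. v (- x)) (- S) (- x)"

definition bump :: "(real \<Rightarrow> real) \<Rightarrow> real \<Rightarrow> real" where
  "bump v x = (if 0 < x then v x - low v x else 0)"

context profile
begin

lemma low_le_between: "0 \<le> z \<Longrightarrow> z \<le> x \<Longrightarrow> low v x \<le> v z"
  using low_anti[of z x] low_le_v[of z] by linarith

lemma low_int: "integrable lborel (low v)"
  by (rule Bochner_Integration.integrable_bound[OF v_int])
    (use low_pos low_le_v v_pos in \<open>auto simp: less_imp_le\<close>)

lemma conv_v_nonneg: "0 \<le> conv v x"
  by (rule conv_nonneg) (rule less_imp_le[OF v_pos])

definition cmax :: real where "cmax = height * mass"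

lemma conv_v_le: "conv v x \<le> cmax"
  using conv_abs_le[OF v_borel v_abs_le, of x] by (simp add: cmax_def abs_le_iff)

lemma cmax_nn: "0 \<le> cmax"
  using conv_v_nonneg[of 0] conv_v_le[of 0] by linarith

lemma conv_v_borel [measurable]: "conv v \<in> borel_measurable borel"
  by (rule lipschitz_borel[OF conv_v_lip])

subsection \<open>The convolution as a function of the level\<close>

text \<open>The function with \<open>conv v x = pot (v x)\<close>. The supremum extends it to all
  levels as a monotone function, which makes it Borel at once.\<close>

definition pot :: "real \<Rightarrow> real" where
  "pot t = (if t \<le> 0 then 0 else (SUP x\<in>{x. v x \<le> t}. conv v x))"

lemma pot_bdd: "bdd_above (conv v ` A)"
  by (rule bdd_aboveI2[where M=cmax]) (rule conv_v_le)

lemma pot_nonempty: "0 < t \<Longrightarrow> {x. v x \<le> t} \<noteq> {}"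
proof -
  assume "0 < t"
  then have "\<forall>\<^sub>F x in at_infinity. v x < t" using v_lim by (intro order_tendstoD)
  then obtain B where "\<And>x. B \<le> \<bar>x\<bar> \<Longrightarrow> v x < t" by (auto simp: eventually_at_infinity)
  from this[of "\<bar>B\<bar>"] have "v \<bar>B\<bar> \<le> t" using abs_ge_self[of B] by simp
  then show ?thesis by blast
qed

lemma pot_v: "pot (v x) = conv v x"
proof -
  have "(SUP y\<in>{y. v y \<le> v x}. conv v y) = conv v x"
  proof (rule antisym)
    show "(SUP y\<in>{y. v y \<le> v x}. conv v y) \<le> conv v x"
      by (rule cSUP_least) (auto simp: conv_le_iff)
    show "conv v x \<le> (SUP y\<in>{y. v y \<le> v x}. conv v y)"
      by (rule cSUP_upper[OF _ pot_bdd]) simp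
  qed
  then show ?thesis using v_pos[of x] by (simp add: pot_def)
qed

lemma pot_nonneg: "0 \<le> pot t"
proof (cases "t \<le> 0")
  case False
  then obtain x where "v x \<le> t" using pot_nonempty[of t] by auto
  then have "conv v x \<le> pot t" using False unfolding pot_def by (auto intro!: cSUP_upper pot_bdd)
  then show ?thesis using conv_v_nonneg[of x] by linarith
qed (simp add: pot_def)

lemma pot_le: "pot t \<le> cmax"
  using pot_nonempty[of t] cmax_nn by (auto simp: pot_def intro!: cSUP_least conv_v_le)

lemma pot_mono: "s \<le> t \<Longrightarrow> pot s \<le> pot t"
proof (cases "s \<le> 0")
  case True then show ?thesis using pot_nonneg[of t] by (simp add: pot_def)
next
  case False
  assume "s \<le> t"
  then show ?thesis
    using False pot_nonempty[of s] unfolding pot_def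
    by (auto intro!: cSUP_subset_mono pot_bdd)
qed

lemma pot_borel [measurable]: "pot \<in> borel_measurable borel"
  by (rule borel_measurable_mono) (simp add: mono_def pot_mono)

text \<open>An antiderivative of \<open>pot\<close>. Increments of \<open>prim (v x)\<close> in
  \<open>x\<close> are close to \<open>conv v x\<close> times those of \<open>v\<close>, and total
  differences integrate to 0.\<close>

definition prim :: "real \<Rightarrow> real" where
  "prim s = (\<integral>t. indicator {0<..<s} t * pot t \<partial>lborel)"

lemma pot_ind_int: "integrable lborel (\<lambda>t. indicator {a<..<b} t * pot t)"
proof (rule integrable_mult_bounded[where M=cmax])
  show "\<bar>pot t\<bar> \<le> cmax" for t using pot_nonneg[of t] pot_le[of t] by simp
qed auto

lemma prim_bounds:
  assumes "0 \<le> s" "s \<le> t"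
  shows "pot s * (t - s) \<le> prim t - prim s" "prim t - prim s \<le> pot t * (t - s)"
proof -
  have "prim t - prim s = (\<integral>x. indicator {0<..<t} x * pot x - indicator {0<..<s} x * pot x \<partial>lborel)"
    unfolding prim_def by (simp add: pot_ind_int)
  also have "\<dots> = (\<integral>x. indicator {s<..<t} x * pot x \<partial>lborel)"
  proof (rule integral_cong_AE)
    show "AE x in lborel. indicator {0<..<t} x * pot x - indicator {0<..<s} x * pot x = indicator {s<..<t} x * pot x"
      using AE_lborel_neq[of s] by eventually_elim (use assms in \<open>auto simp: indicator_def\<close>)
  qed measurable
  finally have e: "prim t - prim s = (\<integral>x. indicator {s<..<t} x * pot x \<partial>lborel)" .
  have c: "(\<integral>x. indicator {s<..<t} x * p \<partial>lborel) = p * (t - s)" for p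
    using assms by simp
  have i: "integrable lborel (\<lambda>x. indicator {s<..<t} x * p)" for p :: real
    by (intro integrable_mult_left) simp
  show "pot s * (t - s) \<le> prim t - prim s"
    unfolding e c[symmetric]
    by (rule integral_mono[OF i pot_ind_int]) (auto simp: indicator_def intro: pot_mono)
  show "prim t - prim s \<le> pot t * (t - s)"
    unfolding e c[symmetric]
    by (rule integral_mono[OF pot_ind_int i]) (auto simp: indicator_def intro: pot_mono)
qed

lemma prim_estimate:
  assumes "0 \<le> s" "0 \<le> t" "\<bar>pot s - p\<bar> \<le> e" "\<bar>pot t - p\<bar> \<le> e"
  shows "\<bar>prim t - prim s - p * (t - s)\<bar> \<le> e * \<bar>t - s\<bar>"
proof -
  have *: "\<bar>prim b - prim a - p * (b - a)\<bar> \<le> e * \<bar>b - a\<bar>"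
    if ab: "0 \<le> a" "a \<le> b" "\<bar>pot a - p\<bar> \<le> e" "\<bar>pot b - p\<bar> \<le> e" for a b
  proof -
    have "(p - e) * (b - a) \<le> pot a * (b - a)" "pot b * (b - a) \<le> (p + e) * (b - a)"
      using ab by (intro mult_right_mono; simp)+
    then show ?thesis using prim_bounds[OF ab(1,2)] ab(2) by (simp add: algebra_simps abs_le_iff)
  qed
  show ?thesis
  proof (cases "s \<le> t")
    case True then show ?thesis using *[of s t] assms by simp
  next
    case False
    then have "\<bar>prim s - prim t - p * (s - t)\<bar> \<le> e * \<bar>s - t\<bar>" using *[of t s] assms by simp
    moreover have "prim t - prim s - p * (t - s) = - (prim s - prim t - p * (s - t))"
      by (simp add: algebra_simps)
    ultimately show ?thesis by (metis abs_minus_cancel abs_minus_commute)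
  qed
qed

lemma prim_v:
  assumes "0 < h"
  shows "\<bar>prim (v (x + h)) - prim (v x) - conv v x * (v (x + h) - v x)\<bar> \<le> lc * h * \<bar>v (x + h) - v x\<bar>"
  by (rule prim_estimate) (use v_pos conv_v_lip[of "x + h" x] lc_nn assms in \<open>auto simp: pot_v less_imp_le\<close>)

text \<open>If the running minimum drops between \<open>x\<close> and \<open>x + h\<close>, both its
  old and its new value are values of \<open>v\<close> on this interval, the old one by the
  intermediate value theorem. At such points \<open>conv v\<close> differs from
  \<open>conv v x\<close> by at most \<open>lc * h\<close>.\<close>

lemma prim_low:
  assumes h: "0 < h" and x: "0 \<le> x"
  shows "\<bar>prim (low v (x + h)) - prim (low v x) - conv v x * (low v (x + h) - low v x)\<bar>
      \<le> lc * h * \<bar>low v (x + h) - low v x\<bar>"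
proof (cases "low v (x + h) = low v x")
  case False
  then have lt: "low v (x + h) < low v x" using low_anti[of x "x + h"] h x by simp
  obtain s where s: "0 \<le> s" "s \<le> 1" "low v (x + h) = v (s * (x + h))" using low_attained .
  define b where "b = s * (x + h)"
  have b0: "0 \<le> b" "b \<le> x + h" using s h x by (auto simp: b_def intro: mult_left_le_one_le)
  have vb: "v b = low v (x + h)" using s by (simp add: b_def)
  have xb: "x \<le> b"
  proof (rule ccontr)
    assume "\<not> x \<le> b"
    then have "low v x \<le> v b" using b0 by (intro low_le_between) auto
    then show False using lt vb by simp
  qed
  obtain a where a: "x \<le> a" "a \<le> b" "v a = low v x"
    using IVT2'[of v b "low v x" x] lt vb xb low_le_v[of x] v_cont by auto
  have 1: "\<bar>conv v a - conv v x\<bar> \<le> lc * h"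
    by (rule order_trans[OF conv_v_lip]) (use a b0 xb lc_nn in \<open>auto intro!: mult_left_mono\<close>)
  have 2: "\<bar>conv v b - conv v x\<bar> \<le> lc * h"
    by (rule order_trans[OF conv_v_lip]) (use b0 xb lc_nn in \<open>auto intro!: mult_left_mono\<close>)
  show ?thesis
    using prim_estimate[of "low v x" "low v (x + h)" "conv v x" "lc * h"] 1 2 pot_v[of a] pot_v[of b] a(3) vb
      low_pos less_imp_le by metis
qed simp

lemma bump_nonneg: "0 \<le> bump v x"
  using low_le_v[of x] by (simp add: bump_def)

lemma bump_le_v: "bump v x \<le> v x"
  using low_pos[of x] v_pos[of x] by (simp add: bump_def)

lemma bump_borel [measurable]: "bump v \<in> borel_measurable borel"
  unfolding bump_def by measurable

lemma bump_int: "integrable lborel (bump v)"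
  by (rule Bochner_Integration.integrable_bound[OF v_int])
    (use bump_nonneg bump_le_v v_pos in \<open>auto simp: less_imp_le\<close>)

lemma bump_small: "0 < x \<Longrightarrow> bump v x \<le> 2 * \<Lambda> * x"
  using v_lip[of x 0] low_lip[of x 0] by (simp add: bump_def)

text \<open>For positive \<open>x\<close>, the increments of \<open>bump v\<close> weighted by
  \<open>conv v\<close> are those of \<open>prim (v x) - prim (low v x)\<close>, up to
  \<open>lc * h\<close> times the increments of \<open>v\<close> and \<open>low v\<close>. The main
  term integrates to 0, and the error is \<open>o(h)\<close> by continuity of translations in
  \<open>L1\<close>.\<close>

lemma bump_interaction:
  "((\<lambda>h. (\<integral>x. bump v x * (conv v (x - h) - conv v x) \<partial>lborel) / h) \<longlongrightarrow> 0) (at_right 0)"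
proof -
  define P where "P = (\<lambda>x. if 0 < x then prim (v x) - prim (low v x) else 0)"
  have P0: "0 \<le> P x" for x
  proof -
    have "0 \<le> pot (low v x) * (v x - low v x)"
      using pot_nonneg low_le_v[of x] by simp
    then show ?thesis using prim_bounds(1)[of "low v x" "v x"] low_pos[of x] low_le_v[of x]
      by (simp add: P_def)
  qed
  have P1: "P x \<le> cmax * bump v x" for x
  proof (cases "0 < x")
    case True
    have "prim (v x) - prim (low v x) \<le> pot (v x) * (v x - low v x)"
      using prim_bounds(2)[of "low v x" "v x"] low_pos[of x] low_le_v[of x] by simp
    also have "\<dots> \<le> cmax * (v x - low v x)"
      using pot_le low_le_v[of x] by (intro mult_right_mono) auto
    finally show ?thesis using True by (simp add: P_def bump_def)
  qed (simp add: P_def bump_def)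
  have [measurable]: "prim \<in> borel_measurable borel"
  proof (rule borel_measurable_mono)
    show "mono prim"
    proof (rule monoI)
      show "prim s \<le> prim t" if "s \<le> t" for s t
        unfolding prim_def using that
        by (intro integral_mono pot_ind_int) (auto simp: indicator_def pot_nonneg)
    qed
  qed
  have [measurable]: "P \<in> borel_measurable borel" unfolding P_def by measurable
  have Pi: "integrable lborel P"
    by (rule Bochner_Integration.integrable_bound[of _ "\<lambda>x. cmax * bump v x"])
      (use bump_int P0 P1 cmax_nn bump_nonneg in \<open>auto simp: abs_of_nonneg\<close>)
  have cM: "\<bar>conv v x\<bar> \<le> cmax" for x using conv_v_nonneg[of x] conv_v_le[of x] by simp
  have bi: "integrable lborel (\<lambda>x. bump v (x + a) * conv v (x + b))" for a b
    by (rule integrable_mult_bounded[OF integrable_lborel_shift[OF bump_int] _ cM]) measurable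
  note bi' = bi[of 0 0, simplified]  bi[of _ 0, simplified]
  have bi0: "integrable lborel (\<lambda>x. bump v x * conv v (x - h))" for h using bi[of 0 "- h"] by simp
  have Pih: "integrable lborel (\<lambda>x. P (x + h))" for h by (rule integrable_lborel_shift[OF Pi])
  have vih: "integrable lborel (\<lambda>x. v (x + h))" "integrable lborel (\<lambda>x. low v (x + h))" for h
    by (intro integrable_lborel_shift v_int low_int)+
  let ?N = "\<lambda>f h. \<integral>x. \<bar>f x - f (x - h)\<bar> \<partial>lborel"
  have bnd: "norm ((\<integral>x. bump v x * (conv v (x - h) - conv v x) \<partial>lborel) / h)
      \<le> lc * (?N v h + ?N (low v) h) + 8 * cmax * \<Lambda> * h" if h: "0 < h" for h
  proof -
    have 1: "integrable lborel (\<lambda>x. \<bar>v (x + h) - v x\<bar>)" "integrable lborel (\<lambda>x. \<bar>low v (x + h) - low v x\<bar>)"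
      by (rule integrable_abs, rule Bochner_Integration.integrable_diff, rule vih, rule v_int)
        (rule integrable_abs, rule Bochner_Integration.integrable_diff, rule vih, rule low_int)
    have 2: "integrable lborel (\<lambda>x. indicator {-h<..<h} x * (4 * cmax * \<Lambda> * h))"
      by (intro integrable_mult_left) simp
    have alg: "l * h * n + 2 * h * (4 * c * L * h) = h * (l * n + 8 * c * L * h)" for l n c L :: real
      by (simp add: algebra_simps)
    define E where "E = (\<lambda>x. (bump v (x + h) * conv v x - bump v x * conv v x) - (P (x + h) - P x))"
    have "(\<integral>x. bump v x * (conv v (x - h) - conv v x) \<partial>lborel)
        = (\<integral>x. bump v x * conv v (x - h) \<partial>lborel) - (\<integral>x. bump v x * conv v x \<partial>lborel)"
      by (simp add: right_diff_distrib bi0 bi')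
    also have "(\<integral>x. bump v x * conv v (x - h) \<partial>lborel) = (\<integral>x. bump v (x + h) * conv v x \<partial>lborel)"
      using integral_lborel_shift[of "\<lambda>x. bump v x * conv v (x - h)" h] by simp
    also have "(\<integral>x. bump v (x + h) * conv v x \<partial>lborel) - (\<integral>x. bump v x * conv v x \<partial>lborel)
        = (\<integral>x. E x \<partial>lborel)"
      unfolding E_def using integral_lborel_shift[of P h] by (simp add: bi' Pi Pih)
    finally have eqE: "(\<integral>x. bump v x * (conv v (x - h) - conv v x) \<partial>lborel) = (\<integral>x. E x \<partial>lborel)" .
    have "\<bar>\<integral>x. E x \<partial>lborel\<bar> \<le> (\<integral>x. lc * h * (\<bar>v (x + h) - v x\<bar> + \<bar>low v (x + h) - low v x\<bar>)
        + indicator {-h<..<h} x * (4 * cmax * \<Lambda> * h) \<partial>lborel)"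
    proof (rule integral_abs_bound_integral)
      show "integrable lborel E" unfolding E_def
        by (rule Bochner_Integration.integrable_diff[OF
              Bochner_Integration.integrable_diff[OF bi'(2,1)] Bochner_Integration.integrable_diff[OF Pih Pi]])
      show "integrable lborel (\<lambda>x. lc * h * (\<bar>v (x + h) - v x\<bar> + \<bar>low v (x + h) - low v x\<bar>)
        + indicator {-h<..<h} x * (4 * cmax * \<Lambda> * h))"
        by (rule Bochner_Integration.integrable_add[OF integrable_mult_right[OF
              Bochner_Integration.integrable_add[OF 1]] 2])
      fix x
      have nn: "0 \<le> lc * h * (\<bar>v (x + h) - v x\<bar> + \<bar>low v (x + h) - low v x\<bar>)"
        using lc_nn h by simp
      have nn': "0 \<le> indicator {-h<..<h} x * (4 * cmax * \<Lambda> * h)"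
        using cmax_nn \<Lambda>_nn h by simp
      consider "0 < x" | "x \<le> 0" "x + h \<le> 0" | "x \<le> 0" "0 < x + h" by linarith
      then show "\<bar>E x\<bar> \<le> lc * h * (\<bar>v (x + h) - v x\<bar> + \<bar>low v (x + h) - low v x\<bar>)
        + indicator {-h<..<h} x * (4 * cmax * \<Lambda> * h)"
      proof cases
        case 1
        define a where "a = \<bar>v (x + h) - v x\<bar>"
        define b where "b = \<bar>low v (x + h) - low v x\<bar>"
        define A where "A = prim (v (x + h)) - prim (v x) - conv v x * (v (x + h) - v x)"
        define B where "B = prim (low v (x + h)) - prim (low v x) - conv v x * (low v (x + h) - low v x)"
        have "E x = B - A"
          using 1 h by (simp add: E_def P_def bump_def A_def B_def algebra_simps)
        moreover have "\<bar>A\<bar> \<le> lc * h * a" unfolding A_def a_def by (rule prim_v[OF h])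
        moreover have "\<bar>B\<bar> \<le> lc * h * b" unfolding B_def b_def by (rule prim_low[OF h]) (use 1 in simp)
        ultimately have "\<bar>E x\<bar> \<le> lc * h * (a + b)" unfolding distrib_left by linarith
        then show ?thesis unfolding a_def[symmetric] b_def[symmetric] using nn' by linarith
      next
        case 2
        then have "E x = 0" by (simp add: E_def P_def bump_def)
        then show ?thesis using nn nn' by simp
      next
        case 3
        \<comment> \<open>Only here does the cut at the origin matter. The bump is
          \<open>O(h)\<close> on this strip of width \<open>h\<close>, so the total contribution is
          of order \<open>h\<^sup>2\<close>.\<close>
        have b: "bump v (x + h) \<le> 2 * \<Lambda> * h"
          using bump_small[OF 3(2)] mult_left_mono[of "x + h" h "2 * \<Lambda>"] 3 \<Lambda>_nn by simp
        have c1: "bump v (x + h) * conv v x \<le> 2 * \<Lambda> * h * cmax" "0 \<le> bump v (x + h) * conv v x"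
          using b bump_nonneg conv_v_nonneg conv_v_le \<Lambda>_nn h by (auto intro!: mult_mono)
        have c2: "P (x + h) \<le> cmax * (2 * \<Lambda> * h)"
          using P1[of "x + h"] mult_left_mono[OF b cmax_nn] by linarith
        have "E x = bump v (x + h) * conv v x - P (x + h)"
          using 3 by (simp add: E_def P_def bump_def)
        then have "\<bar>E x\<bar> \<le> 4 * cmax * \<Lambda> * h"
          using c1 c2 P0[of "x + h"] by (simp add: abs_le_iff algebra_simps)
        moreover have "indicator {-h<..<h} x = (1::real)" using 3 h by (simp add: indicator_def)
        ultimately show ?thesis using nn by simp
      qed
    qed
    also have "\<dots> = lc * h * ((\<integral>x. \<bar>v (x + h) - v x\<bar> \<partial>lborel) + (\<integral>x. \<bar>low v (x + h) - low v x\<bar> \<partial>lborel))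
        + 2 * h * (4 * cmax * \<Lambda> * h)"
    proof -
      define a where "a = (\<lambda>x. \<bar>v (x + h) - v x\<bar>)"
      define b where "b = (\<lambda>x. \<bar>low v (x + h) - low v x\<bar>)"
      define k where "k = 4 * cmax * \<Lambda> * h"
      have i: "integrable lborel a" "integrable lborel b" "integrable lborel (\<lambda>x. indicator {-h<..<h} x * k)"
        using 1 2 unfolding a_def b_def k_def by blast+
      have "(\<integral>x. indicator {-h<..<h} x * k \<partial>lborel) = 2 * h * k" using h by simp
      then have "(\<integral>x. lc * h * (a x + b x) + indicator {-h<..<h} x * k \<partial>lborel)
          = lc * h * ((\<integral>x. a x \<partial>lborel) + (\<integral>x. b x \<partial>lborel)) + 2 * h * k"
        using i by simp
      then show ?thesis unfolding a_def b_def k_def .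
    qed
    also have "(\<integral>x. \<bar>v (x + h) - v x\<bar> \<partial>lborel) = ?N v h"
      using integral_lborel_shift[of "\<lambda>x. \<bar>v x - v (x - h)\<bar>" h] by simp
    also have "(\<integral>x. \<bar>low v (x + h) - low v x\<bar> \<partial>lborel) = ?N (low v) h"
      using integral_lborel_shift[of "\<lambda>x. \<bar>low v x - low v (x - h)\<bar>" h] by simp
    finally have "\<bar>\<integral>x. bump v x * (conv v (x - h) - conv v x) \<partial>lborel\<bar>
        \<le> h * (lc * (?N v h + ?N (low v) h) + 8 * cmax * \<Lambda> * h)" unfolding alg eqE .
    moreover have "\<bar>X / h\<bar> \<le> b" if "\<bar>X\<bar> \<le> h * b" for X b :: real
      using that h by (simp add: abs_divide pos_divide_le_eq mult.commute)
    ultimately show ?thesis unfolding real_norm_def by blast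
  qed
  have "(?N v \<longlongrightarrow> 0) (at_right 0)" "(?N (low v) \<longlongrightarrow> 0) (at_right 0)"
    using L1_shift[OF v_cont _ v_int] L1_shift[OF low_cont _ low_int] v_pos low_pos
    by (simp_all add: filterlim_at_split less_imp_le)
  then have "((\<lambda>h. lc * (?N v h + ?N (low v) h) + 8 * cmax * \<Lambda> * h) \<longlongrightarrow> lc * (0 + 0) + 8 * cmax * \<Lambda> * 0) (at_right 0)"
    by (intro tendsto_intros)
  then have lim: "((\<lambda>h. lc * (?N v h + ?N (low v) h) + 8 * cmax * \<Lambda> * h) \<longlongrightarrow> 0) (at_right 0)" by simp
  show ?thesis
  proof (rule Lim_null_comparison[OF _ lim])
    show "\<forall>\<^sub>F h in at_right 0. norm ((\<integral>x. bump v x * (conv v (x - h) - conv v x) \<partial>lborel) / h)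
        \<le> lc * (?N v h + ?N (low v) h) + 8 * cmax * \<Lambda> * h"
      using eventually_at_right_less[of 0] by eventually_elim (rule bnd)
  qed
qed

subsection \<open>First variation\<close>

lemma copart_sum: "S \<in> sets borel \<Longrightarrow> part v S x + copart v S x = v x"
  using part_sum[of S x] by (simp add: copart_def)

lemma
  assumes S: "S \<in> sets borel"
  shows copart_abs_le: "\<bar>copart v S x\<bar> \<le> height"
    and copart_cont: "continuous_on A (copart v S)"
    and copart_borel: "copart v S \<in> borel_measurable borel"
proof -
  interpret m: profile H "\<lambda>x. v (- x)" \<kappa> \<Lambda> R by (rule profile_reflect)
  have 0: "0 \<le> copart v S x" for x unfolding copart_def by (rule m.part_nonneg)
  show "\<bar>copart v S x\<bar> \<le> height"
    using 0[of x] copart_sum[OF S, of x] part_nonneg[of S x] v_le_height[of x] by simp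
  show c: "continuous_on A (copart v S)" for A
    unfolding copart_def
    by (rule continuous_on_compose2[OF m.part_cont[of "- S" UNIV]])
      (use S in \<open>auto intro!: continuous_intros borel_comp\<close>)
  show "copart v S \<in> borel_measurable borel" by (rule borel_measurable_continuous_onI[OF c])
qed

lemma conv_split:
  assumes S: "S \<in> sets borel"
  shows "conv v x = conv (part v S) x + conv (copart v S) x"
  using conv_add[OF part_borel part_abs_le copart_borel copart_abs_le, OF S S S S, of x]
  by (simp add: copart_sum[OF S])

lemma conv_copart_lip:
  assumes S: "S \<in> sets borel"
  shows "\<bar>conv (copart v S) x - conv (copart v S) y\<bar> \<le> lc * \<bar>x - y\<bar>"
proof -
  interpret m: profile H "\<lambda>x. v (- x)" \<kappa> \<Lambda> R by (rule profile_reflect)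
  have "conv (copart v S) x = conv (part (\<lambda>x. v (- x)) (- S)) (- x)" for x
    unfolding copart_def by (rule conv_uminus)
  then show ?thesis
    using m.conv_part_lip[OF borel_comp[OF S], of "- x" "- y"]
    by (simp add: m.lc_def lc_def abs_minus_commute)
qed

lemma copart_dominated:
  assumes S: "splits v S" and z: "\<bar>z\<bar> \<le> y"
  shows "copart v S y \<le> copart v S z"
proof -
  interpret m: profile H "\<lambda>x. v (- x)" \<kappa> \<Lambda> R by (rule profile_reflect)
  show ?thesis unfolding copart_def
    using m.part_dominated[OF splits_reflect[OF S], of "- z" y] z by simp
qed

text \<open>The midpoint of \<open>a\<close> and \<open>b\<close> is nonnegative, so of two points
  that are mirror images in it the left one is closer to the origin, and \<open>copart\<close> is at
  least as large there.\<close>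

lemma conv_copart_anti:
  assumes S: "splits v S" and ab: "a \<le> b" "0 \<le> a + b"
  shows "conv (copart v S) b \<le> conv (copart v S) a"
proof -
  have b: "S \<in> sets borel" using S by (simp add: splits_def)
  define l B where l: "l = (a + b) / 2" "B = (b - a) / 2"
  have lB: "l + B = b" "l - B = a" "0 \<le> l" "0 \<le> B" using ab by (simp_all add: l field_simps)
  have "conv (copart v S) (l + B) \<le> conv (copart v S) (l - B)"
  proof (rule conv_reflection_le[OF copart_borel copart_abs_le, OF b b lB(4)])
    fix Y :: real assume "0 < Y"
    then have "\<bar>l - Y\<bar> \<le> l + Y" using lB(3) by linarith
    then show "copart v S (l + Y) \<le> copart v S (l - Y)" by (rule copart_dominated[OF S])
  qed
  then show ?thesis unfolding lB .
qed

text \<open>As \<open>conv (copart v S)\<close> is \<open>conv v\<close> minus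
  \<open>conv (part v S)\<close>, there are three terms: the layers in the potential
  \<open>conv v\<close>, which agrees at both ends of each layer; the bump in the same potential;
  and the self-interaction.\<close>

lemma first_variation_small:
  assumes S: "S \<in> sets borel"
  shows "((\<lambda>h. (\<integral>x. part v S x * (conv (copart v S) (x - h) - conv (copart v S) x) \<partial>lborel) / h)
    \<longlongrightarrow> 0) (at_right 0)"
proof -
  let ?f = "part v S" and ?\<psi> = "conv (copart v S)"
  let ?c = "\<lambda>x. count S (low v x)"
  have f: "?f x = ?c x + bump v x" for x by (simp add: part_def bump_def)
  have cM: "\<bar>conv v x\<bar> \<le> cmax" for x using conv_v_nonneg[of x] conv_v_le[of x] by simp
  have fM: "\<bar>conv ?f x\<bar> \<le> cmax" for x
    unfolding cmax_def by (rule conv_abs_le[OF part_borel part_abs_le, OF S S])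
  have [measurable]: "conv ?f \<in> borel_measurable borel" by (rule lipschitz_borel[OF conv_part_lip[OF S]])
  have ci: "integrable lborel ?c"
  proof -
    have "integrable lborel (\<lambda>x. ?f x - bump v x)"
      by (intro Bochner_Integration.integrable_diff part_int[OF S] bump_int)
    then show ?thesis by (simp add: f)
  qed
  have sh: "\<bar>\<theta> (x - h) - \<theta> x\<bar> \<le> 2 * cmax" if "\<And>x. \<bar>\<theta> x\<bar> \<le> cmax" for \<theta> :: "real \<Rightarrow> real" and x h
    using that[of "x - h"] that[of x] by linarith
  have i1: "integrable lborel (\<lambda>x. ?c x * (conv v (x - h) - conv v x))" for h
    by (rule integrable_mult_bounded[OF ci _ sh[OF cM]]) measurable
  have i2: "integrable lborel (\<lambda>x. bump v x * (conv v (x - h) - conv v x))" for h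
    by (rule integrable_mult_bounded[OF bump_int _ sh[OF cM]]) measurable
  have i3: "integrable lborel (\<lambda>x. ?f x * (conv ?f (x - h) - conv ?f x))" for h
    by (rule integrable_mult_bounded[OF part_int[OF S] _ sh[OF fM]]) measurable
  have eq: "(\<integral>x. ?f x * (?\<psi> (x - h) - ?\<psi> x) \<partial>lborel) / h
      = (\<integral>x. ?c x * (conv v (x - h) - conv v x) \<partial>lborel) / h
        + (\<integral>x. bump v x * (conv v (x - h) - conv v x) \<partial>lborel) / h
        - (\<integral>x. ?f x * (conv ?f (x - h) - conv ?f x) \<partial>lborel) / h" for h
  proof -
    have "?f x * (?\<psi> (x - h) - ?\<psi> x) = ?c x * (conv v (x - h) - conv v x)
        + bump v x * (conv v (x - h) - conv v x) - ?f x * (conv ?f (x - h) - conv ?f x)" for x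
      unfolding conv_split[OF S, of x] conv_split[OF S, of "x - h"] by (simp add: f algebra_simps)
    then show ?thesis
      using i1 i2 i3 by (simp add: add_divide_distrib diff_divide_distrib)
  qed
  have lim: "((\<lambda>h. v 0 * (2 * lc * h)) \<longlongrightarrow> 0) (at_right 0)"
    by (rule tendsto_eq_intros refl | simp)+
  have "((\<lambda>h. (\<integral>x. ?c x * (conv v (x - h) - conv v x) \<partial>lborel) / h) \<longlongrightarrow> 0) (at_right 0)"
  proof (rule Lim_null_comparison[OF _ lim])
    have "norm ((\<integral>x. ?c x * (conv v (x - h) - conv v x) \<partial>lborel) / h) \<le> v 0 * (2 * lc * h)" if h: "0 < h" for h
    proof -
      let ?\<Delta> = "\<lambda>t. if t \<in> S \<and> 0 < t \<and> t < v 0 then conv v (left_end t) - conv v (reach v t) else 0"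
      have "?\<Delta> t = 0" for t using conv_eq[of "left_end t" "reach v t"] v_left_end[of t] v_reach[of t] by simp
      then have z: "?\<Delta> = (\<lambda>_. 0)" by blast
      have "\<bar>\<integral>x. ?c x * (conv v (x - h) - conv v x) \<partial>lborel\<bar> \<le> v 0 * (2 * lc * h\<^sup>2)"
        using chain_estimate(2)[OF S conv_v_lip cM h] unfolding z by simp
      then show ?thesis using h by (simp add: pos_divide_le_eq power2_eq_square mult_ac)
    qed
    then show "\<forall>\<^sub>F h in at_right 0.
        norm ((\<integral>x. ?c x * (conv v (x - h) - conv v x) \<partial>lborel) / h) \<le> v 0 * (2 * lc * h)"
      using eventually_at_right_less[of 0] by (auto elim: eventually_mono)
  qed
  from tendsto_diff[OF tendsto_add[OF this bump_interaction] self_interaction[OF S]]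
  show ?thesis unfolding eq by simp
qed

text \<open>Layers and bump both contribute to \<open>J h\<close> with a nonnegative sign up to
  \<open>O(h\<^sup>2)\<close>, while their sum is \<open>o(h)\<close>. Each conclusion isolates one
  contribution and bounds the other from below.\<close>

lemma
  assumes S: "splits v S"
  shows first_variation_chain: "AE t in lborel. t \<in> S \<longrightarrow> 0 < t \<longrightarrow> t < v 0 \<longrightarrow>
      conv (copart v S) (left_end t) = conv (copart v S) (reach v t)"
    and first_variation_bump: "\<lbrakk>0 < x; x < y; \<And>z. x \<le> z \<Longrightarrow> z \<le> y \<Longrightarrow> low v z < v z\<rbrakk> \<Longrightarrow>
      conv (copart v S) x = conv (copart v S) y"
proof -
  have b: "S \<in> sets borel" using S by (simp add: splits_def)
  let ?f = "part v S" and ?\<psi> = "conv (copart v S)"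
  let ?c = "\<lambda>x. count S (low v x)"
  define J where "J = (\<lambda>h. \<integral>x. ?f x * (?\<psi> (x - h) - ?\<psi> x) \<partial>lborel)"
  have J: "((\<lambda>h. J h / h) \<longlongrightarrow> 0) (at_right 0)"
    unfolding J_def by (rule first_variation_small[OF b])
  have f: "?f x = ?c x + bump v x" for x by (simp add: part_def bump_def)
  have \<psi>M: "\<bar>?\<psi> x\<bar> \<le> cmax" for x
    unfolding cmax_def by (rule conv_abs_le[OF copart_borel copart_abs_le, OF b b])
  have \<psi>l: "\<bar>?\<psi> x - ?\<psi> y\<bar> \<le> lc * \<bar>x - y\<bar>" for x y by (rule conv_copart_lip[OF b])
  have [measurable]: "?\<psi> \<in> borel_measurable borel" by (rule lipschitz_borel[OF \<psi>l])
  have sh: "\<bar>?\<psi> (x - h) - ?\<psi> x\<bar> \<le> 2 * cmax" for x h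
    using \<psi>M[of "x - h"] \<psi>M[of x] by linarith
  have ci: "integrable lborel ?c"
  proof -
    have "integrable lborel (\<lambda>x. ?f x - bump v x)"
      by (intro Bochner_Integration.integrable_diff part_int[OF b] bump_int)
    then show ?thesis by (simp add: f)
  qed
  have i1: "integrable lborel (\<lambda>x. ?c x * (?\<psi> (x - h) - ?\<psi> x))" for h
    by (rule integrable_mult_bounded[OF ci _ sh]) measurable
  have i2: "integrable lborel (\<lambda>x. bump v x * (?\<psi> (x - h) - ?\<psi> x))" for h
    by (rule integrable_mult_bounded[OF bump_int _ sh]) measurable
  have J_split: "J h = (\<integral>x. ?c x * (?\<psi> (x - h) - ?\<psi> x) \<partial>lborel)
      + (\<integral>x. bump v x * (?\<psi> (x - h) - ?\<psi> x) \<partial>lborel)" for h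
    unfolding J_def f distrib_right using i1 i2 by simp
  define \<Delta> where "\<Delta> = (\<lambda>t. if t \<in> S \<and> 0 < t \<and> t < v 0 then ?\<psi> (left_end t) - ?\<psi> (reach v t) else 0)"
  have \<Delta>0: "0 \<le> \<Delta> t" for t
  proof (cases "t \<in> S \<and> 0 < t \<and> t < v 0")
    case True
    have "?\<psi> (reach v t) \<le> ?\<psi> (left_end t)"
      using True splits_reach[OF S, of t] left_end_neg[of t] reach_pos[of t]
      by (intro conv_copart_anti[OF S]) (auto simp: left_end_def)
    then show ?thesis by (simp add: \<Delta>_def)
  qed (auto simp: \<Delta>_def)
  have \<Delta>i: "integrable lborel \<Delta>"
    and chain: "\<And>h. 0 < h \<Longrightarrow> \<bar>(\<integral>x. ?c x * (?\<psi> (x - h) - ?\<psi> x) \<partial>lborel) - h * (\<integral>t. \<Delta> t \<partial>lborel)\<bar> \<le> v 0 * (2 * lc * h\<^sup>2)"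
    unfolding \<Delta>_def using chain_estimate(1)[OF b \<psi>l \<psi>M zero_less_one] chain_estimate(2)[OF b \<psi>l \<psi>M] by simp_all
  \<comment> \<open>Monotonicity of \<open>?\<psi>\<close> covers \<open>h \<le> x\<close>. For
    \<open>0 < x < h\<close> the shift crosses the origin; there the bump is at most
    \<open>2 * \<Lambda> * h\<close> and the increment at most \<open>lc * h\<close>, so the loss is
    \<open>O(h\<^sup>3)\<close> in total.\<close>
  have bump_pw: "- (indicator {-h<..<h} x * (2 * \<Lambda> * h * (lc * h))) \<le> bump v x * (?\<psi> (x - h) - ?\<psi> x)"
    if h: "0 < h" for h x
  proof -
    consider "x \<le> 0" | "0 < x" "x < h" | "h \<le> x" by linarith
    then show ?thesis
    proof cases
      case 1 then show ?thesis using h lc_nn \<Lambda>_nn by (simp add: bump_def)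
    next
      case 2
      have "bump v x * \<bar>?\<psi> (x - h) - ?\<psi> x\<bar> \<le> (2 * \<Lambda> * h) * (lc * h)"
      proof (rule mult_mono)
        show "bump v x \<le> 2 * \<Lambda> * h"
          using bump_small[OF 2(1)] mult_left_mono[of x h "2 * \<Lambda>"] 2 \<Lambda>_nn by simp
        show "\<bar>?\<psi> (x - h) - ?\<psi> x\<bar> \<le> lc * h" using \<psi>l[of "x - h" x] h by simp
      qed (use \<Lambda>_nn h in auto)
      moreover have "- (bump v x * \<bar>?\<psi> (x - h) - ?\<psi> x\<bar>) \<le> bump v x * (?\<psi> (x - h) - ?\<psi> x)"
        unfolding mult_minus_right[symmetric] using bump_nonneg by (intro mult_left_mono) auto
      moreover have "indicator {-h<..<h} x = (1::real)" using 2 by (simp add: indicator_def)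
      ultimately show ?thesis by simp
    next
      case 3
      have "?\<psi> x \<le> ?\<psi> (x - h)" by (rule conv_copart_anti[OF S]) (use 3 h in auto)
      then show ?thesis using bump_nonneg[of x] 3 by simp
    qed
  qed
  have bi: "integrable lborel (\<lambda>x. indicator {-h<..<h} x * (2 * \<Lambda> * h * (lc * h)))" for h
    by (intro integrable_mult_left) simp
  have bint: "(\<integral>x. indicator {-h<..<h} x * (2 * \<Lambda> * h * (lc * h)) \<partial>lborel) = h * (4 * \<Lambda> * lc * h\<^sup>2)" if "0 < h" for h
    using that by (simp add: power2_eq_square)
  text \<open>A lower bound for \<open>J h / h\<close> that tends to \<open>D\<close> forces \<open>D \<le> 0\<close>.\<close>
  have key: "D \<le> 0"
    if lb: "\<And>h. 0 < h \<Longrightarrow> h < d \<Longrightarrow> h * D - A * h\<^sup>2 - B * (h * h\<^sup>2) \<le> J h" and d: "0 < d" for D A B d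
  proof -
    have "((\<lambda>h. J h / h + A * h + B * h\<^sup>2) \<longlongrightarrow> 0 + A * 0 + B * 0\<^sup>2) (at_right 0)"
      by (intro tendsto_intros J)
    then have l: "((\<lambda>h. J h / h + A * h + B * h\<^sup>2) \<longlongrightarrow> 0) (at_right 0)" by simp
    have "\<forall>\<^sub>F h in at_right 0. 0 < h \<and> h < d"
      using d eventually_at_right_real[of 0 d] by (auto elim: eventually_mono)
    then have "\<forall>\<^sub>F h in at_right 0. D \<le> J h / h + A * h + B * h\<^sup>2"
    proof eventually_elim
      case (elim h)
      have "h * (D - A * h - B * h\<^sup>2) \<le> J h"
        using lb[of h] elim by (simp add: algebra_simps power2_eq_square)
      then have "D - A * h - B * h\<^sup>2 \<le> J h / h"
        using elim by (simp add: pos_le_divide_eq mult.commute)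
      then show ?case by linarith
    qed
    then show ?thesis by (rule tendsto_lowerbound[OF l]) simp
  qed
  have "(\<integral>t. \<Delta> t \<partial>lborel) \<le> 0"
  proof (rule key[where d=1 and A="v 0 * (2 * lc)" and B="4 * \<Lambda> * lc"])
    fix h :: real assume h: "0 < h"
    have "- (h * (4 * \<Lambda> * lc * h\<^sup>2)) \<le> (\<integral>x. bump v x * (?\<psi> (x - h) - ?\<psi> x) \<partial>lborel)"
      unfolding bint[OF h, symmetric] Bochner_Integration.integral_minus[symmetric]
      by (intro integral_mono i2 bump_pw[OF h] Bochner_Integration.integrable_minus bi)
    then show "h * (\<integral>t. \<Delta> t \<partial>lborel) - v 0 * (2 * lc) * h\<^sup>2 - 4 * \<Lambda> * lc * (h * h\<^sup>2) \<le> J h"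
      using chain[OF h] unfolding J_split by (simp add: abs_le_iff algebra_simps)
  qed simp
  then have "(\<integral>t. \<Delta> t \<partial>lborel) = 0"
    using \<Delta>0 by (intro antisym Bochner_Integration.integral_nonneg) auto
  then have "AE t in lborel. \<Delta> t = 0"
    using integral_nonneg_eq_0_iff_AE[OF \<Delta>i] \<Delta>0 by simp
  then show "AE t in lborel. t \<in> S \<longrightarrow> 0 < t \<longrightarrow> t < v 0 \<longrightarrow> ?\<psi> (left_end t) = ?\<psi> (reach v t)"
    by eventually_elim (auto simp: \<Delta>_def)
  assume xy: "0 < x" "x < y" "\<And>z. x \<le> z \<Longrightarrow> z \<le> y \<Longrightarrow> low v z < v z"
  have "continuous_on {x..y} (\<lambda>z. v z - low v z)"
    by (intro continuous_intros v_cont low_cont)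
  then obtain z0 where z0: "z0 \<in> {x..y}" "\<And>z. z \<in> {x..y} \<Longrightarrow> v z0 - low v z0 \<le> v z - low v z"
    using continuous_attains_inf[of "{x..y}" "\<lambda>z. v z - low v z"] xy by auto
  \<comment> \<open>A positive lower bound for the bump on \<open>[x, y]\<close>. A block of height
    \<open>q\<close> over this interval contributes \<open>q * (?\<psi> x - ?\<psi> y)\<close> to
    first order.\<close>
  define q where "q = v z0 - low v z0"
  have q: "0 < q" "\<And>z. x \<le> z \<Longrightarrow> z \<le> y \<Longrightarrow> q \<le> bump v z"
    using z0 xy by (auto simp: q_def bump_def)
  have "q * (?\<psi> x - ?\<psi> y) \<le> 0"
  proof (rule key[where d=x and A="v 0 * (2 * lc) + q * (2 * lc)" and B="4 * \<Lambda> * lc"])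
    fix h :: real assume h: "0 < h" "h < x"
    have ii: "integrable lborel (\<lambda>z. indicator {x<..<y} z * (?\<psi> (z - h) - ?\<psi> z))"
      by (rule integrable_mult_bounded[OF _ _ sh]) auto
    have pw: "q * (indicator {x<..<y} z * (?\<psi> (z - h) - ?\<psi> z))
        - indicator {-h<..<h} z * (2 * \<Lambda> * h * (lc * h)) \<le> bump v z * (?\<psi> (z - h) - ?\<psi> z)" for z
    proof (cases "x < z \<and> z < y")
      case True
      have "?\<psi> z \<le> ?\<psi> (z - h)" by (rule conv_copart_anti[OF S]) (use True h in auto)
      then have "q * (?\<psi> (z - h) - ?\<psi> z) \<le> bump v z * (?\<psi> (z - h) - ?\<psi> z)"
        using q(2)[of z] True by (intro mult_right_mono) auto
      then show ?thesis using True h by simp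
    next
      case False
      then show ?thesis using bump_pw[OF h(1), of z] by auto
    qed
    have "q * (\<integral>z. indicator {x<..<y} z * (?\<psi> (z - h) - ?\<psi> z) \<partial>lborel) - h * (4 * \<Lambda> * lc * h\<^sup>2)
        = (\<integral>z. q * (indicator {x<..<y} z * (?\<psi> (z - h) - ?\<psi> z))
            - indicator {-h<..<h} z * (2 * \<Lambda> * h * (lc * h)) \<partial>lborel)"
      using ii bi[of h] unfolding bint[OF h(1), symmetric] by simp
    also have "\<dots> \<le> (\<integral>x. bump v x * (?\<psi> (x - h) - ?\<psi> x) \<partial>lborel)"
      by (intro integral_mono i2 pw Bochner_Integration.integrable_diff integrable_mult_right ii bi)
    finally have 1: "q * (\<integral>z. indicator {x<..<y} z * (?\<psi> (z - h) - ?\<psi> z) \<partial>lborel) - h * (4 * \<Lambda> * lc * h\<^sup>2)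
        \<le> (\<integral>x. bump v x * (?\<psi> (x - h) - ?\<psi> x) \<partial>lborel)" .
    have "h * (?\<psi> x - ?\<psi> y) - 2 * lc * h\<^sup>2 \<le> (\<integral>z. indicator {x<..<y} z * (?\<psi> (z - h) - ?\<psi> z) \<partial>lborel)"
      using interval_shift_estimate[of ?\<psi> lc h x y] \<psi>l h xy by (simp add: abs_le_iff)
    then have "q * (h * (?\<psi> x - ?\<psi> y) - 2 * lc * h\<^sup>2)
        \<le> q * (\<integral>z. indicator {x<..<y} z * (?\<psi> (z - h) - ?\<psi> z) \<partial>lborel)"
      using q(1) by (intro mult_left_mono) auto
    moreover have "0 \<le> h * (\<integral>t. \<Delta> t \<partial>lborel)"
      using h \<Delta>0 by (simp add: Bochner_Integration.integral_nonneg)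
    ultimately show "h * (q * (?\<psi> x - ?\<psi> y)) - (v 0 * (2 * lc) + q * (2 * lc)) * h\<^sup>2 - 4 * \<Lambda> * lc * (h * h\<^sup>2) \<le> J h"
      using 1 chain[OF h(1)] unfolding J_split by (simp add: abs_le_iff algebra_simps)
  qed (use xy in auto)
  then have "?\<psi> x \<le> ?\<psi> y" using q(1) by (simp add: mult_le_0_iff)
  moreover have "?\<psi> y \<le> ?\<psi> x" by (rule conv_copart_anti[OF S]) (use xy in auto)
  ultimately show "?\<psi> x = ?\<psi> y" by simp
qed

end

section \<open>How an equality case of the reflection comparison persists when the points move
  apart\<close>

context kernel
begin

text \<open>Two terms of the right-hand side reproduce the left-hand side. The other two compare by
  monotonicity, as \<open>h \<le> B\<close> makes \<open>Y + h - B\<close> the argument closer to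
  the origin.\<close>

lemma H_shift_sum:
  assumes "0 < Y" "0 < h" "h \<le> B" "Y \<noteq> B - h"
  shows "H (Y - (B + h)) - H (Y + (B + h))
    \<le> (H ((Y - h) - B) - H ((Y - h) + B)) + (H ((Y + h) - B) - H ((Y + h) + B))"
proof -
  have "H (Y - h + B) \<le> H (Y + h - B)" by (rule H_le) (use assms in auto)
  moreover have e: "Y - (B + h) = (Y - h) - B" "Y + (B + h) = (Y + h) + B" by simp_all
  ultimately show ?thesis unfolding e by linarith
qed

text \<open>Where the reflected difference \<open>\<delta>\<close> of \<open>w\<close> exceeds \<open>2 C h\<close>, the kernel difference vanishes at
  the neighbouring points \<open>Y \<plusminus> h\<close>, hence at \<open>Y\<close> as well; where \<open>0 < \<delta> \<le> 2 C h\<close> it vanishes at \<open>Y\<close>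
  before the shift. Both effects together make the loss \<open>o(h)\<close>.\<close>

lemma reflection_stability:
  assumes m: "w \<in> borel_measurable borel" and M: "\<And>y. \<bar>w y\<bar> \<le> M"
    and lip: "\<And>x y. \<bar>w x - w y\<bar> \<le> C * \<bar>x - y\<bar>"
    and ord: "\<And>Y. 0 < Y \<Longrightarrow> w (l + Y) \<le> w (l - Y)"
    and eq: "conv w (l - B) = conv w (l + B)" and h: "0 < h" "h \<le> B"
  shows "conv w (l - (B + h)) - conv w (l + (B + h)) \<le> 4 * C * h * core h"
proof -
  have [measurable]: "w \<in> borel_measurable borel" by (rule m)
  have C0: "0 \<le> C" using lip[of 0 1] by simp
  have B: "0 < B" using h by simp
  define \<delta> where "\<delta> = (\<lambda>Y. w (l - Y) - w (l + Y))"
  define k where "k = (\<lambda>B Y. H (Y - B) - H (Y + B))"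
  have \<delta>l: "\<bar>\<delta> Y - \<delta> Z\<bar> \<le> 2 * C * \<bar>Y - Z\<bar>" for Y Z
  proof -
    have "\<bar>w (l - Y) - w (l - Z)\<bar> \<le> C * \<bar>Y - Z\<bar>" "\<bar>w (l + Y) - w (l + Z)\<bar> \<le> C * \<bar>Y - Z\<bar>"
      using lip[of "l - Y" "l - Z"] lip[of "l + Y" "l + Z"] by (simp_all add: abs_minus_commute)
    then show ?thesis unfolding \<delta>_def by linarith
  qed
  have \<delta>odd: "\<delta> (- Y) = - \<delta> Y" for Y by (simp add: \<delta>_def)
  have kodd: "k B (- Y) = - k B Y" for B Y
  proof -
    have "- Y - B = - (Y + B)" "- Y + B = - (Y - B)" by simp_all
    then show ?thesis unfolding k_def by (simp only: H_even)
  qed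
  \<comment> \<open>Made for the case of small \<open>\<delta>\<close>, which
    \<open>2 * C * h\<close> then bounds; each absolute difference has integral at most
    \<open>2 * core h\<close>. Evenness of \<open>G\<close> transfers the bound to negative
    \<open>Y\<close>.\<close>
  define G where "G = (\<lambda>Y. 2 * C * h * (\<bar>H (Y - B - h) - H (Y - B)\<bar> + \<bar>H (Y + B + h) - H (Y + B)\<bar>))"
  have Geven: "G (- Y) = G Y" for Y
  proof -
    have "- Y - B - h = - (Y + B + h)" "- Y - B = - (Y + B)" "- Y + B + h = - (Y - B - h)" "- Y + B = - (Y - B)"
      by simp_all
    then show ?thesis unfolding G_def by (simp only: H_even add.commute)
  qed
  have G0: "0 \<le> G Y" for Y unfolding G_def using C0 h by (intro mult_nonneg_nonneg add_nonneg_nonneg) auto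
  have z: "AE Y in lborel. k B Y * \<delta> Y = 0"
    using conv_reflection_eq_AE[OF m M B ord eq] by (simp add: k_def \<delta>_def)
  have zp: "AE Y in lborel. k B (Y + h) * \<delta> (Y + h) = 0"
    using AE_lborel_affine[OF z, of 1 h] by (simp add: add.commute)
  have zm: "AE Y in lborel. k B (Y - h) * \<delta> (Y - h) = 0"
    using AE_lborel_affine[OF z, of 1 "- h"] by (simp add: add.commute)
  have pos: "AE Y in lborel. 0 < Y \<longrightarrow> k (B + h) Y * \<delta> Y \<le> G Y"
    using z zp zm AE_lborel_neq[of "B - h"]
  proof eventually_elim
    case (elim Y)
    show ?case
    proof
      assume Y: "0 < Y"
      have \<delta>0: "0 \<le> \<delta> Y" using ord[OF Y] by (simp add: \<delta>_def)
      consider "\<delta> Y = 0" | "0 < \<delta> Y" "\<delta> Y \<le> 2 * C * h" | "2 * C * h < \<delta> Y" using \<delta>0 by linarith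
      then show "k (B + h) Y * \<delta> Y \<le> G Y"
      proof cases
        case 1 then show ?thesis using G0 by simp
      next
        case 2
        then have "k B Y = 0" using elim(1) by simp
        then have "k (B + h) Y = (H (Y - B - h) - H (Y - B)) - (H (Y + B + h) - H (Y + B))"
          by (simp add: k_def algebra_simps)
        then have "k (B + h) Y \<le> \<bar>H (Y - B - h) - H (Y - B)\<bar> + \<bar>H (Y + B + h) - H (Y + B)\<bar>" by linarith
        then have "k (B + h) Y * \<delta> Y \<le> (\<bar>H (Y - B - h) - H (Y - B)\<bar> + \<bar>H (Y + B + h) - H (Y + B)\<bar>) * \<delta> Y"
          using \<delta>0 by (rule mult_right_mono)
        also have "\<dots> \<le> (\<bar>H (Y - B - h) - H (Y - B)\<bar> + \<bar>H (Y + B + h) - H (Y + B)\<bar>) * (2 * C * h)"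
          using 2 by (intro mult_left_mono) auto
        finally show ?thesis unfolding G_def by (simp only: mult.commute)
      next
        case 3
        then have "0 < \<delta> (Y + h)" "0 < \<delta> (Y - h)"
          using \<delta>l[of "Y + h" Y] \<delta>l[of "Y - h" Y] h by (simp_all add: abs_le_iff)
        then have "k B (Y + h) = 0" "k B (Y - h) = 0" using elim by auto
        then have "k (B + h) Y \<le> 0"
          using H_shift_sum[OF Y h elim(4)] unfolding k_def by linarith
        then have "k (B + h) Y * \<delta> Y \<le> 0" using \<delta>0 by (rule mult_nonpos_nonneg)
        then show ?thesis using G0[of Y] by linarith
      qed
    qed
  qed
  have neg: "AE Y in lborel. 0 < - Y \<longrightarrow> k (B + h) (- Y) * \<delta> (- Y) \<le> G (- Y)"
    using AE_lborel_affine[OF pos, of "-1" 0] by simp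
  have all: "AE Y in lborel. k (B + h) Y * \<delta> Y \<le> G Y"
    using pos neg AE_lborel_neq[of 0]
    by eventually_elim (auto simp: kodd \<delta>odd Geven neq_iff)
  have s1: "integrable lborel (\<lambda>Y. \<bar>H (Y - B - h) - H (Y - B)\<bar>)"
    "(\<integral>Y. \<bar>H (Y - B - h) - H (Y - B)\<bar> \<partial>lborel) \<le> 2 * core h"
  proof -
    have e: "\<bar>H (Y - B - h) - H (Y - B)\<bar> = \<bar>H ((Y + (- B - h)) + h) - H (Y + (- B - h))\<bar>" for Y
    proof -
      have "Y + (- B - h) + h = Y - B" "Y - B - h = Y + (- B - h)" by simp_all
      then show ?thesis by (metis abs_minus_commute)
    qed
    show "integrable lborel (\<lambda>Y. \<bar>H (Y - B - h) - H (Y - B)\<bar>)"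
      unfolding e by (rule integrable_lborel_shift[OF shift_L1(1)[OF h(1)]])
    show "(\<integral>Y. \<bar>H (Y - B - h) - H (Y - B)\<bar> \<partial>lborel) \<le> 2 * core h"
      unfolding e using shift_L1(2)[OF h(1)]
        integral_lborel_shift[of "\<lambda>Y. \<bar>H (Y + h) - H Y\<bar>" "- B - h"] by simp
  qed
  have s2: "integrable lborel (\<lambda>Y. \<bar>H (Y + B + h) - H (Y + B)\<bar>)"
    "(\<integral>Y. \<bar>H (Y + B + h) - H (Y + B)\<bar> \<partial>lborel) \<le> 2 * core h"
    using integrable_lborel_shift[OF shift_L1(1)[OF h(1)], of B] shift_L1(2)[OF h(1)]
      integral_lborel_shift[of "\<lambda>Y. \<bar>H (Y + h) - H Y\<bar>" B] by simp_all
  have "2 * (conv w (l - (B + h)) - conv w (l + (B + h))) = (\<integral>Y. k (B + h) Y * \<delta> Y \<partial>lborel)"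
    using conv_reflection(1)[OF m M, of l "B + h"] by (simp add: k_def \<delta>_def)
  moreover have "(\<integral>Y. k (B + h) Y * \<delta> Y \<partial>lborel) \<le> (\<integral>Y. G Y \<partial>lborel)"
  proof (rule integral_mono_AE[OF _ _ all])
    show "integrable lborel (\<lambda>Y. k (B + h) Y * \<delta> Y)"
      using conv_reflection(2)[OF m M, of "B + h" l] by (simp add: k_def \<delta>_def)
    show "integrable lborel G"
      unfolding G_def by (rule integrable_mult_right[OF Bochner_Integration.integrable_add[OF s1(1) s2(1)]])
  qed
  moreover have "(\<integral>Y. G Y \<partial>lborel) = 2 * C * h * ((\<integral>Y. \<bar>H (Y - B - h) - H (Y - B)\<bar> \<partial>lborel)
      + (\<integral>Y. \<bar>H (Y + B + h) - H (Y + B)\<bar> \<partial>lborel))"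
    unfolding G_def integral_mult_right_zero Bochner_Integration.integral_add[OF s1(1) s2(1)] ..
  moreover have "2 * C * h * ((\<integral>Y. \<bar>H (Y - B - h) - H (Y - B)\<bar> \<partial>lborel)
      + (\<integral>Y. \<bar>H (Y + B + h) - H (Y + B)\<bar> \<partial>lborel)) \<le> 2 * C * h * (2 * core h + 2 * core h)"
    using s1(2) s2(2) C0 h by (intro mult_left_mono add_mono) auto
  ultimately show ?thesis by (simp add: algebra_simps)
qed

end

context profile
begin

lemma copart_lip:
  assumes S: "S \<in> sets borel"
  shows "\<bar>copart v S x - copart v S y\<bar> \<le> 3 * \<Lambda> * \<bar>x - y\<bar>"
proof -
  interpret m: profile H "\<lambda>x. v (- x)" \<kappa> \<Lambda> R by (rule profile_reflect)
  show ?thesis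
    using m.part_lip[OF borel_comp[OF S], of "- x" "- y"] by (simp add: copart_def abs_minus_commute)
qed

lemma copart_right: "0 \<le> y \<Longrightarrow> copart v S y = count (- S) (low v y)"
  by (simp add: copart_def part_def low_reflect)

lemma conv_part_mono:
  assumes S: "splits v S" and ab: "a \<le> b" "a + b \<le> 0"
  shows "conv (part v S) a \<le> conv (part v S) b"
proof -
  interpret m: profile H "\<lambda>x. v (- x)" \<kappa> \<Lambda> R by (rule profile_reflect)
  have e: "copart (\<lambda>x. v (- x)) (- S) = (\<lambda>x. part v S (- x))" by (simp add: copart_def fun_eq_iff)
  show ?thesis
    using m.conv_copart_anti[OF splits_reflect[OF S], of "- b" "- a"] ab
    by (simp add: e conv_uminus)
qed

lemma first_variation_chain_part:
  assumes S: "splits v S"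
  shows "AE t in lborel. t \<notin> S \<longrightarrow> 0 < t \<longrightarrow> t < v 0 \<longrightarrow>
      conv (part v S) (left_end t) = conv (part v S) (reach v t)"
proof -
  interpret m: profile H "\<lambda>x. v (- x)" \<kappa> \<Lambda> R by (rule profile_reflect)
  have e: "copart (\<lambda>x. v (- x)) (- S) = (\<lambda>x. part v S (- x))" by (simp add: copart_def fun_eq_iff)
  show ?thesis
    using m.first_variation_chain[OF splits_reflect[OF S]]
    by eventually_elim (auto simp: e conv_uminus m.left_end_def left_end_def)
qed

end

section \<open>Rigidity at a low level with layers that do not lean to the right just above
  it\<close>

locale gap_level = profile +
  fixes \<gamma> :: real
  assumes \<gamma>_pos: "0 < \<gamma>" and \<gamma>_R: "\<gamma> < low v R" and \<gamma>_mR: "\<gamma> < low v (- R)"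
    and nonnull: "\<And>e. 0 < e \<Longrightarrow> emeasure lborel (- right_levels v \<inter> {\<gamma><..<\<gamma> + e}) \<noteq> 0"
begin

abbreviation "S \<equiv> right_levels v"
abbreviation "b \<equiv> reach v \<gamma>"

lemma \<gamma>_0: "\<gamma> < v 0"
  using \<gamma>_R low_le_0[of R] by linarith

lemma b_R: "R < b"
  using reach_iff[OF \<gamma>_pos _ \<gamma>_0, of R] R_pos \<gamma>_R by simp

lemma count_less: "\<gamma> < s \<Longrightarrow> count (- S) \<gamma> < count (- S) s"
  using nonnull \<gamma>_pos by (intro count_strict borel_comp right_levels_borel) auto

text \<open>By \<open>nonnull\<close>, the levels outside \<open>S\<close> have positive measure in
  every interval above \<open>\<gamma>\<close>. Their layers end no later than \<open>b\<close>, so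
  the copart drops strictly there; this drop drives the arguments that follow.\<close>

lemma copart_less:
  assumes "0 \<le> y" "y < b" "b \<le> z"
  shows "copart v S z < copart v S y"
proof -
  have b0: "0 < b" using b_R R_pos by linarith
  have "low v z \<le> \<gamma>" using low_anti[of b z] low_reach[OF \<gamma>_pos \<gamma>_0] b0 assms by simp
  then have "copart v S z \<le> count (- S) \<gamma>"
    using assms b0 by (simp add: copart_right count_mono borel_comp right_levels_borel)
  also have "\<dots> < copart v S y"
    using assms reach_iff[OF \<gamma>_pos assms(1) \<gamma>_0] by (simp add: copart_right count_less)
  finally show ?thesis .
qed

text \<open>Where the bump is positive on \<open>[x, x + e]\<close>, first variation makes
  \<open>conv (copart v S)\<close> equal at the two ends. Reflection about the midpoint
  \<open>l\<close> then gives equal values of the copart at \<open>l - R\<close> and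
  \<open>l + R\<close>, which the drop at \<open>b\<close> forbids if
  \<open>l - R < b\<close>.\<close>

lemma bump_far:
  assumes x: "0 < x" "low v x = \<gamma>" "\<gamma> < v x"
  shows "b + R \<le> x"
proof (rule ccontr)
  assume "\<not> ?thesis"
  then have xR: "x < b + R" by simp
  have bx: "b \<le> x" using reach_iff[OF \<gamma>_pos _ \<gamma>_0, of x] x by simp
  have lim: "((\<lambda>z. v z - low v z) \<longlongrightarrow> v x - low v x) (at x)"
    using v_cont[of UNIV] low_cont[of UNIV] by (intro tendsto_intros) (auto simp: continuous_on_def)
  have "\<forall>\<^sub>F z in at x. 0 < v z - low v z" by (rule order_tendstoD(1)[OF lim]) (use x in simp)
  then obtain d where d: "d > 0" "\<And>z. z \<noteq> x \<Longrightarrow> dist z x < d \<Longrightarrow> 0 < v z - low v z"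
    unfolding eventually_at by auto
  \<comment> \<open>Small enough for the bump to stay positive up to \<open>x + e\<close> and for
    \<open>x + e / 2 - R\<close> to stay below \<open>b\<close>.\<close>
  define e where "e = min (d / 2) (min R (b + R - x))"
  have e: "0 < e" "e < d" "e \<le> R" "e \<le> b + R - x" using d(1) R_pos xR by (auto simp: e_def min_less_iff_disj)
  define l B where lB: "l = x + e / 2" "B = e / 2"
  have "conv (copart v S) x = conv (copart v S) (x + e)"
  proof (rule first_variation_bump[OF splits_right_levels])
    show "low v z < v z" if "x \<le> z" "z \<le> x + e" for z
      using d(2)[of z] that e x by (cases "z = x") (auto simp: dist_real_def)
  qed (use x e in auto)
  moreover have "l - B = x" "l + B = x + e" by (simp_all add: lB)
  ultimately have eq: "conv (copart v S) (l - B) = conv (copart v S) (l + B)" by (simp only:)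
  have "copart v S (l + R) = copart v S (l - R)"
  proof (rule conv_reflection_eq[OF _ _ _ _ eq R])
    show "copart v S (l + Y) \<le> copart v S (l - Y)" if "0 < Y" for Y
      using that x e by (intro copart_dominated splits_right_levels) (simp add: lB)
    show "\<bar>copart v S y\<bar> \<le> height" for y by (rule copart_abs_le[OF right_levels_borel])
  qed (use e R_pos in \<open>auto simp: lB intro: copart_cont right_levels_borel\<close>)
  moreover have "copart v S (l + R) < copart v S (l - R)"
    by (rule copart_less) (use e bx b_R R_pos in \<open>auto simp: lB\<close>)
  ultimately show False by simp
qed

text \<open>Just above \<open>\<gamma>\<close> there are levels \<open>s\<close> outside
  \<open>S\<close> for which \<open>conv (part v S)\<close> agrees at both ends. Stability lets both
  ends move out by \<open>h\<close>; on the left this does not raise the value, so on the right it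
  rises by at most \<open>12 * \<Lambda> * h * core h\<close>, where \<open>12 = 4 * 3\<close>
  contains the Lipschitz constant \<open>3 * \<Lambda>\<close> of the part. Levels close to
  \<open>\<gamma>\<close> bring \<open>reach v s\<close> close to \<open>b\<close>.\<close>

lemma part_conv_upper:
  assumes h: "0 < h" "h \<le> R / 2"
  shows "conv (part v S) (b + h) \<le> conv (part v S) b + 12 * \<Lambda> * h * core h"
proof (rule field_le_epsilon)
  fix e :: real assume e: "0 < e"
  \<comment> \<open>The passage between \<open>reach v s\<close> and \<open>b\<close> is made twice,
    each time at cost \<open>lc * d\<close>.\<close>
  define d where "d = e / (2 * (lc + 1))"
  have d: "0 < d" "2 * lc * d \<le> e" using e lc_nn by (auto simp: d_def field_simps)
  define y where "y = max R (b - d)"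
  have y: "0 \<le> y" "y < b" "b - d \<le> y" "R \<le> y" using b_R R_pos d(1) by (auto simp: y_def)
  have ly: "\<gamma> < low v y" using reach_iff[OF \<gamma>_pos y(1) \<gamma>_0] y(2) by simp
  define T where "T = min (low v y) (low v (- R))"
  have T: "\<gamma> < T" using ly \<gamma>_mR by (simp add: T_def)
  have "\<exists>s. s \<notin> S \<and> \<gamma> < s \<and> s < T \<and> conv (part v S) (left_end s) = conv (part v S) (reach v s)"
  proof (rule ccontr)
    assume no: "\<not> ?thesis"
    have "AE s in lborel. s \<notin> - S \<inter> {\<gamma><..<\<gamma> + (T - \<gamma>)}"
      using first_variation_chain_part[OF splits_right_levels]
    proof eventually_elim
      case (elim s)
      have "T \<le> v 0" using low_le_0[of y] by (simp add: T_def)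
      then show ?case using elim no \<gamma>_pos by auto
    qed
    then have "- S \<inter> {\<gamma><..<\<gamma> + (T - \<gamma>)} \<in> null_sets lborel"
      by (subst AE_iff_null_sets) (auto intro!: sets.Int borel_comp right_levels_borel)
    then show False using nonnull[of "T - \<gamma>"] T by (simp add: null_sets_def)
  qed
  then obtain s where s: "s \<notin> S" "\<gamma> < s" "s < T"
    "conv (part v S) (left_end s) = conv (part v S) (reach v s)" by blast
  have s0: "0 < s" "s < v 0" using s \<gamma>_pos low_le_0[of y] by (auto simp: T_def)
  have bs: "y < reach v s" "reach v s \<le> b"
    using reach_iff[OF s0(1) y(1) s0(2)] s reach_anti[of \<gamma> s] \<gamma>_pos s0 by (auto simp: T_def)
  have le: "left_end s < 0" by (rule left_end_neg[OF s0])
  have sum: "left_end s + reach v s \<le> 0"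
    using right_levels_reach[OF s0] s(1) by (simp add: left_end_def)
  define l B where lB: "l = - (left_end s + reach v s) / 2" "B = (reach v s - left_end s) / 2"
  have lB': "l - B = - reach v s" "l + B = - left_end s" by (simp_all add: lB field_simps)
  have lBh: "- (l - (B + h)) = reach v s + h" "- (l + (B + h)) = left_end s - h"
    by (simp_all add: lB field_simps)
  have B: "h \<le> B" using bs y le h by (simp add: lB)
  have l0: "0 \<le> l" using sum by (simp add: lB)
  have "conv (\<lambda>x. part v S (- x)) (l - (B + h)) - conv (\<lambda>x. part v S (- x)) (l + (B + h))
      \<le> 4 * (3 * \<Lambda>) * h * core h"
  proof (rule reflection_stability)
    show "(\<lambda>x. part v S (- x)) \<in> borel_measurable borel"
      using part_borel[OF right_levels_borel] by measurable
    show "\<bar>part v S (- y)\<bar> \<le> height" for y by (rule part_abs_le[OF right_levels_borel])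
    show "\<bar>part v S (- x) - part v S (- y)\<bar> \<le> 3 * \<Lambda> * \<bar>x - y\<bar>" for x y
      using part_lip[OF right_levels_borel, of "- x" "- y"] by (simp add: abs_minus_commute)
    show "part v S (- (l + Y)) \<le> part v S (- (l - Y))" if "0 < Y" for Y
      using l0 that by (intro part_dominated splits_right_levels) linarith
    show "conv (\<lambda>x. part v S (- x)) (l - B) = conv (\<lambda>x. part v S (- x)) (l + B)"
      using s(4) by (simp add: conv_uminus lB')
  qed (use h B in auto)
  then have 1: "conv (part v S) (reach v s + h) - conv (part v S) (left_end s - h) \<le> 12 * \<Lambda> * h * core h"
    unfolding conv_uminus lBh by simp
  have 2: "conv (part v S) (left_end s - h) \<le> conv (part v S) (left_end s)"
    by (rule conv_part_mono[OF splits_right_levels]) (use le h in auto)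
  have db: "lc * \<bar>b - reach v s\<bar> \<le> lc * d"
    using bs y lc_nn by (intro mult_left_mono) auto
  have 3: "conv (part v S) (b + h) \<le> conv (part v S) (reach v s + h) + lc * d"
    using conv_part_lip[OF right_levels_borel, of "b + h" "reach v s + h"] db by (simp add: abs_le_iff)
  have 4: "conv (part v S) (reach v s) \<le> conv (part v S) b + lc * d"
    using conv_part_lip[OF right_levels_borel, of b "reach v s"] db by (simp add: abs_le_iff)
  show "conv (part v S) (b + h) \<le> conv (part v S) b + 12 * \<Lambda> * h * core h + e"
    using 1 2 3 4 s(4) d(2) by linarith
qed

text \<open>Reflect about \<open>b + h / 2\<close>. The copart differs by \<open>2 * m0 > 0\<close>
  between \<open>b - R\<close> and \<open>b + R\<close>, hence by at least \<open>m0\<close> at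
  nearby pairs, and the kernel difference near \<open>R\<close> has integral at least
  \<open>q * h\<close>.\<close>

lemma copart_conv_gain:
  obtains q d where "0 < q" "0 < d"
    "\<And>h. 0 < h \<Longrightarrow> h < d \<Longrightarrow> conv (copart v S) (b + h) + q * h \<le> conv (copart v S) b"
proof -
  let ?g = "copart v S"
  note sb = right_levels_borel
  define m0 where "m0 = (?g (b - R) - ?g (b + R)) / 2"
  have m0: "0 < m0" using copart_less[of "b - R" "b + R"] b_R R_pos by (simp add: m0_def)
  \<comment> \<open>\<open>R / 3\<close> gives \<open>2 * e < R\<close>. The other bound absorbs two
    errors of \<open>3 * \<Lambda> * (2 * e)\<close>, one near each of \<open>b - R\<close> and
    \<open>b + R\<close>, into half of \<open>2 * m0\<close>.\<close>
  define e where "e = min (R / 3) (m0 / (12 * \<Lambda> + 1))"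
  have e: "0 < e" "2 * e < R" "12 * \<Lambda> * e \<le> m0"
  proof -
    show "0 < e" using R_pos m0 \<Lambda>_nn by (simp add: e_def)
    show "2 * e < R" using R_pos by (simp add: e_def min_def)
    have "12 * \<Lambda> * e \<le> 12 * \<Lambda> * (m0 / (12 * \<Lambda> + 1))"
      using \<Lambda>_nn by (intro mult_left_mono) (auto simp: e_def)
    also have "\<dots> \<le> m0" using \<Lambda>_nn m0 by (simp add: field_simps)
    finally show "12 * \<Lambda> * e \<le> m0" .
  qed
  obtain q where q: "0 < q" "\<And>h. 0 < h \<Longrightarrow> h < e \<Longrightarrow>
      q * h \<le> (\<integral>Y. indicator {R - e<..<R + e} Y * (H (Y - h / 2) - H (Y + h / 2)) \<partial>lborel)"
    using jump_gain[OF R e(1,2)] by blast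
  have "conv ?g (b + h) + (m0 * q / 2) * h \<le> conv ?g b" if h: "0 < h" "h < e" for h
  proof -
    define l where "l = b + h / 2"
    let ?k = "\<lambda>Y. H (Y - h / 2) - H (Y + h / 2)"
    let ?\<delta> = "\<lambda>Y. ?g (l - Y) - ?g (l + Y)"
    have ord: "?g (l + Y) \<le> ?g (l - Y)" if "0 < Y" for Y
      using that h b_R R_pos by (intro copart_dominated splits_right_levels) (simp add: l_def)
    have \<delta>: "m0 \<le> ?\<delta> Y" if "R - e < Y" "Y < R + e" for Y
    proof -
      have "\<bar>(l - Y) - (b - R)\<bar> \<le> 2 * e" unfolding l_def using that h by linarith
      then have "3 * \<Lambda> * \<bar>(l - Y) - (b - R)\<bar> \<le> 3 * \<Lambda> * (2 * e)"
        using \<Lambda>_nn by (intro mult_left_mono) auto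
      then have 1: "\<bar>?g (l - Y) - ?g (b - R)\<bar> \<le> 3 * \<Lambda> * (2 * e)"
        by (rule order_trans[OF copart_lip[OF sb]])
      have "\<bar>(l + Y) - (b + R)\<bar> \<le> 2 * e" unfolding l_def using that h by linarith
      then have "3 * \<Lambda> * \<bar>(l + Y) - (b + R)\<bar> \<le> 3 * \<Lambda> * (2 * e)"
        using \<Lambda>_nn by (intro mult_left_mono) auto
      then have 2: "\<bar>?g (l + Y) - ?g (b + R)\<bar> \<le> 3 * \<Lambda> * (2 * e)"
        by (rule order_trans[OF copart_lip[OF sb]])
      have "2 * m0 = ?g (b - R) - ?g (b + R)" by (simp add: m0_def)
      then show ?thesis using 1 2 e(3) by (simp add: abs_le_iff)
    qed
    have ki: "integrable lborel (\<lambda>Y. indicator {R - e<..<R + e} Y * ?k Y)"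
    proof -
      have "integrable lborel (\<lambda>Y. indicator {R - e<..<R + e} Y * H (Y - h / 2)
          - indicator {R - e<..<R + e} Y * H (Y + h / 2))"
        using ind_int[of "{R - e<..<R + e}" "- (h/2)"] ind_int[of "{R - e<..<R + e}" "h/2"]
        by (simp add: add.commute)
      then show ?thesis by (simp add: right_diff_distrib)
    qed
    have "m0 * (q * h) \<le> m0 * (\<integral>Y. indicator {R - e<..<R + e} Y * ?k Y \<partial>lborel)"
      using q(2)[OF h] m0 by (intro mult_left_mono) auto
    also have "\<dots> = (\<integral>Y. m0 * (indicator {R - e<..<R + e} Y * ?k Y) \<partial>lborel)" by simp
    also have "\<dots> \<le> (\<integral>Y. ?k Y * ?\<delta> Y \<partial>lborel)"
    proof (rule integral_mono_AE[OF integrable_mult_right[OF ki]])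
      show "integrable lborel (\<lambda>Y. ?k Y * ?\<delta> Y)"
        by (rule conv_reflection(2)[OF copart_borel copart_abs_le, OF sb sb])
      have nn: "AE Y in lborel. 0 \<le> ?k Y * ?\<delta> Y"
        by (rule AE_reflection_nonneg) (use h ord in auto)
      show "AE Y in lborel. m0 * (indicator {R - e<..<R + e} Y * ?k Y) \<le> ?k Y * ?\<delta> Y"
        using nn AE_lborel_neq[of "h / 2"]
      proof eventually_elim
        case (elim Y)
        show ?case
        proof (cases "R - e < Y \<and> Y < R + e")
          case True
          have "0 \<le> ?k Y" using H_diff_nonneg[of "h / 2" Y] h True e elim(2) by simp
          then have "?k Y * m0 \<le> ?k Y * ?\<delta> Y" using \<delta>[of Y] True by (intro mult_left_mono) auto
          then show ?thesis using True by (simp add: mult.commute)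
        next
          case False
          then have "indicator {R - e<..<R + e} Y = (0::real)" by (auto simp: indicator_def)
          then show ?thesis using elim(1) by simp
        qed
      qed
    qed
    also have "\<dots> = 2 * (conv ?g (l - h / 2) - conv ?g (l + h / 2))"
      by (rule conv_reflection(1)[OF copart_borel copart_abs_le, OF sb sb, symmetric])
    also have "l - h / 2 = b" by (simp add: l_def)
    also have "l + h / 2 = b + h" by (simp add: l_def)
    finally show ?thesis by (simp add: algebra_simps)
  qed
  then show ?thesis using that[of "m0 * q / 2" e] m0 q(1) e(1) by simp
qed

text \<open>If \<open>v\<close> were constant on \<open>[b, b + R)\<close>, so would be \<open>H * v = H * f + H * g\<close>. But to the right of \<open>b\<close>
  the term \<open>H * g\<close> decreases at least linearly while \<open>H * f\<close> gains only \<open>o(h)\<close>.\<close>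

lemma no_plateau:
  assumes flat: "\<And>y. b \<le> y \<Longrightarrow> y < b + R \<Longrightarrow> low v y = \<gamma>"
  shows False
proof -
  have vflat: "v y = \<gamma>" if "b \<le> y" "y < b + R" for y
    using bump_far[of y] flat[OF that] low_le_v[of y] that b_R R_pos by force
  obtain q d where q: "0 < q" "0 < d"
    "\<And>h. 0 < h \<Longrightarrow> h < d \<Longrightarrow> conv (copart v S) (b + h) + q * h \<le> conv (copart v S) b"
    using copart_conv_gain by blast
  obtain p where p: "0 < p" "core p < q / (12 * \<Lambda> + 1)"
    using core_small[of "q / (12 * \<Lambda> + 1)"] q(1) \<Lambda>_nn by auto
  define h where "h = min p (min (d / 2) (R / 2))"
  have h: "0 < h" "h < d" "h \<le> R / 2" "h \<le> p" using p q(2) R_pos by (auto simp: h_def)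
  have "conv v (b + h) = conv v b"
    using vflat[of b] vflat[of "b + h"] h R_pos by (intro conv_eq) auto
  then have "q * h \<le> 12 * \<Lambda> * h * core h"
    using part_conv_upper[OF h(1,3)] q(3)[OF h(1,2)]
      conv_split[OF right_levels_borel, of "b + h"] conv_split[OF right_levels_borel, of b]
    by linarith
  then have "h * q \<le> h * (12 * \<Lambda> * core h)" by (simp add: mult_ac)
  then have "q \<le> 12 * \<Lambda> * core h" using h(1) by simp
  also have "\<dots> \<le> (12 * \<Lambda> + 1) * core p"
    using core_mono[OF h(4)] core_nn[of h] \<Lambda>_nn by (intro mult_mono) auto
  also have "\<dots> < q" using p(2) \<Lambda>_nn by (simp add: field_simps)
  finally show False by simp
qed

text \<open>A point with \<open>v x > \<gamma>\<close> would lie at or beyond \<open>b + R\<close>,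
  and monotonicity would keep \<open>low v\<close> equal to \<open>\<gamma>\<close> from
  \<open>b\<close> up to \<open>x\<close>, which is an excluded plateau.\<close>

lemma no_bump:
  assumes "0 < x" "low v x = \<gamma>"
  shows "v x = \<gamma>"
proof (rule ccontr)
  assume "v x \<noteq> \<gamma>"
  then have "b + R \<le> x" using bump_far[of x] low_le_v[of x] assms by simp
  moreover have "low v b = \<gamma>" by (rule low_reach[OF \<gamma>_pos \<gamma>_0])
  moreover have "0 < b" using b_R R_pos by linarith
  ultimately have "low v y = \<gamma>" if "b \<le> y" "y < b + R" for y
    using that low_anti[of b y] low_anti[of y x] assms by simp
  then show False by (rule no_plateau)
qed

text \<open>For almost every level between \<open>t\<close> and \<open>\<gamma>\<close>,
  \<open>conv (copart v S)\<close> would agree at both ends of its layer. Reflection about the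
  midpoint of such a layer contradicts the drop at \<open>b\<close> unless its right end is at least
  \<open>b + R\<close>. Letting the level rise to \<open>\<gamma>\<close> produces a
  plateau.\<close>

lemma no_right_levels_below:
  assumes t: "0 < t" "t < \<gamma>" and null: "- S \<inter> {t<..<\<gamma>} \<in> null_sets lborel"
  shows False
proof (rule no_plateau)
  let ?g = "copart v S"
  have far: "b + R \<le> reach v s"
    if s: "t < s" "s < \<gamma>" "s \<in> S" and eq: "conv ?g (left_end s) = conv ?g (reach v s)" for s
  proof (rule ccontr)
    assume "\<not> ?thesis"
    then have bR: "reach v s < b + R" by simp
    have s0: "0 < s" "s < v 0" using s t \<gamma>_0 by auto
    interpret m: profile H "\<lambda>x. v (- x)" \<kappa> \<Lambda> R by (rule profile_reflect)
    have aR: "left_end s < - R"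
      using m.reach_iff[of s R] s0 R_pos s(2) \<gamma>_mR by (simp add: left_end_def low_reflect)
    have ls: "0 < left_end s + reach v s"
      using right_levels_reach[OF s0] s(3) by (simp add: left_end_def)
    have bb: "b \<le> reach v s" by (rule reach_anti) (use s t \<gamma>_0 in auto)
    define l B where lB: "l = (left_end s + reach v s) / 2" "B = (reach v s - left_end s) / 2"
    have l0: "0 < l" using ls by (simp add: lB)
    have lB': "l - B = left_end s" "l + B = reach v s" by (simp_all add: lB field_simps)
    \<comment> \<open>The test point is \<open>b\<close> itself, with mirror image
      \<open>2 * l - b\<close> on the negative axis. Since \<open>l > 0\<close>, its distance
      \<open>b - 2 * l\<close> from the origin is smaller than \<open>b\<close>, and the drop at
      \<open>b\<close> separates the two values.\<close>
    have "?g (l + (b - l)) = ?g (l - (b - l))"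
    proof (rule conv_reflection_eq[where B=B, OF _ _ _ _ _ R])
      show "?g (l + Y) \<le> ?g (l - Y)" if "0 < Y" for Y
        using that l0 by (intro copart_dominated splits_right_levels) linarith
      show "\<bar>?g y\<bar> \<le> height" for y by (rule copart_abs_le[OF right_levels_borel])
      show "conv ?g (l - B) = conv ?g (l + B)" using eq by (simp add: lB')
      have d: "b - l - B = b - reach v s" "b - l + B = b - left_end s" by (simp_all add: lB field_simps)
      show "\<bar>b - l - B\<bar> < R" "R < b - l + B"
        unfolding d using bR bb aR b_R R_pos by auto
      show "0 < B" using aR bb b_R R_pos by (simp add: lB)
      have "2 * l = left_end s + reach v s" by (simp add: lB)
      then show "0 < b - l" using bR aR bb b_R by linarith
    qed (auto intro: copart_cont right_levels_borel)
    then have "?g b = ?g (2 * l - b)" by simp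
    moreover have "?g (b - 2 * l) \<le> ?g (2 * l - b)"
      by (rule copart_dominated[OF splits_right_levels]) (use bR aR in \<open>simp add: lB\<close>)
    moreover have "?g b < ?g (b - 2 * l)"
      by (rule copart_less) (use bR aR ls in \<open>auto simp: lB\<close>)
    ultimately show False by simp
  qed
  have ae: "AE s in lborel. t < s \<longrightarrow> s < \<gamma> \<longrightarrow> b + R \<le> reach v s"
  proof -
    have "AE s in lborel. s \<notin> - S \<inter> {t<..<\<gamma>}"
      using null by (rule AE_not_in)
    then show ?thesis
      using first_variation_chain[OF splits_right_levels]
    proof eventually_elim
      case (elim s)
      then show ?case using far[of s] t \<gamma>_0 by auto
    qed
  qed
  fix y assume y: "b \<le> y" "y < b + R"
  have b0: "0 < b" using b_R R_pos by linarith
  show "low v y = \<gamma>"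
  proof (rule antisym)
    show "low v y \<le> \<gamma>" using low_anti[of b y] low_reach[OF \<gamma>_pos \<gamma>_0] b0 y by simp
    show "\<gamma> \<le> low v y"
    proof (rule ccontr)
      assume "\<not> ?thesis"
      then have lt: "max t (low v y) < \<gamma>" using t by simp
      have "AE s in lborel. (if t < s \<and> s < \<gamma> \<and> \<not> b + R \<le> reach v s then 1 else 0 :: real) = 0"
        using ae by eventually_elim auto
      then obtain s where s: "max t (low v y) < s" "s < \<gamma>"
        and "(if t < s \<and> s < \<gamma> \<and> \<not> b + R \<le> reach v s then 1 else 0 :: real) = 0"
        using lt by (rule AE_zero_open)
      then have "b + R \<le> reach v s" by (simp split: if_splits)
      then have "s < low v y"
        using reach_iff[of s y] s y b0 t \<gamma>_0 by auto
      then show False using s by simp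
    qed
  qed
qed

end

context profile
begin

subsection \<open>One-sidedness of the tail\<close>

lemma right_levels_open: "t \<in> right_levels v \<Longrightarrow> \<exists>e>0. {t..<t + e} \<subseteq> right_levels v"
proof -
  assume "t \<in> right_levels v"
  then obtain q where q: "q \<in> \<rat>" "0 \<le> q" "low v (- q) \<le> t" "t < low v q"
    by (auto simp: right_levels_def)
  then have "{t..<t + (low v q - t)} \<subseteq> right_levels v" by (auto simp: right_levels_def)
  then show ?thesis using q(4) by (metis diff_gt_0_iff_gt)
qed

text \<open>Without low right-leaning layers every low level satisfies the assumptions of
  \<open>gap_level\<close>, so \<open>v\<close> equals its running minimum far to the right. At
  equal distance on the left the running minimum is no smaller, as a level in between would lean to
  the right.\<close>

lemma tail_right:
  assumes no: "\<And>t. 0 < t \<Longrightarrow> t < low v R \<Longrightarrow> t < low v (- R) \<Longrightarrow> t \<notin> right_levels v"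
  shows "\<exists>Y. \<forall>y>Y. \<forall>z. \<bar>z\<bar> \<le> y \<longrightarrow> v y \<le> v z"
proof -
  define T where "T = min (low v R) (low v (- R))"
  have T: "0 < T" using low_pos by (simp add: T_def)
  have gl: "gap_level H v \<kappa> \<Lambda> R \<gamma>" if \<gamma>: "0 < \<gamma>" "\<gamma> < T" for \<gamma>
  proof
    fix e :: real assume e: "0 < e"
    define f where "f = min e (T - \<gamma>)"
    have f: "0 < f" using e \<gamma> by (simp add: f_def)
    have "{\<gamma><..<\<gamma> + f} \<subseteq> - right_levels v \<inter> {\<gamma><..<\<gamma> + e}"
      using no \<gamma> by (auto simp: T_def f_def)
    then have "emeasure lborel {\<gamma><..<\<gamma> + f} \<le> emeasure lborel (- right_levels v \<inter> {\<gamma><..<\<gamma> + e})"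
      by (intro emeasure_mono) (auto intro!: sets.Int borel_comp right_levels_borel)
    then show "emeasure lborel (- right_levels v \<inter> {\<gamma><..<\<gamma> + e}) \<noteq> 0" using f by auto
  qed (use \<gamma> in \<open>auto simp: T_def\<close>)
  have "\<forall>\<^sub>F y in at_infinity. low v y < T" using low_lim T by (rule order_tendstoD)
  then obtain Y where Y: "\<And>y. Y \<le> \<bar>y\<bar> \<Longrightarrow> low v y < T" by (auto simp: eventually_at_infinity)
  have "v y \<le> v z" if y: "\<bar>Y\<bar> < y" and z: "\<bar>z\<bar> \<le> y" for y z
  proof -
    have y0: "0 < y" using y by linarith
    have lT: "low v y < T" using Y[of y] y by linarith
    interpret gap_level H v \<kappa> \<Lambda> R "low v y" by (rule gl[OF low_pos lT])
    have "v y = low v y" by (rule no_bump[OF y0 refl])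
    moreover have "low v y \<le> low v z"
    proof (cases "0 \<le> z")
      case True then show ?thesis using z by (intro low_anti) auto
    next
      case False
      have "low v y \<le> low v (- y)"
      proof (rule ccontr)
        assume "\<not> ?thesis"
        then have "low v (- y) \<in> right_levels v" "low v (- y) < T"
          using y0 lT by (auto simp: right_levels_iff intro!: exI[of _ y])
        then show False using no[OF low_pos, of "- y"] by (simp add: T_def)
      qed
      also have "\<dots> \<le> low v z" using False z by (intro low_anti_neg) auto
      finally show ?thesis .
    qed
    ultimately show ?thesis using low_le_v[of z] by linarith
  qed
  then show ?thesis by blast
qed

text \<open>Between a right-leaning level \<open>t\<close> and a left-leaning level \<open>s\<close>
  above it there is a last level \<open>\<gamma>\<close> up to which almost all levels lean to the
  right. It meets the assumptions of \<open>gap_level\<close>, and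
  \<open>no_right_levels_below\<close> excludes it.\<close>

lemma no_switch:
  assumes t: "t \<in> right_levels v" "0 < t" and s: "s \<in> right_levels (\<lambda>x. v (- x))" "t < s"
    and sR: "s < low v R" "s < low v (- R)"
  shows False
proof -
  interpret m: profile H "\<lambda>x. v (- x)" \<kappa> \<Lambda> R by (rule profile_reflect)
  let ?S = "right_levels v"
  have cb: "- ?S \<in> sets borel" by (intro borel_comp right_levels_borel)
  define A where "A = {r. t \<le> r \<and> r \<le> s \<and> - ?S \<inter> {t<..<r} \<in> null_sets lborel}"
  have tA: "t \<in> A" using s(2) by (simp add: A_def)
  have bdd: "bdd_above A" by (auto simp: A_def bdd_above_def)
  define \<gamma> where "\<gamma> = Sup A"
  obtain e where e: "0 < e" "{t..<t + e} \<subseteq> ?S" using right_levels_open[OF t(1)] by blast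
  have "- ?S \<inter> {t<..<min (t + e) s} = {}" using e(2) by (auto simp: subset_iff)
  then have "min (t + e) s \<in> A" using e(1) s(2) by (simp add: A_def)
  then have \<gamma>t: "t < \<gamma>" using cSup_upper[OF _ bdd] e(1) s(2) unfolding \<gamma>_def by fastforce
  have \<gamma>s: "\<gamma> \<le> s" unfolding \<gamma>_def by (rule cSup_least) (use tA in \<open>auto simp: A_def\<close>)
  have null: "- ?S \<inter> {t<..<\<gamma>} \<in> null_sets lborel"
  proof -
    define X where "X = (\<lambda>n. - ?S \<inter> {t<..<\<gamma> - 1 / real (Suc n)})"
    have "X n \<in> null_sets lborel" for n
    proof -
      obtain r where r: "r \<in> A" "\<gamma> - 1 / real (Suc n) < r"
        using less_cSup_iff[of A "\<gamma> - 1 / real (Suc n)"] tA bdd unfolding \<gamma>_def by auto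
      show ?thesis
        by (rule null_sets_subset[of "- ?S \<inter> {t<..<r}"])
          (use r cb in \<open>auto simp: A_def X_def intro!: sets.Int\<close>)
    qed
    then have "(\<Union>n. X n) \<in> null_sets lborel" by (rule null_sets_UN)
    moreover have "- ?S \<inter> {t<..<\<gamma>} \<subseteq> (\<Union>n. X n)"
    proof
      fix x assume x: "x \<in> - ?S \<inter> {t<..<\<gamma>}"
      then obtain n where "1 / real (Suc n) < \<gamma> - x"
        using reals_Archimedean[of "\<gamma> - x"] by (auto simp: inverse_eq_divide)
      then show "x \<in> (\<Union>n. X n)" using x by (auto simp: X_def intro!: exI[of _ n])
    qed
    moreover have "- ?S \<inter> {t<..<\<gamma>} \<in> sets lborel" using cb by (auto intro!: sets.Int)
    ultimately show ?thesis by (blast intro: null_sets_subset)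
  qed
  interpret gap_level H v \<kappa> \<Lambda> R \<gamma>
  proof
    fix e :: real assume e: "0 < e"
    show "emeasure lborel (- ?S \<inter> {\<gamma><..<\<gamma> + e}) \<noteq> 0"
    proof
      assume z: "emeasure lborel (- ?S \<inter> {\<gamma><..<\<gamma> + e}) = 0"
      then have nz: "- ?S \<inter> {\<gamma><..<\<gamma> + e} \<in> null_sets lborel"
        using cb by (auto simp: null_sets_def intro!: sets.Int)
      show False
      proof (cases "\<gamma> < s")
        case True
        define r where "r = min (\<gamma> + e) s"
        have "(- ?S \<inter> {t<..<\<gamma>}) \<union> (- ?S \<inter> {\<gamma><..<\<gamma> + e}) \<union> {\<gamma>} \<in> null_sets lborel"
          by (intro null_sets.Un null nz) (simp add: null_sets_def)
        then have "- ?S \<inter> {t<..<r} \<in> null_sets lborel"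
          by (rule null_sets_subset) (use cb in \<open>auto simp: r_def intro!: sets.Int\<close>)
        then have "r \<in> A" using \<gamma>t True e by (simp add: A_def r_def)
        then have "r \<le> \<gamma>" unfolding \<gamma>_def by (rule cSup_upper[OF _ bdd])
        then show False using True e by (simp add: r_def)
      next
        case False
        \<comment> \<open>The left-leaning levels contain an interval that starts at
          \<open>s\<close>, so levels outside \<open>?S\<close> have positive measure just above
          \<open>\<gamma> = s\<close> too.\<close>
        then have gs: "\<gamma> = s" using \<gamma>s by simp
        obtain d where d: "0 < d" "{s..<s + d} \<subseteq> right_levels (\<lambda>x. v (- x))"
          using m.right_levels_open[OF s(1)] by blast
        define f where "f = min (min d e) (low v R - s)"
        have f: "0 < f" using d e sR by (simp add: f_def)
        have "{s<..<s + f} \<subseteq> - ?S \<inter> {\<gamma><..<\<gamma> + e}"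
        proof
          fix x assume x: "x \<in> {s<..<s + f}"
          then have xm: "x \<in> right_levels (\<lambda>x. v (- x))" using d(2) by (auto simp: f_def)
          have x0: "0 < x" "x < v 0" using x t s low_le_0[of R] by (auto simp: f_def)
          have "x \<notin> ?S"
            using right_levels_reach[OF x0] m.right_levels_reach[of x] x0 xm by auto
          then show "x \<in> - ?S \<inter> {\<gamma><..<\<gamma> + e}" using x gs by (auto simp: f_def)
        qed
        then have "emeasure lborel {s<..<s + f} \<le> emeasure lborel (- ?S \<inter> {\<gamma><..<\<gamma> + e})"
          using cb by (intro emeasure_mono) (auto intro!: sets.Int)
        then show False using z f by auto
      qed
    qed
  qed (use t \<gamma>t \<gamma>s sR in auto)
  show False by (rule no_right_levels_below[OF t(2) \<gamma>t null])
qed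

lemma tail_dichotomy_0:
  "(\<exists>Y. \<forall>y>Y. \<forall>z. \<bar>z\<bar> \<le> y \<longrightarrow> v y \<le> v z) \<or> (\<exists>Y. \<forall>y>Y. \<forall>z. \<bar>z\<bar> \<le> y \<longrightarrow> v (- y) \<le> v z)"
proof -
  interpret m: profile H "\<lambda>x. v (- x)" \<kappa> \<Lambda> R by (rule profile_reflect)
  let ?T = "\<lambda>t. 0 < t \<and> t < low v R \<and> t < low v (- R)"
  consider "\<forall>t. ?T t \<longrightarrow> t \<notin> right_levels v" | "\<forall>t. ?T t \<longrightarrow> t \<notin> right_levels (\<lambda>x. v (- x))"
    | t s where "?T t" "t \<in> right_levels v" "?T s" "s \<in> right_levels (\<lambda>x. v (- x))" by blast
  then show ?thesis
  proof cases
    case 1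
    then show ?thesis using tail_right by blast
  next
    case 2
    then have "\<exists>Y. \<forall>y>Y. \<forall>z. \<bar>z\<bar> \<le> y \<longrightarrow> v (- y) \<le> v (- z)"
      by (intro m.tail_right) (auto simp: low_reflect)
    then show ?thesis by (metis abs_minus_cancel minus_minus)
  next
    case 3
    have e: "(\<lambda>x. v (- (- x))) = v" by simp
    have "t \<noteq> s"
    proof
      assume "t = s"
      moreover have "t < v 0" using 3(1) low_le_0[of R] by linarith
      ultimately show False
        using 3 right_levels_reach[of t] m.right_levels_reach[of t] by auto
    qed
    then consider "t < s" | "s < t" by linarith
    then show ?thesis
    proof cases
      case 1 then show ?thesis using no_switch[of t s] 3 by blast
    next
      case 2
      then show ?thesis using m.no_switch[of s t] 3 unfolding e low_reflect by simp
    qed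
  qed
qed

text \<open>\<open>[2 * K - y, y]\<close> contains the mirror image of \<open>y\<close> in every
  plane between \<open>K\<close> and \<open>y\<close>, so far out the folding inequality for such
  planes is immediate.\<close>

definition right_tail :: "real \<Rightarrow> bool" where
  "right_tail K \<longleftrightarrow> (\<exists>Y. \<forall>y>Y. \<forall>z. 2 * K - y \<le> z \<longrightarrow> z \<le> y \<longrightarrow> v y \<le> v z)"

definition left_tail :: "real \<Rightarrow> bool" where
  "left_tail K \<longleftrightarrow> (\<exists>Y. \<forall>y>Y. \<forall>z. - y \<le> z \<longrightarrow> z \<le> 2 * K + y \<longrightarrow> v (- y) \<le> v z)"

lemma tail_dichotomy: "right_tail K \<or> left_tail K"
proof -
  interpret t: profile H "\<lambda>x. v (x + K)" \<kappa> \<Lambda> R by (rule profile_translate)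
  from t.tail_dichotomy_0 show ?thesis
  proof
    assume "\<exists>Y. \<forall>y>Y. \<forall>z. \<bar>z\<bar> \<le> y \<longrightarrow> v (y + K) \<le> v (z + K)"
    then obtain Y where Y: "\<And>y z. Y < y \<Longrightarrow> \<bar>z\<bar> \<le> y \<Longrightarrow> v (y + K) \<le> v (z + K)" by blast
    have "v y \<le> v z" if "Y + K < y" "2 * K - y \<le> z" "z \<le> y" for y z
      using Y[of "y - K" "z - K"] that by (simp add: abs_le_iff)
    then show ?thesis unfolding right_tail_def by blast
  next
    assume "\<exists>Y. \<forall>y>Y. \<forall>z. \<bar>z\<bar> \<le> y \<longrightarrow> v (- y + K) \<le> v (z + K)"
    then obtain Y where Y: "\<And>y z. Y < y \<Longrightarrow> \<bar>z\<bar> \<le> y \<Longrightarrow> v (- y + K) \<le> v (z + K)" by blast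
    have "v (- y) \<le> v z" if "Y - K < y" "- y \<le> z" "z \<le> 2 * K + y" for y z
      using Y[of "y + K" "z - K"] that by (simp add: abs_le_iff)
    then show ?thesis unfolding left_tail_def by blast
  qed
qed

subsection \<open>Moving planes\<close>

definition folds :: "real \<Rightarrow> bool" where
  "folds l \<longleftrightarrow> (\<forall>y\<ge>l. v y \<le> v (2 * l - y))"

definition symm :: "real \<Rightarrow> bool" where
  "symm l \<longleftrightarrow> (\<forall>y. v y = v (2 * l - y))"

lemma folds_offset: "folds l \<longleftrightarrow> (\<forall>Y\<ge>0. v (l + Y) \<le> v (l - Y))"
proof
  assume "folds l"
  then show "\<forall>Y\<ge>0. v (l + Y) \<le> v (l - Y)"
    unfolding folds_def by (metis add_diff_cancel_left' add_diff_eq diff_diff_eq2 le_add_same_cancel1 mult_2 diff_add_eq_diff_diff_swap)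
next
  assume a: "\<forall>Y\<ge>0. v (l + Y) \<le> v (l - Y)"
  show "folds l" unfolding folds_def
  proof (intro allI impI)
    fix y assume "l \<le> y"
    then have "v (l + (y - l)) \<le> v (l - (y - l))" by (intro a[rule_format]) simp
    moreover have "l + (y - l) = y" "l - (y - l) = 2 * l - y" by simp_all
    ultimately show "v y \<le> v (2 * l - y)" by simp
  qed
qed

text \<open>Equal values of \<open>v\<close> give equal values of \<open>conv v\<close>, and the
  rigid case of the reflection comparison spreads the equality from \<open>X\<close> to all
  \<open>Y\<close> with \<open>\<bar>Y - X\<bar> < R < Y + X\<close>. It is carried to
  \<open>Y = R\<close> first, which reaches all of \<open>(0, 2 * R)\<close>, and outward from there
  in steps of \<open>R / 2\<close>.\<close>

lemma strong_maximum_principle: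
  assumes f: "folds l" and X: "0 < X" "v (l + X) = v (l - X)"
  shows "symm l"
proof -
  define E where "E = {Y. 0 < Y \<and> v (l + Y) = v (l - Y)}"
  have ord: "v (l + Y) \<le> v (l - Y)" if "0 < Y" for Y using f that by (simp add: folds_offset)
  have step: "Y \<in> E" if "X \<in> E" "0 < Y" "\<bar>Y - X\<bar> < R" "R < Y + X" for X Y
  proof -
    have "conv v (l - X) = conv v (l + X)" using that(1) by (intro conv_eq) (simp add: E_def)
    then show ?thesis
      using conv_reflection_eq[OF v_cont v_abs_le _ ord _ R, of X Y] that by (simp add: E_def)
  qed
  have "R \<in> E" if "X \<in> E" "X < 2 * R + real n * (R / 2)" for n X
    using that
  proof (induction n arbitrary: X)
    case 0
    then show ?case using step[of X R] R_pos by (simp add: E_def abs_less_iff)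
  next
    case (Suc n)
    show ?case
    proof (cases "X < 2 * R")
      case True then show ?thesis using step[of X R] R_pos Suc.prems by (simp add: E_def abs_less_iff)
    next
      case False
      then have "X - R / 2 \<in> E" using step[of X "X - R / 2"] R_pos Suc.prems by simp
      moreover have "X - R / 2 < 2 * R + real n * (R / 2)" using Suc.prems by (simp add: field_simps)
      ultimately show ?thesis by (rule Suc.IH)
    qed
  qed
  moreover obtain n where "X < 2 * R + real n * (R / 2)"
  proof -
    obtain n where "(X - 2 * R) / (R / 2) < real n" using reals_Archimedean2 by blast
    then have "X < 2 * R + real n * (R / 2)" using R_pos by (simp add: field_simps)
    then show ?thesis by (rule that)
  qed
  ultimately have RE: "R \<in> E" using X by (simp add: E_def)
  have "Y \<in> E" if "0 < Y" "Y < 2 * R + real n * (R / 2)" for n Y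
    using that
  proof (induction n arbitrary: Y)
    case 0
    then show ?case using step[OF RE, of Y] by (simp add: abs_less_iff)
  next
    case (Suc n)
    show ?case
    proof (cases "Y < 2 * R")
      case True then show ?thesis using step[OF RE, of Y] Suc.prems by (simp add: abs_less_iff)
    next
      case False
      have "Y - R / 2 < 2 * R + real n * (R / 2)" using Suc.prems by (simp add: field_simps)
      then have "Y - R / 2 \<in> E" using Suc.IH[of "Y - R / 2"] False R_pos by simp
      then show ?thesis using step[of "Y - R / 2" Y] R_pos False by simp
    qed
  qed
  moreover have "\<exists>n. Y < 2 * R + real n * (R / 2)" for Y
  proof -
    obtain n where "(Y - 2 * R) / (R / 2) < real n" using reals_Archimedean2 by blast
    then have "Y < 2 * R + real n * (R / 2)" using R_pos by (simp add: field_simps)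
    then show ?thesis ..
  qed
  ultimately have E: "v (l + Y) = v (l - Y)" if "0 < Y" for Y using that unfolding E_def by blast
  show ?thesis unfolding symm_def
  proof
    fix y
    consider "l < y" | "y = l" | "y < l" by linarith
    then show "v y = v (2 * l - y)"
    proof cases
      case 1 then show ?thesis using E[of "y - l"] by (simp add: algebra_simps)
    next
      case 3 then show ?thesis using E[of "l - y"] by (simp add: algebra_simps)
    qed simp
  qed
qed

text \<open>Two reflections compose to a translation, and a periodic function with positive values
  does not tend to 0.\<close>

lemma symm_unique: "symm l \<Longrightarrow> symm l' \<Longrightarrow> \<not> l < l'"
proof
  assume s: "symm l" "symm l'" and l: "l < l'"
  define p where "p = 2 * (l' - l)"
  have p: "0 < p" using l by (simp add: p_def)
  have per: "v (x + p) = v x" for x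
  proof -
    have "v x = v (2 * l - x)" using s(1) unfolding symm_def by blast
    also have "\<dots> = v (2 * l' - (2 * l - x))" using s(2) unfolding symm_def by blast
    also have "2 * l' - (2 * l - x) = x + p" by (simp add: p_def algebra_simps)
    finally show ?thesis by simp
  qed
  have n: "v (real n * p) = v 0" for n
  proof (induction n)
    case (Suc n)
    then show ?case using per[of "real n * p"] by (simp add: distrib_right add.commute)
  qed simp
  have "\<forall>\<^sub>F x in at_infinity. v x < v 0" using v_lim v_pos[of 0] by (rule order_tendstoD)
  then obtain B where B: "\<And>x. B \<le> \<bar>x\<bar> \<Longrightarrow> v x < v 0" by (auto simp: eventually_at_infinity)
  obtain k where "B / p < real k" using reals_Archimedean2 by blast
  then have "B \<le> \<bar>real k * p\<bar>" using p by (simp add: field_simps abs_of_pos)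
  then show False using B n[of k] by fastforce
qed

text \<open>Folding in all planes far to the left would bound a fixed value of \<open>v\<close> by
  values near minus infinity, which tend to 0. This keeps the moving plane from escaping.\<close>

lemma not_all_fold: "\<exists>l<B. \<not> folds l"
proof (rule ccontr)
  assume "\<not> ?thesis"
  then have f: "folds l" if "l < B" for l using that by blast
  have "\<forall>\<^sub>F x in at_infinity. v x < v (B - 1)" using v_lim v_pos[of "B - 1"] by (rule order_tendstoD)
  then obtain N where N: "\<And>x. N \<le> \<bar>x\<bar> \<Longrightarrow> v x < v (B - 1)" by (auto simp: eventually_at_infinity)
  define z where "z = min (B - 1) (- \<bar>N\<bar>)"
  define l where "l = (z + (B - 1)) / 2"
  have "z \<le> B - 1" by (simp add: z_def)
  then have l: "l < B" "l \<le> B - 1" "2 * l - (B - 1) = z" by (auto simp: l_def field_simps)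
  then have "v (B - 1) \<le> v z" using f[OF l(1)] unfolding folds_def by metis
  moreover have "N \<le> \<bar>z\<bar>" by (auto simp: z_def)
  ultimately show False using N[of z] by simp
qed

text \<open>Beyond \<open>Y0\<close> the reflected differences are nonnegative by the tail condition, and on
  \<open>[l + W / 2, Y0]\<close> by compactness. A negative minimum in the remaining narrow strip would contradict
  the equation, because \<open>H\<close> has mass less than \<open>\<kappa>\<close> there.\<close>

lemma plane_moves:
  assumes f: "folds l" and ns: "\<not> symm l" and K: "right_tail K" "K < l"
  shows "\<exists>e>0. \<forall>l'. l - e \<le> l' \<longrightarrow> l' \<le> l \<longrightarrow> folds l'"
proof -
  obtain Y0 where Y0: "\<And>y z. Y0 < y \<Longrightarrow> 2 * K - y \<le> z \<Longrightarrow> z \<le> y \<Longrightarrow> v y \<le> v z"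
    using K(1) unfolding right_tail_def by blast
  obtain d where d: "0 < d" "core d < \<kappa>" using core_small[OF \<kappa>_pos] by blast
  \<comment> \<open>The strip \<open>{-W<..<W}\<close> has length \<open>d\<close>, and the kernel
    has mass at most \<open>core d < \<kappa>\<close> on any translate of it.\<close>
  define W where "W = d / 2"
  have W: "0 < W" using d by (simp add: W_def)
  have strict: "v y < v (2 * l - y)" if "l < y" for y
  proof -
    have "v (l + (y - l)) \<noteq> v (l - (y - l))"
      using strong_maximum_principle[OF f, of "y - l"] ns that by auto
    moreover have "l + (y - l) = y" "l - (y - l) = 2 * l - y" by simp_all
    ultimately have "v y \<noteq> v (2 * l - y)" by (simp only: not_False_eq_True)
    then show ?thesis using f[unfolded folds_def, rule_format, of y] that by simp
  qed
  obtain c where c: "0 < c" "\<And>y. l + W / 2 \<le> y \<Longrightarrow> y \<le> Y0 \<Longrightarrow> c \<le> v (2 * l - y) - v y"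
  proof (cases "l + W / 2 \<le> Y0")
    case True
    have "continuous_on {l + W / 2..Y0} (\<lambda>y. v (2 * l - y) - v y)"
      by (intro continuous_intros continuous_on_compose2[OF v_cont[of UNIV]]) auto
    then obtain y0 where y0: "y0 \<in> {l + W / 2..Y0}"
      "\<And>y. y \<in> {l + W / 2..Y0} \<Longrightarrow> v (2 * l - y0) - v y0 \<le> v (2 * l - y) - v y"
      using continuous_attains_inf[of "{l + W / 2..Y0}" "\<lambda>y. v (2 * l - y) - v y"] True by auto
    have "0 < v (2 * l - y0) - v y0" using strict[of y0] y0(1) W by simp
    then show ?thesis by (rule that) (use y0(2) in auto)
  next
    case False
    show ?thesis by (rule that[of 1]) (use False in auto)
  qed
  \<comment> \<open>The three bounds ensure, in turn, \<open>K \<le> l'\<close>,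
    \<open>l + W / 2 \<le> l' + W\<close>, and a loss \<open>2 * \<Lambda> * e\<close> from moving
    the plane that stays within the margin \<open>c\<close>.\<close>
  define e where "e = min (l - K) (min (W / 2) (c / (2 * \<Lambda> + 1)))"
  have e: "0 < e" "e \<le> l - K" "e \<le> W / 2" "2 * \<Lambda> * e \<le> c"
  proof -
    show "0 < e" using K W c \<Lambda>_nn by (simp add: e_def)
    show "e \<le> W / 2" unfolding e_def by (rule min.coboundedI2[OF min.cobounded1])
    have "2 * \<Lambda> * e \<le> 2 * \<Lambda> * (c / (2 * \<Lambda> + 1))" using \<Lambda>_nn by (intro mult_left_mono) (auto simp: e_def)
    also have "\<dots> \<le> c" using \<Lambda>_nn c(1) by (simp add: field_simps)
    finally show "2 * \<Lambda> * e \<le> c" .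
  qed (auto simp: e_def)
  have "folds l'" if l': "l - e \<le> l'" "l' \<le> l" for l'
  proof -
    let ?\<delta> = "\<lambda>Y. v (l' - Y) - v (l' + Y)"
    have far: "0 \<le> ?\<delta> Y" if Y: "W \<le> Y" for Y
    proof (cases "l' + Y \<le> Y0")
      case False
      then show ?thesis using Y0[of "l' + Y" "l' - Y"] l' e W Y by simp
    next
      case True
      have "c \<le> v (2 * l - (l' + Y)) - v (l' + Y)" using c(2)[of "l' + Y"] True l' e Y by simp
      moreover have "\<bar>v (2 * l - (l' + Y)) - v (l' - Y)\<bar> \<le> \<Lambda> * \<bar>2 * l - (l' + Y) - (l' - Y)\<bar>"
        by (rule v_lip)
      moreover have "\<Lambda> * \<bar>2 * l - (l' + Y) - (l' - Y)\<bar> \<le> \<Lambda> * (2 * e)"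
        using l' \<Lambda>_nn by (intro mult_left_mono) auto
      ultimately show ?thesis using e(4) by linarith
    qed
    have "continuous_on {0..W} ?\<delta>"
      by (intro continuous_intros continuous_on_compose2[OF v_cont[of UNIV]]) auto
    then obtain B where B: "B \<in> {0..W}" "\<And>Y. Y \<in> {0..W} \<Longrightarrow> ?\<delta> B \<le> ?\<delta> Y"
      using continuous_attains_inf[of "{0..W}" ?\<delta>] W by auto
    show ?thesis
    proof (cases "0 \<le> ?\<delta> B")
      case True
      have "0 \<le> ?\<delta> Y" if "0 \<le> Y" for Y
        using B(2)[of Y] True far[of Y] that by (cases "Y \<le> W") auto
      then show ?thesis by (simp add: folds_offset)
    next
      case False
      define D where "D = - ?\<delta> B"
      have D: "0 < D" using False by (simp add: D_def)
      have B0: "0 < B" using B(1) False by (cases "B = 0") auto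
      let ?k = "\<lambda>Y. H (Y - B) - H (Y + B)"
      have low\<delta>: "- D \<le> ?\<delta> Y" if "0 < Y" for Y
        using B(2)[of Y] far[of Y] D that by (cases "Y \<le> W") (auto simp: D_def)
      have pw: "- (?k Y * ?\<delta> Y) \<le> D * (indicator {-W<..<W} Y * H (Y - B) + indicator {-W<..<W} Y * H (Y + B))"
        if "0 < Y" "Y \<noteq> B" for Y
      proof -
        have k: "0 \<le> ?k Y" using H_diff_nonneg[OF B0 that] by simp
        show ?thesis
        proof (cases "Y < W")
          case True
          have "?k Y * - D \<le> ?k Y * ?\<delta> Y" using k low\<delta>[OF that(1)] by (rule mult_left_mono[rotated])
          moreover have "?k Y * D \<le> (H (Y - B) + H (Y + B)) * D"
            using H_nn[of "Y + B"] D by (intro mult_right_mono) auto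
          ultimately show ?thesis using True that by (simp add: algebra_simps)
        next
          case False
          then have "0 \<le> ?k Y * ?\<delta> Y" using k far[of Y] by simp
          then show ?thesis using False by simp
        qed
      qed
      have ae: "AE Y in lborel. - (?k Y * ?\<delta> Y)
          \<le> D * (indicator {-W<..<W} Y * H (Y - B) + indicator {-W<..<W} Y * H (Y + B))"
        using AE_lborel_neq[of 0] AE_lborel_neq[of B] AE_lborel_neq[of "- B"]
      proof eventually_elim
        case (elim Y)
        show ?case
        proof (cases "0 < Y")
          case True then show ?thesis using pw elim by blast
        next
          case False
          then have Y: "0 < - Y" "- Y \<noteq> B" using elim by auto
          have "- Y - B = - (Y + B)" "- Y + B = - (Y - B)" by simp_all
          then have h: "H (- Y - B) = H (Y + B)" "H (- Y + B) = H (Y - B)" by (simp_all only: H_even)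
          have i: "indicator {-W<..<W} (- Y) = (indicator {-W<..<W} Y :: real)"
            by (auto simp: indicator_def)
          show ?thesis using pw[OF Y] unfolding h i by (simp add: algebra_simps)
        qed
      qed
      have i: "integrable lborel (\<lambda>Y. indicator {-W<..<W} Y * H (Y - B))"
        "integrable lborel (\<lambda>Y. indicator {-W<..<W} Y * H (Y + B))"
        using ind_int[of "{-W<..<W}" "- B"] ind_int[of "{-W<..<W}" B] by (simp_all add: add.commute)
      have narrow: "(\<integral>Y. indicator {-W<..<W} Y * H (Y + a) \<partial>lborel) \<le> core d" for a
      proof -
        have "indicator {-W<..<W} (Y - a) = (indicator {a - W<..<(a - W) + d} Y :: real)" for Y
          by (auto simp: indicator_def W_def field_simps)
        then have "(\<integral>Y. indicator {-W<..<W} Y * H (Y + a) \<partial>lborel)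
            = (\<integral>Y. indicator {a - W<..<(a - W) + d} Y * H Y \<partial>lborel)"
          using integral_lborel_shift[of "\<lambda>Y. indicator {-W<..<W} Y * H (Y + a)" "- a"] by simp
        then show ?thesis using core_interval[of d "a - W"] d(1) by simp
      qed
      have "2 * (conv v (l' - B) - conv v (l' + B)) = (\<integral>Y. ?k Y * ?\<delta> Y \<partial>lborel)"
        by (rule conv_reflection(1)[OF v_borel v_abs_le])
      then have "2 * (conv v (l' + B) - conv v (l' - B)) = (\<integral>Y. - (?k Y * ?\<delta> Y) \<partial>lborel)" by simp
      also have "\<dots> \<le> (\<integral>Y. D * (indicator {-W<..<W} Y * H (Y - B) + indicator {-W<..<W} Y * H (Y + B)) \<partial>lborel)"
        by (rule integral_mono_AE[OF _ _ ae])
          (intro Bochner_Integration.integrable_minus conv_reflection(2)[OF v_borel v_abs_le],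
           intro integrable_mult_right Bochner_Integration.integrable_add i)
      also have "\<dots> = D * ((\<integral>Y. indicator {-W<..<W} Y * H (Y - B) \<partial>lborel)
          + (\<integral>Y. indicator {-W<..<W} Y * H (Y + B) \<partial>lborel))"
        using i by simp
      also have "\<dots> \<le> D * (core d + core d)"
        using narrow[of "- B"] narrow[of B] D by (intro mult_left_mono add_mono) auto
      finally have 1: "conv v (l' + B) - conv v (l' - B) \<le> D * core d" by simp
      have "\<kappa> * (v (l' + B) - v (l' - B)) \<le> conv v (l' + B) - conv v (l' - B)"
        by (rule v_mono) (use False in simp)
      then have "D * \<kappa> \<le> D * core d" using 1 by (simp add: D_def mult.commute)
      then show ?thesis using D d(2) by simp
    qed
  qed
  then show ?thesis using e(1) by blast
qed

text \<open>The stopping position is the infimum of the planes from which on all fold; folding is a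
  closed condition. Short of symmetry, a tail condition at some \<open>K < l\<close> would let the
  plane move further.\<close>

lemma plane_stops:
  assumes K: "right_tail K"
  obtains l where "\<And>l'. l \<le> l' \<Longrightarrow> folds l'" "symm l \<or> (\<forall>K<l. \<not> right_tail K)"
proof -
  define A where "A = {l. \<forall>l'\<ge>l. folds l'}"
  obtain Y0 where Y0: "\<And>y z. Y0 < y \<Longrightarrow> 2 * K - y \<le> z \<Longrightarrow> z \<le> y \<Longrightarrow> v y \<le> v z"
    using K unfolding right_tail_def by blast
  \<comment> \<open>For a plane beyond \<open>K\<close> and \<open>Y0\<close> the tail condition
    itself is the folding inequality.\<close>
  have "max K (Y0 + 1) \<in> A"
    unfolding A_def folds_def by (auto intro!: Y0)
  then have ne: "A \<noteq> {}" by blast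
  obtain l0 where l0: "\<not> folds l0" using not_all_fold by blast
  have lb: "l0 \<le> l" if "l \<in> A" for l
  proof (rule ccontr)
    assume "\<not> l0 \<le> l"
    then show False using that l0 unfolding A_def by auto
  qed
  then have bdd: "bdd_below A" by (auto simp: bdd_below_def)
  define l where "l = Inf A"
  have gt: "folds l'" if lt: "l < l'" for l'
  proof -
    obtain a where "a \<in> A" "a < l'" using cInf_lessD[OF ne lt[unfolded l_def]] by blast
    then show ?thesis unfolding A_def by auto
  qed
  have "folds l" unfolding folds_offset
  proof (intro allI impI)
    fix Y :: real assume Y: "0 \<le> Y"
    have "v (l + Y) \<le> v (l - Y) + e" if e: "0 < e" for e
    proof -
      define h where "h = e / (2 * \<Lambda> + 1)"
      have h: "0 < h" "2 * \<Lambda> * h \<le> e" using e \<Lambda>_nn by (auto simp: h_def field_simps)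
      have "v ((l + h) + Y) \<le> v ((l + h) - Y)" using gt[of "l + h"] h Y by (simp add: folds_offset)
      then show ?thesis
        using v_lip[of "l + Y" "(l + h) + Y"] v_lip[of "(l + h) - Y" "l - Y"] h by (simp add: abs_le_iff)
    qed
    then show "v (l + Y) \<le> v (l - Y)" by (rule field_le_epsilon)
  qed
  then have le: "folds l'" if "l \<le> l'" for l' using gt that by (cases "l = l'") auto
  have "symm l \<or> (\<forall>K<l. \<not> right_tail K)"
  proof (rule ccontr)
    assume "\<not> ?thesis"
    then obtain K where "\<not> symm l" "K < l" "right_tail K" by blast
    then obtain e where e: "e > 0" "\<forall>l'. l - e \<le> l' \<longrightarrow> l' \<le> l \<longrightarrow> folds l'"
      using plane_moves[OF le[OF order_refl]] by blast
    have "folds l'" if "l - e \<le> l'" for l'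
      using e(2) le[of l'] that by (cases "l' \<le> l") auto
    then have "l - e \<in> A" by (simp add: A_def)
    then have "l \<le> l - e" unfolding l_def by (rule cInf_lower[OF _ bdd])
    then show False using e(1) by simp
  qed
  then show ?thesis using that le by blast
qed

end

section \<open>Measurability, decay and positivity from the hypotheses of the theorem\<close>

lemma antimono_even_borel:
  fixes H :: "real \<Rightarrow> real"
  assumes "antimono_on {0<..} H" and "\<And>x. H (- x) = H x"
  shows "H \<in> borel_measurable borel"
proof -
  have "mono_on {0<..} (\<lambda>x. - H x)"
    using assms(1) by (auto simp: monotone_on_def)
  then have "(\<lambda>x. - H x) \<in> borel_measurable (restrict_space borel {0<..})"
    by (rule borel_measurable_mono_on_fnc)
  then have "H \<in> borel_measurable (restrict_space borel {0<..})"
    using borel_measurable_uminus by fastforce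
  then have [measurable]: "(\<lambda>x. indicator {0<..} x * H x) \<in> borel_measurable borel"
    by (subst (asm) borel_measurable_restrict_space_iff) auto
  have "H = (\<lambda>x. if x = 0 then H 0 else
      indicator {0<..} x * H x + indicator {0<..} (- x) * H (- x))"
    by (auto simp: fun_eq_iff indicator_def assms(2))
  moreover have "(\<lambda>x. if x = 0 then H 0 else
      indicator {0<..} x * H x + indicator {0<..} (- x) * H (- x)) \<in> borel_measurable borel"
    by measurable
  ultimately show ?thesis by simp
qed

lemma superlinear_vanishing:
  fixes G :: "real \<Rightarrow> real"
  assumes "\<forall>\<^sub>F s in nhds 0. \<bar>G s\<bar> \<le> C * \<bar>s\<bar> powr r" and "0 < C" "1 < r" "0 < e"
  shows "\<forall>\<^sub>F s in nhds 0. \<bar>G s\<bar> \<le> e * \<bar>s\<bar>"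
proof -
  define d where "d = (e / C) powr (1 / (r - 1))"
  have d: "0 < d" "d powr (r - 1) = e / C"
    using assms(2-4) by (auto simp: d_def powr_powr)
  have "\<forall>\<^sub>F s in nhds (0::real). \<bar>s\<bar> < d"
    using d(1) by (intro order_tendstoD(2)[where y="\<bar>0::real\<bar>"] tendsto_intros filterlim_ident) auto
  with assms(1) show ?thesis
  proof eventually_elim
    case (elim s)
    have "\<bar>s\<bar> powr (r - 1) \<le> d powr (r - 1)"
      using elim(2) assms(3) by (intro powr_mono2) auto
    then have "C * \<bar>s\<bar> powr (r - 1) \<le> e" using d(2) assms(2) by (simp add: field_simps)
    then have "C * \<bar>s\<bar> powr (r - 1) * \<bar>s\<bar> \<le> e * \<bar>s\<bar>" by (rule mult_right_mono) simp
    moreover have "\<bar>s\<bar> powr r = \<bar>s\<bar> powr (r - 1) * \<bar>s\<bar>"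
      by (cases "s = 0") (simp_all add: powr_diff)
    ultimately show ?case using elim(1) by (simp add: mult.assoc)
  qed
qed

context kernel
begin

text \<open>The integrand is nonnegative with integral 0, and \<open>H\<close> is positive at every
  nonzero point of \<open>(- R, R)\<close>, since it exceeds \<open>H (2 * R)\<close> there.\<close>

lemma conv_eq_0_imp:
  assumes w: "continuous_on UNIV w" "\<And>y. 0 \<le> w y" "\<And>y. w y \<le> M"
    and z: "conv w x = 0" and R: "jump R" and y: "\<bar>x - y\<bar> < R"
  shows "w y = 0"
proof (rule ccontr)
  assume ne: "w y \<noteq> 0"
  have m: "w \<in> borel_measurable borel" using w(1) by (rule borel_measurable_continuous_onI)
  have wM: "\<bar>w z\<bar> \<le> M" for z using w(2,3)[of z] by simp
  have ae: "AE z in lborel. H (x - z) * w z = 0"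
    using integral_nonneg_eq_0_iff_AE[OF conv_integrable[OF m wM, of x]] z w(2) H_nn
    by (auto simp: conv_def)
  have "(w \<longlongrightarrow> w y) (at y)" using w(1) by (simp add: continuous_on_def)
  then have "\<forall>\<^sub>F z in at y. 0 < w z"
    by (rule order_tendstoD(1)) (use ne w(2)[of y] in simp)
  moreover have "\<forall>\<^sub>F z in at y. \<bar>x - z\<bar> < R"
    by (rule order_tendstoD(2)[OF _ y]) (intro tendsto_intros)
  ultimately have "\<forall>\<^sub>F z in at y. 0 < w z \<and> \<bar>x - z\<bar> < R" by eventually_elim auto
  then obtain d where d: "d > 0" "\<And>z. z \<noteq> y \<Longrightarrow> dist z y < d \<Longrightarrow> 0 < w z \<and> \<bar>x - z\<bar> < R"
    unfolding eventually_at by auto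
  obtain a b where ab: "y < a" "a < b" "b < y + d" "x \<notin> {a<..<b}"
  proof (cases "x \<le> y \<or> y + d \<le> x")
    case True then show ?thesis using that[of "y + d/3" "y + d/2"] d(1) by (auto simp: field_simps)
  next
    case False then show ?thesis using that[of "(y + x)/2" x] by auto
  qed
  obtain z where "a < z" "z < b" "H (x - z) * w z = 0"
    using AE_zero_open[OF ae ab(2)] by blast
  moreover from this have "0 < w z" "\<bar>x - z\<bar> < R" "z \<noteq> x"
    using d(2)[of z] ab by (auto simp: dist_real_def)
  ultimately show False
    using jumpD[OF R, of "x - z" "2 * R"] H_nn[of "2 * R"] R by (auto simp: jump_def)
qed

end

section \<open>Symmetry and strict decrease away from the axis\<close>

context profile
begin

text \<open>\<open>x\<close> and \<open>y\<close> are mirror images in the plane through their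
  midpoint, which folds. Equality would make this plane a second axis of symmetry.\<close>

lemma folds_all_strict:
  assumes f: "\<And>l'. l \<le> l' \<Longrightarrow> folds l'" and s: "symm l" and xy: "l \<le> x" "x < y"
  shows "v y < v x"
proof -
  define l' where "l' = (x + y) / 2"
  define X where "X = (y - x) / 2"
  have e: "l' + X = y" "l' - X = x" by (simp_all add: l'_def X_def field_simps)
  have l: "l < l'" "0 < X" using xy by (auto simp: l'_def X_def)
  have "v y \<le> v x" using f[of l'] l e unfolding folds_offset by (metis less_imp_le)
  moreover have "v y \<noteq> v x"
    using strong_maximum_principle[OF f[of l'] l(2)] symm_unique[OF s, of l'] l e by auto
  ultimately show ?thesis by simp
qed

definition unimodal :: "real \<Rightarrow> bool" where
  "unimodal l \<longleftrightarrow> symm l \<and> (\<forall>x y. l \<le> x \<longrightarrow> x < y \<longrightarrow> v y < v x)"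

theorem symmetric_unimodal: "\<exists>l. unimodal l"
proof -
  interpret m: profile H "\<lambda>x. v (- x)" \<kappa> \<Lambda> R by (rule profile_reflect)
  have mt: "m.right_tail (- K) \<longleftrightarrow> left_tail K" for K
  proof -
    have "(\<forall>z. 2 * - K - y \<le> z \<longrightarrow> z \<le> y \<longrightarrow> v (- y) \<le> v (- z)) \<longleftrightarrow>
        (\<forall>z. - y \<le> z \<longrightarrow> z \<le> 2 * K + y \<longrightarrow> v (- y) \<le> v z)" for y
    proof (intro iffI allI impI)
      fix z assume "\<forall>z. 2 * - K - y \<le> z \<longrightarrow> z \<le> y \<longrightarrow> v (- y) \<le> v (- z)" "- y \<le> z" "z \<le> 2 * K + y"
      then show "v (- y) \<le> v z" by (auto dest: spec[of _ "- z"])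
    next
      fix z assume "\<forall>z. - y \<le> z \<longrightarrow> z \<le> 2 * K + y \<longrightarrow> v (- y) \<le> v z" "2 * - K - y \<le> z" "z \<le> y"
      then show "v (- y) \<le> v (- z)" by (auto dest: spec[of _ "- z"])
    qed
    then show ?thesis unfolding m.right_tail_def left_tail_def by simp
  qed
  have flip: "unimodal (- p)" if "m.symm p" "\<And>q. p \<le> q \<Longrightarrow> m.folds q" for p
  proof -
    have s: "v (- y) = v (- (2 * p - y))" for y using that(1) unfolding m.symm_def by blast
    have s': "v y = v (- (2 * p + y))" for y using s[of "- y"] by simp
    have "v y < v x" if "- p \<le> x" "x < y" for x y
      using m.folds_all_strict[of p "2 * p + x" "2 * p + y"] \<open>m.symm p\<close>
        \<open>\<And>q. p \<le> q \<Longrightarrow> m.folds q\<close> that s'[of x] s'[of y] by simp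
    moreover have "symm (- p)" unfolding symm_def using s' by simp
    ultimately show ?thesis by (simp add: unimodal_def)
  qed
  show ?thesis
  proof (cases "\<exists>K. right_tail K")
    case True
    then obtain l where l: "\<And>l'. l \<le> l' \<Longrightarrow> folds l'" "symm l \<or> (\<forall>K<l. \<not> right_tail K)"
      using plane_stops by blast
    have u: "unimodal l" if "symm l" using folds_all_strict[OF l(1) that] that by (simp add: unimodal_def)
    show ?thesis
    proof (cases "symm l")
      case True then show ?thesis using u by blast
    next
      case False
      \<comment> \<open>No position below \<open>l\<close> has a right tail, so the dichotomy
        provides left tails at all of them; in the mirror image these are right tails at every
        \<open>K > - l\<close>.\<close>
      then have lt: "left_tail K" if "K < l" for K using l(2) tail_dichotomy that by blast
      have mr: "m.right_tail K" if "- l < K" for K using mt[of "- K"] lt[of "- K"] that by simp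
      obtain p where p: "\<And>q. p \<le> q \<Longrightarrow> m.folds q" "m.symm p \<or> (\<forall>K<p. \<not> m.right_tail K)"
        using m.plane_stops[OF mr[of "1 - l"]] by auto
      show ?thesis
      proof (cases "m.symm p")
        case True then show ?thesis using flip p(1) by blast
      next
        case False
        have "p \<le> - l"
        proof (rule ccontr)
          assume "\<not> ?thesis"
          then obtain K where "- l < K" "K < p" using dense[of "- l" p] by auto
          then show False using mr[of K] p(2) False by blast
        qed
        \<comment> \<open>The plane from the left has reached \<open>l\<close> as well, so
          \<open>v\<close> folds about \<open>l\<close> from both sides.\<close>
        then have mf: "m.folds (- l)" by (rule p(1))
        have "symm l" unfolding symm_def
        proof
          fix y
          have a: "v z \<le> v (2 * l - z)" if "l \<le> z" for z using l(1)[of l] that by (simp add: folds_def)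
          have b: "v z \<le> v (2 * l - z)" if "z \<le> l" for z
            using mf[unfolded m.folds_def, rule_format, of "- z"] that by (simp add: algebra_simps)
          show "v y = v (2 * l - y)"
            using a[of y] b[of y] a[of "2 * l - y"] b[of "2 * l - y"] by (cases "l \<le> y") auto
        qed
        then show ?thesis using u by blast
      qed
    qed
  next
    case False
    then have mr: "m.right_tail K" for K using mt[of "- K"] tail_dichotomy by auto
    obtain p where p: "\<And>q. p \<le> q \<Longrightarrow> m.folds q" "m.symm p \<or> (\<forall>K<p. \<not> m.right_tail K)"
      using m.plane_stops[OF mr] by blast
    \<comment> \<open>The reflected profile has right tails everywhere, so the second alternative
      for \<open>p\<close> already fails at \<open>p - 1\<close>.\<close>
    have "p - 1 < p" by simp
    then have "m.symm p" using p(2) mr by blast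
    then show ?thesis using flip p(1) by blast
  qed
qed

end

section \<open>Crests, and the passage from the equation for \<open>u\<close> to a profile\<close>

lemma crest_iff_of_unimodal:
  assumes sym: "\<And>x. u x = u (2 * l - x)" and dec: "\<And>x y. l \<le> x \<Longrightarrow> x < y \<Longrightarrow> u y < u x"
  shows "crest u x \<longleftrightarrow> x = l"
proof
  have le: "u y \<le> u l" for y
  proof (cases "l \<le> y")
    case True then show ?thesis using dec[of l y] by (cases "y = l") auto
  next
    case False then show ?thesis using dec[of l "2 * l - y"] sym[of y] by auto
  qed
  then show "x = l \<Longrightarrow> crest u x" by (simp add: crest_def)
  assume "crest u x"
  then obtain d where d: "d > 0" "\<And>y. dist y x < d \<Longrightarrow> u y \<le> u x"
    unfolding crest_def eventually_nhds_metric by blast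
  show "x = l"
  proof (rule ccontr)
    assume "x \<noteq> l"
    then consider "l < x" | "x < l" by linarith
    then show False
    proof cases
      case 1
      define y where "y = max l (x - d / 2)"
      have y: "l \<le> y" "y < x" "dist y x < d" using 1 d(1) by (auto simp: y_def dist_real_def max_def)
      then show False using dec[of y x] d(2)[of y] by simp
    next
      case 2
      define y where "y = min l (x + d / 2)"
      have y: "y \<le> l" "x < y" "dist y x < d" using 2 d(1) by (auto simp: y_def dist_real_def min_def)
      then show False using dec[of "2 * l - y" "2 * l - x"] sym[of x] sym[of y] d(2)[of y] by simp
    qed
  qed
qed

text \<open>Nontriviality of \<open>u\<close> has to be assumed because every point is a crest of
  the zero function. Strict monotonicity of \<open>G\<close> on the range of \<open>u\<close> makes
  \<open>v\<close> and \<open>u\<close> order points alike, so that symmetry and decrease return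
  from \<open>v\<close> to \<open>u\<close>.\<close>

theorem theorem1p3:
  fixes c r ct :: real and m H G u :: "real \<Rightarrow> real"
  assumes "c > 0"
    and "\<And>\<xi>. m \<xi> \<noteq> c"
    and "has_inv_fourier (\<lambda>\<xi>. complex_of_real (m \<xi> / (c - m \<xi>))) (\<lambda>x. complex_of_real (H x))"
    and "integrable lebesgue H"
    and "\<And>x. H x \<ge> 0"
    and "\<And>x. H (- x) = H x"
    and "antimono_on {0<..} H"
    and "\<And>K. compact K \<Longrightarrow> bounded (G ` K)"
    and "r > 1"
    and "\<exists>C>0. \<forall>\<^sub>F s in nhds 0. \<bar>G s\<bar> \<le> C * \<bar>s\<bar> powr r"
    and "bounded (range u)"
    and "continuous_on UNIV u"
    and "(u \<longlongrightarrow> 0) at_infinity"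
    and "\<exists>x. u x \<noteq> 0"
    and "\<And>x. c * u x - G (u x) = convolution H (\<lambda>y. G (u y)) x"
    and "\<And>s. s \<in> range u \<Longrightarrow> G s \<ge> 0"
    and "strict_mono_on (range u) G"
    and "0 < ct" and "ct < c"
    and "\<And>s t. s \<in> range u \<Longrightarrow> t \<in> range u \<Longrightarrow> \<bar>G s - G t\<bar> \<le> ct * \<bar>s - t\<bar>"
  shows "\<exists>x\<^sub>0. (\<forall>x. u x = u (2 * x\<^sub>0 - x)) \<and> (\<forall>x. crest u x \<longleftrightarrow> x = x\<^sub>0)"
proof -
  note c = assms(1) and decay = assms(10) and uc = assms(12) and ul = assms(13)
    and eq = assms(15) and Gnn = assms(16) and Gmono = assms(17) and ct = assms(18,19) and Glip = assms(20)
  define v where "v = (\<lambda>x. G (u x))"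
  have Hb [measurable]: "H \<in> borel_measurable borel" by (rule antimono_even_borel[OF assms(7,6)])
  have Hi: "integrable lborel H" using assms(4) Hb by (simp add: integrable_completion)
  interpret kernel H
    by unfold_locales (use Hb Hi assms(5,6,7) in \<open>auto simp: monotone_on_def\<close>)
  have vl: "\<bar>v x - v y\<bar> \<le> ct * \<bar>u x - u y\<bar>" for x y unfolding v_def by (rule Glip) auto
  have vc: "continuous_on UNIV v"
  proof -
    have "ct-lipschitz_on (range u) G"
      by (rule lipschitz_onI) (use Glip ct in \<open>auto simp: dist_real_def\<close>)
    then have "continuous_on (range u) G" by (rule lipschitz_on_continuous_on)
    then show ?thesis unfolding v_def using uc by (rule continuous_on_compose2) auto
  qed
  have vb [measurable]: "v \<in> borel_measurable borel" using vc by (rule borel_measurable_continuous_onI)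
  have eqv: "c * u x = v x + conv v x" for x
  proof -
    have "convolution H v x = conv v x"
      unfolding convolution_def conv_def by (rule integral_completion) measurable
    then show ?thesis using eq[of x] by (simp add: v_def)
  qed
  have vnn: "0 \<le> v x" for x unfolding v_def by (rule Gnn) simp
  have cnn: "0 \<le> conv v x" for x by (rule conv_nonneg) (rule vnn)
  have vcu: "v x \<le> c * u x" for x using eqv[of x] cnn[of x] by simp
  have unn: "0 \<le> u x" for x using order_trans[OF vnn vcu, of x] c by (simp add: zero_le_mult_iff)
  obtain U where U: "\<And>x. \<bar>u x\<bar> \<le> U" using assms(11) unfolding bounded_iff by auto
  have vM: "v x \<le> c * U" for x
    by (rule order_trans[OF vcu mult_left_mono[OF abs_le_D1[OF U]]]) (use c in simp)
  have vMa: "\<bar>v x\<bar> \<le> c * U" for x using vM vnn by simp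
  obtain C where C: "0 < C" "\<forall>\<^sub>F s in nhds 0. \<bar>G s\<bar> \<le> C * \<bar>s\<bar> powr r" using decay by blast
  \<comment> \<open>The bound holds at the point \<open>s = 0\<close> itself, where
    \<open>0 powr r = 0\<close>.\<close>
  have G0: "G 0 = 0" using eventually_nhds_x_imp_x[OF C(2)] by simp
  have uless: "v x < v y \<longleftrightarrow> u x < u y" for x y
    unfolding v_def by (rule strict_mono_on_less[OF Gmono]) auto
  have ueq: "v x = v y \<longleftrightarrow> u x = u y" for x y using uless[of x y] uless[of y x] by (metis less_irrefl neqE v_def)
  obtain x1 where x1: "u x1 \<noteq> 0" using assms(14) by blast
  have small: "\<exists>y. u y < e" if "0 < e" for e
  proof -
    have "\<forall>\<^sub>F x in at_infinity. u x < e" using ul that by (rule order_tendstoD)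
    then obtain B where "\<And>x. B \<le> \<bar>x\<bar> \<Longrightarrow> u x < e" by (auto simp: eventually_at_infinity)
    from this[of "\<bar>B\<bar>"] have "u \<bar>B\<bar> < e" using abs_ge_self[of B] by simp
    then show ?thesis by blast
  qed
  \<comment> \<open>If \<open>H\<close> vanished off the origin, the equation would read
    \<open>c * u = v\<close>, and \<open>v\<close> could not have Lipschitz constant
    \<open>ct < c\<close> as a function of \<open>u\<close>.\<close>
  obtain R where R: "jump R"
  proof -
    have "\<exists>z>0. 0 < H z"
    proof (rule ccontr)
      assume "\<not> ?thesis"
      then have "H z \<le> 0" if "0 < z" for z using that by (metis not_le)
      then have "H z = 0" if "0 < z" for z using that H_nn[of z] by (metis antisym)
      then have Hz: "H z = 0" if "z \<noteq> 0" for z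
        using that H_abs[of z] by (metis zero_less_abs_iff)
      have "conv v x = 0" for x
      proof -
        have "conv v x = (\<integral>y. 0 \<partial>(lborel :: real measure))"
          unfolding conv_def
        proof (rule integral_cong_AE)
          show "AE y in lborel. H (x - y) * v y = 0"
            using AE_lborel_neq[of x] by eventually_elim (simp add: Hz)
        qed measurable
        then show ?thesis by simp
      qed
      then have cu: "c * u x = v x" for x using eqv by simp
      obtain y where y: "u y < u x1" using small[of "u x1"] unn[of x1] x1 by auto
      have "c * (u x1 - u y) \<le> ct * (u x1 - u y)"
        using vl[of x1 y] y unfolding cu[symmetric] by (simp add: right_diff_distrib)
      then show False using y ct by simp
    qed
    then show ?thesis using jump_exists that by blast
  qed
  have upos: "0 < u x" for x
  proof (rule ccontr)
    assume "\<not> 0 < u x"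
    then have ux: "u x = 0" using unn[of x] by simp
    \<comment> \<open>A zero of \<open>u\<close> is a zero of \<open>conv v\<close>, so zeros spread
      over distance \<open>R\<close>. The zero set is thus open and closed, and it is not the whole
      line.\<close>
    have spread: "u z = 0" if "u y = 0" "\<bar>y - z\<bar> < R" for y z
    proof -
      have vy: "v y = 0" using that(1) by (simp add: v_def G0)
      then have "conv v y = 0" using eqv[of y] that(1) by simp
      then have "v z = 0" by (rule conv_eq_0_imp[OF vc vnn vM _ R that(2)])
      then show ?thesis using ueq[of z y] vy that(1) by simp
    qed
    have "open {y. u y = 0}"
      unfolding open_dist
    proof (intro ballI exI conjI allI impI)
      show "0 < R" using R by (simp add: jump_def)
      show "z \<in> {y. u y = 0}" if "y \<in> {y. u y = 0}" "dist z y < R" for y z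
        using spread[of y z] that by (simp add: dist_real_def abs_minus_commute)
    qed
    moreover have "closed {y. u y = 0}" by (rule closed_Collect_eq[OF uc continuous_on_const])
    ultimately have "{y. u y = 0} = UNIV" using ux clopen[of "{y. u y = 0}"] by auto
    then show False using x1 by auto
  qed
  have vpos: "0 < v x" for x
  proof -
    obtain y where "u y < u x" using small[OF upos] by blast
    then show ?thesis using uless[of y x] vnn[of y] by linarith
  qed
  \<comment> \<open>\<open>v\<close> grows at most \<open>ct\<close> times as fast as
    \<open>u\<close>, so \<open>c * u\<close> grows at least \<open>c / ct\<close> times as fast as
    \<open>v\<close>; subtracting \<open>v\<close> itself leaves \<open>c / ct - 1\<close> for
    \<open>conv v\<close>.\<close>
  define \<kappa> where "\<kappa> = c / ct - 1"
  have \<kappa>: "0 < \<kappa>" using ct by (simp add: \<kappa>_def)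
  have mono: "\<kappa> * (v y - v x) \<le> conv v y - conv v x" if xy: "v x \<le> v y" for x y
  proof -
    have "u x \<le> u y" using xy uless[of y x] by linarith
    then have "v y - v x \<le> ct * (u y - u x)" using vl[of y x] by (simp add: abs_le_iff)
    then have "c / ct * (v y - v x) \<le> c / ct * (ct * (u y - u x))"
      using c ct by (intro mult_left_mono) auto
    also have "\<dots> = c * u y - c * u x" using ct by (simp add: right_diff_distrib)
    finally show ?thesis unfolding eqv by (simp add: \<kappa>_def algebra_simps)
  qed
  obtain \<Lambda> where "0 \<le> \<Lambda>" and \<Lambda>: "\<And>x y. \<bar>v x - v y\<bar> \<le> \<Lambda> * \<bar>x - y\<bar>"
    by (rule lipschitz_of_equation[OF vb vMa \<kappa>], erule mono) (rule that)
  have vint: "integrable lborel v"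
  proof (rule integrable_of_equation[OF uc ul unn vc vnn vM c eqv])
    fix e :: real assume "0 < e"
    then have "\<forall>\<^sub>F s in nhds 0. \<bar>G s\<bar> \<le> e * \<bar>s\<bar>"
      using superlinear_vanishing[OF C(2,1) assms(9)] by blast
    then have "\<forall>\<^sub>F x in at_infinity. \<bar>G (u x)\<bar> \<le> e * \<bar>u x\<bar>"
      using ul by (rule eventually_compose_filterlim)
    then show "\<exists>N. \<forall>x. N \<le> \<bar>x\<bar> \<longrightarrow> v x \<le> e * u x"
      unfolding abs_of_nonneg[OF unn] abs_of_nonneg[OF vnn[unfolded v_def]]
        eventually_at_infinity v_def real_norm_def .
  qed
  have vlim: "(v \<longlongrightarrow> 0) at_infinity"
  proof (rule tendsto_sandwich[OF _ _ tendsto_const])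
    show "((\<lambda>x. c * u x) \<longlongrightarrow> 0) at_infinity" by (rule tendsto_mult_right_zero[OF ul])
  qed (use vnn vcu in auto)
  interpret profile H v \<kappa> \<Lambda> R
    by unfold_locales (use vpos vlim vint \<Lambda> \<kappa> mono R in auto)
  obtain l where l: "unimodal l" using symmetric_unimodal by blast
  have sym: "u x = u (2 * l - x)" for x
    using l ueq[of x "2 * l - x"] unfolding unimodal_def symm_def by blast
  have dec: "u y < u x" if "l \<le> x" "x < y" for x y
    using l that uless[of y x] unfolding unimodal_def by blast
  have "crest u x \<longleftrightarrow> x = l" for x by (rule crest_iff_of_unimodal) (use sym dec in auto)
  then show ?thesis using sym by blast
qed

end
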